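(* Let $X\subset\mathbf{R}^n$ be a locally closed set with flat tangent cones (i.e., $T_pX$ is flat for every $p\in X$) and positive support. Suppose that either $X$ is a hypersurface, or there is a constant $m<3/2$ such that the multiplicity of each $T_pX$, $p\in X$, is at most $m$. Then $X$ is a $\mathcal{C}^1$ hypersurface; furthermore, if $X$ has double positive support, then it is a $\mathcal{C}^{1,1}$ hypersurface.
   Context: Locally closed: the intersection of a closed set with an open set of $\mathbf{R}^n$. Tangent cone: for $X\subset\mathbf{R}^n$ and $p\in X$, a ray with origin $p$ and direction $u\in\mathbf{S}^{n-1}$ is the set $\{p+tu : t\ge 0\}$; rays with origin $p$ are topologized by the distance $\|u-u'\|$ between directions. $T_pX$ is the union of all rays $\ell$ with origin $p$ for which there is a sequence $p_i\in X\smallsetminus\{p\}$ converging to $p$ such that the rays from $p$ through $p_i$ converge to $\ell$. $T_pX$ is flat if it is a hyperplane. Hypersurface: a subset of $\mathbf{R}^n$ which (with the subspace topology) is locally homeomorphic to $\mathbf{R}^{n-1}$. It is $\mathcal{C}^1$ (resp. $\mathcal{C}^{1,1}$) if it may be represented locally (after a rigid motion) as the graph of a continuously differentiable function (resp. of a function with Lipschitz continuous derivative). Positive support: there is a uniform constant $r>0$ such that through each point of $X$ there passes a (closed) ball of radius $r$ whose interior is disjoint from $X$. Double positive support: there is a uniform constant $r>0$ such that through each point of $X$ there pass two such balls of radius $r$ with disjoint interiors. Multiplicity of a flat tangent cone $T_pX$: the $(n-1)$-dimensional lower density of $X$ at $p$, $$\liminf_{r\to 0}\frac{\mathcal{H}^{n-1}(X\cap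 B^n(p,r))}{\mathcal{H}^{n-1}(r\mathbf{B}^{n-1})},$$ where $\mathcal{H}^{n-1}$ is Hausdorff measure, $B^n(p,r)$ is the closed ball of radius $r$ about $p$, and $\mathbf{B}^{n-1}$ is the closed unit ball of $\mathbf{R}^{n-1}$. *)

theory Defs
  imports "HOL-Analysis.Analysis"
begin

definition locally_closed :: "'a::topological_space set \<Rightarrow> bool" where
  "locally_closed X \<longleftrightarrow> (\<exists>C U. closed C \<and> open U \<and> X = C \<inter> U)"

subsection \<open>Tangent cones\<close>

definition ray :: "'a::real_vector \<Rightarrow> 'a \<Rightarrow> 'a set" where
  "ray p u = {p + t *\<^sub>R u | t. 0 \<le> t}"

definition direction :: "'a::real_normed_vector \<Rightarrow> 'a \<Rightarrow> 'a" where
  "direction p q = (q - p) /\<^sub>R norm (q - p)"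

definition tangent_cone :: "'a::real_normed_vector set \<Rightarrow> 'a \<Rightarrow> 'a set" where
  "tangent_cone X p =
     \<Union> {ray p u | u. norm u = 1 \<and>
           (\<exists>q :: nat \<Rightarrow> 'a. (\<forall>i. q i \<in> X - {p}) \<and> q \<longlonglongrightarrow> p \<and>
              (\<lambda>i. direction p (q i)) \<longlonglongrightarrow> u)}"

definition is_hyperplane :: "'a::real_inner set \<Rightarrow> bool" where
  "is_hyperplane H \<longleftrightarrow> (\<exists>a b. a \<noteq> 0 \<and> H = {x. a \<bullet> x = b})"

definition flat_tangent_cones :: "'a::real_inner set \<Rightarrow> bool" where
  "flat_tangent_cones X \<longleftrightarrow> (\<forall>p\<in>X. is_hyperplane (tangent_cone X p))"

subsection \<open>Support by balls\<close>

definition positive_support :: "'a::metric_space set \<Rightarrow> bool" where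
  "positive_support X \<longleftrightarrow>
     (\<exists>r>0. \<forall>p\<in>X. \<exists>c. p \<in> cball c r \<and> interior (cball c r) \<inter> X = {})"

definition double_positive_support :: "'a::metric_space set \<Rightarrow> bool" where
  "double_positive_support X \<longleftrightarrow>
     (\<exists>r>0. \<forall>p\<in>X. \<exists>c c'.
        p \<in> cball c r \<and> interior (cball c r) \<inter> X = {} \<and>
        p \<in> cball c' r \<and> interior (cball c' r) \<inter> X = {} \<and>
        interior (cball c r) \<inter> interior (cball c' r) = {})"

subsection \<open>Hypersurfaces\<close>

text \<open>
  There is no type of dimension \<open>CARD('n) - 1\<close>, so $\mathbf{R}^{n-1}$ is taken to be the
  coordinate hyperplane of $\mathbf{R}^n$ on which one fixed coordinate, thought of as the last
  one, vanishes. The index type carries no order; since permuting the coordinates is an isometry,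
  it does not matter which coordinate is singled out.
\<close>

definition last_coord :: "'n::finite" where
  "last_coord = (SOME k. True)"

definition horizontal :: "(real ^ 'n::finite) set" where
  "horizontal = {x. x $ last_coord = 0}"

definition hypersurface :: "(real ^ 'n::finite) set \<Rightarrow> bool" where
  "hypersurface X \<longleftrightarrow>
     (\<forall>p\<in>X. \<exists>U W. p \<in> U \<and> openin (top_of_set X) U \<and>
        openin (top_of_set (horizontal :: (real ^ 'n) set)) W \<and> U homeomorphic W)"

definition rigid_motion :: "('a::real_inner \<Rightarrow> 'a) \<Rightarrow> bool" where
  "rigid_motion \<rho> \<longleftrightarrow> (\<exists>c Q. orthogonal_transformation Q \<and> \<rho> = (\<lambda>x. c + Q x))"

definition graph_over :: "(real ^ 'n::finite) set \<Rightarrow> (real ^ 'n \<Rightarrow> real) \<Rightarrow> (real ^ 'n) set" where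
  "graph_over W f = (\<lambda>y. y + f y *\<^sub>R axis last_coord 1) ` W"

text \<open>
  The derivative of a function on an open subset \<open>W\<close> of $\mathbf{R}^{n-1}$ is represented by its
  gradient, a vector of $\mathbf{R}^{n-1}$; this identification is isometric, so continuity and
  Lipschitz continuity of the derivative are those of the gradient. The filter
  \<open>at y within horizontal\<close> makes it a derivative along $\mathbf{R}^{n-1}$ only.
\<close>

definition has_gradient_on ::
    "(real ^ 'n::finite \<Rightarrow> real) \<Rightarrow> (real ^ 'n \<Rightarrow> real ^ 'n) \<Rightarrow> (real ^ 'n) set \<Rightarrow> bool" where
  "has_gradient_on f g W \<longleftrightarrow>
     (\<forall>y\<in>W. g y \<in> horizontal \<and> (f has_derivative (\<lambda>h. g y \<bullet> h)) (at y within horizontal))"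

definition C1_fun_on :: "(real ^ 'n::finite) set \<Rightarrow> (real ^ 'n \<Rightarrow> real) \<Rightarrow> bool" where
  "C1_fun_on W f \<longleftrightarrow> (\<exists>g. has_gradient_on f g W \<and> continuous_on W g)"

definition C11_fun_on :: "(real ^ 'n::finite) set \<Rightarrow> (real ^ 'n \<Rightarrow> real) \<Rightarrow> bool" where
  "C11_fun_on W f \<longleftrightarrow> (\<exists>g L. has_gradient_on f g W \<and> L-lipschitz_on W g)"

definition locally_graph ::
    "((real ^ 'n::finite) set \<Rightarrow> (real ^ 'n \<Rightarrow> real) \<Rightarrow> bool) \<Rightarrow> (real ^ 'n) set \<Rightarrow> bool" where
  "locally_graph R X \<longleftrightarrow>
     (\<forall>p\<in>X. \<exists>U \<rho> W f. open U \<and> p \<in> U \<and> rigid_motion \<rho> \<and>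
        openin (top_of_set horizontal) W \<and> R W f \<and> \<rho> ` (X \<inter> U) = graph_over W f)"

definition C1_hypersurface :: "(real ^ 'n::finite) set \<Rightarrow> bool" where
  "C1_hypersurface X \<longleftrightarrow> hypersurface X \<and> locally_graph C1_fun_on X"

definition C11_hypersurface :: "(real ^ 'n::finite) set \<Rightarrow> bool" where
  "C11_hypersurface X \<longleftrightarrow> hypersurface X \<and> locally_graph C11_fun_on X"

subsection \<open>Hausdorff measure and multiplicity\<close>

text \<open>
  Normalised so that the \<open>d\<close>-dimensional Hausdorff measure on $\mathbf{R}^d$ is Lebesgue measure.
  The empty set needs its own case because \<open>0 ^ 0 = 1\<close>. Boundedness of the covering sets is
  required explicitly because \<open>diameter\<close> has no meaningful value on unbounded sets.
\<close>

definition hausdorff_gauge :: "nat \<Rightarrow> 'a::metric_space set \<Rightarrow> ennreal" where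
  "hausdorff_gauge d S =
     (if S = {} then 0 else ennreal (unit_ball_vol (real d) * (diameter S / 2) ^ d))"

definition hausdorff_pre :: "nat \<Rightarrow> real \<Rightarrow> 'a::metric_space set \<Rightarrow> ennreal" where
  "hausdorff_pre d \<delta> A =
     (INF C \<in> {C :: nat \<Rightarrow> 'a set. A \<subseteq> (\<Union>i. C i) \<and> (\<forall>i. bounded (C i) \<and> diameter (C i) \<le> \<delta>)}.
        \<Sum>i. hausdorff_gauge d (C i))"

definition hausdorff_measure :: "nat \<Rightarrow> 'a::metric_space set \<Rightarrow> ennreal" where
  "hausdorff_measure d A = (SUP \<delta>\<in>{0<..}. hausdorff_pre d \<delta> A)"

definition multiplicity_at :: "(real ^ 'n::finite) set \<Rightarrow> real ^ 'n \<Rightarrow> ennreal" where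
  "multiplicity_at X p =
     Liminf (at_right 0) (\<lambda>r.
       hausdorff_measure (CARD('n) - 1) (X \<inter> cball p r) /
       hausdorff_measure (CARD('n) - 1) ((horizontal :: (real ^ 'n) set) \<inter> cball 0 r))"

end

theory Submission
  imports Defs
begin

text \<open>
Fix \<open>p \<in> X\<close> and a supporting ball at \<open>p\<close> whose centre lies in the unit direction \<open>e\<close>. No tangent
direction of \<open>X\<close> at \<open>p\<close> can point into that ball, so a tangent cone that is a hyperplane has to be
the one orthogonal to \<open>e\<close>. Supporting balls of a fixed radius pass to limits; hence the normal
line depends continuously on the point, and near \<open>p\<close> all tangent hyperplanes are nearly orthogonal
to \<open>e\<close>.

Call \<open>e\<close> vertical. Each point near \<open>p\<close> has a supporting ball almost straight above or almost
straight below it, so it is the highest or the lowest point of \<open>X\<close> on its vertical line: at most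
two sheets lie over a small disk of the horizontal hyperplane. Over every point of the disk there
is at least one, because a point of \<open>X\<close> whose projection is nearest to an uncovered point would
have no tangent direction leading towards that point (\<open>shadow_open\<close>). The same openness of
the projection, applied at every point of \<open>X\<close>, makes the height of the top sheet continuous
(\<open>upper_height_continuous\<close>); the bottom sheet is the top sheet of the picture turned upside down.
The two sheets meet at \<open>p\<close>, since the tangent cone there contains no vertical direction.

It remains to show that the sheets coincide near \<open>p\<close>. If \<open>X\<close> is a hypersurface, invariance of
domain makes the bottom sheet open in \<open>X\<close>, so the top sheet lies in it near \<open>p\<close>
(\<open>single_sheet_of_hypersurface\<close>). Suppose instead that the multiplicities are bounded by
\<open>m < 3 / 2\<close>. If the sheets were distinct over points arbitrarily close to \<open>p\<close>, there would be a ball in the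
hyperplane over which they are distinct, with a point over which they meet on its
boundary. At the corresponding point of \<open>X\<close>, two sheets lie over almost a half-ball and one over
the opposite half-ball. Projection along \<open>e\<close> does not increase Hausdorff measure, and the sheets
are almost horizontal, so the lower density there is at least nearly \<open>3 / 2\<close>, which is impossible
(\<open>single_sheet_of_multiplicity\<close>).

Finally, a single sheet is the graph of a function \<open>f\<close> whose tangent hyperplanes exist and vary
continuously, so \<open>f\<close> is continuously differentiable. With supporting balls on both sides, \<open>f\<close>
differs from its linear approximations by at most a constant times the square of the distance,
uniformly in the base point, and this makes the gradient Lipschitz
(\<open>lipschitz_of_quadratic_approximation\<close>).
\<close>

section \<open>Supporting balls and tangent hyperplanes\<close>

text \<open>
For \<open>norm u = 1\<close> and \<open>0 < r\<close>, the inequality is \<open>r \<le> dist (p + r *\<^sub>R u) z\<close> squared and expanded: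
\<open>X\<close> misses the open ball of radius \<open>r\<close> centred at \<open>p + r *\<^sub>R u\<close>. In this form the condition is
visibly closed in \<open>p\<close> and \<open>u\<close>.
\<close>
definition supporting_normal :: "'a::real_inner set \<Rightarrow> real \<Rightarrow> 'a \<Rightarrow> 'a \<Rightarrow> bool" where
  "supporting_normal X r p u \<longleftrightarrow>
     norm u = 1 \<and> (\<forall>z\<in>X. 2 * r * (u \<bullet> (z - p)) \<le> (norm (z - p))\<^sup>2)"

lemma supporting_normal_of_ball:
  fixes X :: "'a::euclidean_space set"
  assumes "0 < r" "p \<in> X" "p \<in> cball c r" "interior (cball c r) \<inter> X = {}"
  shows "supporting_normal X r p ((c - p) /\<^sub>R r)"
proof -
  have out: "r \<le> dist c z" if "z \<in> X" for z
    using assms(4) that by (fastforce simp: interior_cball not_le)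
  have d: "norm (c - p) = r"
    using out[OF assms(2)] assms(3) by (simp add: dist_norm)
  have "2 * r * (((c - p) /\<^sub>R r) \<bullet> (z - p)) \<le> (norm (z - p))\<^sup>2" if "z \<in> X" for z
  proof -
    have "r\<^sup>2 \<le> (norm (c - z))\<^sup>2"
      using out[OF that] assms(1) by (simp add: dist_norm power_mono)
    moreover have "(norm (c - z))\<^sup>2
        = (norm (c - p))\<^sup>2 - 2 * ((c - p) \<bullet> (z - p)) + (norm (z - p))\<^sup>2"
      unfolding power2_norm_eq_inner by (simp add: inner_diff_left inner_diff_right inner_commute)
    ultimately have "r\<^sup>2 \<le> (norm (c - p))\<^sup>2 - 2 * ((c - p) \<bullet> (z - p)) + (norm (z - p))\<^sup>2"
      by simp
    moreover have "r * (((c - p) /\<^sub>R r) \<bullet> (z - p)) = (c - p) \<bullet> (z - p)"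
      using assms(1) by simp
    ultimately show ?thesis using d by (simp only: mult.assoc)
  qed
  then show ?thesis using d assms(1) by (simp add: supporting_normal_def)
qed

lemma inner_direction: "u \<bullet> direction p q = (u \<bullet> (q - p)) / norm (q - p)"
  for p q :: "'a::real_inner"
  by (simp add: direction_def divide_inverse mult.commute)

lemma mem_tangent_cone_iff:
  "x \<in> tangent_cone X p \<longleftrightarrow>
     (\<exists>t u q. x = p + t *\<^sub>R u \<and> 0 \<le> t \<and> norm u = 1 \<and> (\<forall>i::nat. q i \<in> X - {p}) \<and>
        q \<longlonglongrightarrow> p \<and> (\<lambda>i. direction p (q i)) \<longlonglongrightarrow> u)"
  unfolding tangent_cone_def ray_def by blast

lemma apex_in_tangent_cone: "x \<in> tangent_cone X p \<Longrightarrow> p \<in> tangent_cone X p"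
  unfolding mem_tangent_cone_iff by (metis add.right_neutral order_refl scale_zero_left)

text \<open>
The ball keeps every secant direction from pointing much towards its centre, so the tangent cone
lies in the half-space opposite to \<open>u\<close>. A hyperplane through \<open>p\<close> contained in a half-space bounded
by another hyperplane through \<open>p\<close> is that other hyperplane.
\<close>
lemma tangent_cone_eq_orthogonal:
  assumes hyp: "is_hyperplane (tangent_cone X p)" and r_pos: "0 < r"
    and u: "supporting_normal X r p u"
  shows "tangent_cone X p = {x. u \<bullet> (x - p) = 0}"
proof -
  obtain a b where a: "a \<noteq> 0" and T: "tangent_cone X p = {x. a \<bullet> x = b}"
    using hyp unfolding is_hyperplane_def by blast
  have "(b / (a \<bullet> a)) *\<^sub>R a \<in> tangent_cone X p" using a by (simp add: T)
  then have "p \<in> tangent_cone X p" by (rule apex_in_tangent_cone)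
  then have b: "b = a \<bullet> p" by (simp add: T)
  have half: "u \<bullet> (x - p) \<le> 0" if x: "x \<in> tangent_cone X p" for x
  proof -
    obtain w t q where x_eq: "x = p + t *\<^sub>R w" "0 \<le> t" and q: "\<forall>i. q i \<in> X - {p}"
        "q \<longlonglongrightarrow> p" "(\<lambda>i. direction p (q i)) \<longlonglongrightarrow> w"
      using x unfolding mem_tangent_cone_iff by blast
    have "u \<bullet> direction p (q i) \<le> norm (q i - p) / (2 * r)" for i
    proof -
      have "2 * r * (u \<bullet> (q i - p)) \<le> (norm (q i - p))\<^sup>2" "norm (q i - p) > 0"
        using u spec[OF q(1), of i] by (auto simp: supporting_normal_def)
      then show ?thesis using r_pos
        by (simp add: inner_direction field_simps power2_eq_square)
    qed
    moreover have "(\<lambda>i. norm (q i - p) / (2 * r)) \<longlonglongrightarrow> norm (p - p) / (2 * r)"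
      using r_pos by (intro tendsto_intros q) auto
    moreover have "(\<lambda>i. u \<bullet> direction p (q i)) \<longlonglongrightarrow> u \<bullet> w" by (intro tendsto_intros q)
    ultimately have "u \<bullet> w \<le> norm (p - p) / (2 * r)" by (meson LIMSEQ_le)
    then show ?thesis using x_eq by (simp add: mult_nonneg_nonpos)
  qed
  have zero: "u \<bullet> w = 0" if "a \<bullet> w = 0" for w
  proof -
    have "p + w \<in> tangent_cone X p" "p - w \<in> tangent_cone X p"
      using that by (auto simp: T b inner_add_right inner_diff_right)
    from half[OF this(1)] half[OF this(2)] show ?thesis by simp
  qed
  \<comment> \<open>the part of \<open>u\<close> orthogonal to \<open>a\<close>, which has to vanish\<close>
  define w where "w = u - (a \<bullet> u / (a \<bullet> a)) *\<^sub>R a"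
  have "a \<bullet> w = 0" using a by (simp add: w_def inner_diff_right)
  with zero[OF this] have "w \<bullet> w = 0" by (simp add: w_def inner_diff_left)
  then obtain c where ua: "u = c *\<^sub>R a" by (auto simp: w_def)
  then have "c \<noteq> 0" using u unfolding supporting_normal_def by auto
  then have "u \<bullet> (x - p) = 0 \<longleftrightarrow> a \<bullet> (x - p) = 0" for x
    using ua by simp
  then show ?thesis by (auto simp: T b inner_diff_right)
qed

locale flat_supported =
  fixes X :: "'a::euclidean_space set" and r :: real
  assumes r_pos: "0 < r"
    and locally_closed: "locally_closed X"
    and flat: "flat_tangent_cones X"
    and supported: "\<And>p. p \<in> X \<Longrightarrow> \<exists>u. supporting_normal X r p u"
begin

lemma tangent_cone_eq:
  assumes "p \<in> X" "supporting_normal X r p u"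
  shows "tangent_cone X p = {x. u \<bullet> (x - p) = 0}"
  using assms flat r_pos unfolding flat_tangent_cones_def
  by (intro tangent_cone_eq_orthogonal) auto

lemma tangent_direction_orthogonal:
  assumes "p \<in> X" "supporting_normal X r p u"
    and "norm w = 1" "\<And>i. q i \<in> X - {p}" "q \<longlonglongrightarrow> p" "(\<lambda>i. direction p (q i)) \<longlonglongrightarrow> w"
  shows "u \<bullet> w = 0"
proof -
  have "p + 1 *\<^sub>R w \<in> tangent_cone X p"
    unfolding mem_tangent_cone_iff using assms(3-6) zero_le_one by blast
  then show ?thesis using tangent_cone_eq[OF assms(1,2)] by simp
qed

lemma norm_direction: "q \<noteq> p \<Longrightarrow> norm (direction p q) = 1" for p q :: "'b::real_normed_vector"
  by (simp add: direction_def)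

text \<open>
Were this false, secant directions making a definite angle with the hyperplane would accumulate,
by compactness of the unit sphere, at a tangent direction off the hyperplane.
\<close>
lemma flat_approach:
  assumes "p \<in> X" "supporting_normal X r p u" "0 < \<epsilon>"
  shows "\<exists>\<delta>>0. \<forall>z\<in>X. norm (z - p) < \<delta> \<longrightarrow> \<bar>u \<bullet> (z - p)\<bar> \<le> \<epsilon> * norm (z - p)"
proof (rule ccontr)
  assume "\<not> ?thesis"
  then have "\<exists>z\<in>X. norm (z - p) < \<delta> \<and> \<bar>u \<bullet> (z - p)\<bar> > \<epsilon> * norm (z - p)" if "0 < \<delta>" for \<delta>
    using that by (simp add: not_le)
  from this[of "inverse (real (Suc n))" for n]
  have "\<forall>n. \<exists>z\<in>X. norm (z - p) < inverse (real (Suc n)) \<and> \<bar>u \<bullet> (z - p)\<bar> > \<epsilon> * norm (z - p)"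
    by simp
  then obtain z where z: "\<And>n. z n \<in> X" "\<And>n. norm (z n - p) < inverse (real (Suc n))"
      "\<And>n. \<bar>u \<bullet> (z n - p)\<bar> > \<epsilon> * norm (z n - p)"
    by metis
  have ne: "z n \<noteq> p" for n using z(3)[of n] by auto
  have lim: "z \<longlonglongrightarrow> p"
  proof (rule LIM_zero_cancel, rule Lim_null_comparison)
    show "\<forall>\<^sub>F n in sequentially. norm (z n - p) \<le> inverse (real (Suc n))"
      using z(2) less_imp_le by (intro always_eventually) blast
    show "(\<lambda>n. inverse (real (Suc n))) \<longlonglongrightarrow> 0" by (rule LIMSEQ_inverse_real_of_nat)
  qed
  have "\<forall>n. direction p (z n) \<in> sphere 0 1" using ne by (simp add: norm_direction)
  then obtain w s where w: "w \<in> sphere 0 1" and s: "strict_mono (s::nat\<Rightarrow>nat)"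
      and lw: "((\<lambda>n. direction p (z n)) \<circ> s) \<longlonglongrightarrow> w"
    using compact_sphere[of "0::'a" 1] unfolding compact_def by meson
  have "u \<bullet> w = 0"
  proof (rule tangent_direction_orthogonal[OF assms(1,2)])
    show "(\<lambda>i. (z \<circ> s) i) \<longlonglongrightarrow> p" using LIMSEQ_subseq_LIMSEQ[OF lim s] by (simp add: o_def)
    show "(\<lambda>i. direction p ((z \<circ> s) i)) \<longlonglongrightarrow> w" using lw by (simp add: o_def)
  qed (use w z ne in auto)
  moreover have "\<epsilon> \<le> \<bar>u \<bullet> direction p (z n)\<bar>" for n
  proof -
    have "\<bar>u \<bullet> direction p (z n)\<bar> = \<bar>u \<bullet> (z n - p)\<bar> / norm (z n - p)"
      by (simp add: inner_direction)
    then show ?thesis using z(3)[of n] ne[of n] by (simp add: pos_le_divide_eq less_imp_le)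
  qed
  moreover have "(\<lambda>n. \<bar>u \<bullet> direction p (z (s n))\<bar>) \<longlonglongrightarrow> \<bar>u \<bullet> w\<bar>"
    using lw by (intro tendsto_intros) (simp add: o_def)
  ultimately have "\<epsilon> \<le> \<bar>u \<bullet> w\<bar>" by (intro LIMSEQ_le_const) auto
  then show False using assms(3) \<open>u \<bullet> w = 0\<close> by simp
qed

text \<open>
The converse of \<open>flat_approach\<close>: because the tangent cone is the full hyperplane, \<open>X\<close> really
leaves \<open>p\<close> in every direction of that hyperplane.
\<close>
lemma tangent_direction_attained:
  assumes "p \<in> X" "supporting_normal X r p u" "norm w = 1" "u \<bullet> w = 0" "0 < \<epsilon>"
  shows "\<exists>q\<in>X. q \<noteq> p \<and> norm (q - p) < \<epsilon> \<and> norm (direction p q - w) < \<epsilon>"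
proof -
  have "p + w \<in> tangent_cone X p" using assms tangent_cone_eq by simp
  then obtain v t q where v: "p + w = p + t *\<^sub>R v" "0 \<le> t" "norm v = 1"
      and q: "\<forall>i. q i \<in> X - {p}" "q \<longlonglongrightarrow> p" "(\<lambda>i. direction p (q i)) \<longlonglongrightarrow> v"
    unfolding mem_tangent_cone_iff by blast
  have "t = 1" using v assms(3) by auto
  then have "v = w" using v by simp
  then have "\<forall>\<^sub>F i in sequentially. norm (q i - p) < \<epsilon> \<and> norm (direction p (q i) - w) < \<epsilon>"
    using q assms(5) unfolding tendsto_iff dist_norm by (auto intro: eventually_conj)
  then obtain i where "norm (q i - p) < \<epsilon>" "norm (direction p (q i) - w) < \<epsilon>"
    by (auto simp: eventually_sequentially)
  then show ?thesis using q(1) by blast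
qed

lemma supporting_normal_unique:
  assumes "p \<in> X" "supporting_normal X r p u" "supporting_normal X r p v"
  shows "v = u \<or> v = - u"
proof -
  define w where "w = v - (u \<bullet> v) *\<^sub>R u"
  have uu: "u \<bullet> u = 1" and nv: "norm v = 1" and nu: "norm u = 1"
    using assms(2,3) by (auto simp: supporting_normal_def norm_eq_1)
  have uw: "u \<bullet> w = 0" by (simp add: w_def inner_diff_right uu)
  then have "p + w \<in> tangent_cone X p" using tangent_cone_eq[OF assms(1,2)] by simp
  then have vw: "v \<bullet> w = 0" using tangent_cone_eq[OF assms(1,3)] by simp
  have "w \<bullet> w = v \<bullet> w - (u \<bullet> v) * (u \<bullet> w)" by (simp add: w_def inner_diff_left)
  then obtain c where v: "v = c *\<^sub>R u" using uw vw by (auto simp: w_def)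
  then have "\<bar>c\<bar> = 1" using nu nv by simp
  then show ?thesis using v by (auto simp: abs_if split: if_splits)
qed

text \<open>
A limit of supporting normals at points tending to \<open>p\<close> is a supporting normal at \<open>p\<close>, and there
the tangent cone leaves only \<open>u\<close> and \<open>- u\<close>. The sign is undetermined: there may be supporting balls
on either side.
\<close>
lemma normals_continuous:
  assumes "p \<in> X" "supporting_normal X r p u" "0 < \<epsilon>"
  shows "\<exists>\<delta>>0. \<forall>x\<in>X. \<forall>v. norm (x - p) < \<delta> \<longrightarrow> supporting_normal X r x v \<longrightarrow>
           norm (v - u) < \<epsilon> \<or> norm (v + u) < \<epsilon>"
proof (rule ccontr)
  assume "\<not> ?thesis"
  then have "\<exists>x\<in>X. \<exists>v. norm (x - p) < \<delta> \<and> supporting_normal X r x v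
      \<and> \<epsilon> \<le> norm (v - u) \<and> \<epsilon> \<le> norm (v + u)" if "0 < \<delta>" for \<delta>
    using that by (simp add: not_le not_less) (metis leD)
  from this[of "inverse (real (Suc n))" for n]
  have "\<forall>n. \<exists>x\<in>X. \<exists>v. norm (x - p) < inverse (real (Suc n)) \<and> supporting_normal X r x v
      \<and> \<epsilon> \<le> norm (v - u) \<and> \<epsilon> \<le> norm (v + u)"
    by simp
  then obtain x v where x: "\<And>n. x n \<in> X" "\<And>n. norm (x n - p) < inverse (real (Suc n))"
      and v: "\<And>n. supporting_normal X r (x n) (v n)"
      and far: "\<And>n. \<epsilon> \<le> norm (v n - u)" "\<And>n. \<epsilon> \<le> norm (v n + u)"
    by metis
  have lim: "x \<longlonglongrightarrow> p"
  proof (rule LIM_zero_cancel, rule Lim_null_comparison)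
    show "\<forall>\<^sub>F n in sequentially. norm (x n - p) \<le> inverse (real (Suc n))"
      using x(2) less_imp_le by (intro always_eventually) blast
    show "(\<lambda>n. inverse (real (Suc n))) \<longlonglongrightarrow> 0" by (rule LIMSEQ_inverse_real_of_nat)
  qed
  have "\<forall>n. v n \<in> sphere 0 1" using v by (simp add: supporting_normal_def)
  then obtain w s where w: "w \<in> sphere 0 1" and s: "strict_mono (s::nat\<Rightarrow>nat)"
      and lw: "(v \<circ> s) \<longlonglongrightarrow> w"
    using compact_sphere[of "0::'a" 1] unfolding compact_def by meson
  have lx: "(x \<circ> s) \<longlonglongrightarrow> p" using LIMSEQ_subseq_LIMSEQ[OF lim s] .
  have "supporting_normal X r p w"
    unfolding supporting_normal_def
  proof (intro conjI ballI)
    show "norm w = 1" using w by simp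
    fix z assume z: "z \<in> X"
    show "2 * r * (w \<bullet> (z - p)) \<le> (norm (z - p))\<^sup>2"
    proof (rule LIMSEQ_le)
      show "(\<lambda>n. 2 * r * ((v \<circ> s) n \<bullet> (z - (x \<circ> s) n))) \<longlonglongrightarrow> 2 * r * (w \<bullet> (z - p))"
        by (intro tendsto_intros lw lx)
      show "(\<lambda>n. (norm (z - (x \<circ> s) n))\<^sup>2) \<longlonglongrightarrow> (norm (z - p))\<^sup>2"
        by (intro tendsto_intros lx)
    qed (use v z in \<open>auto simp: supporting_normal_def\<close>)
  qed
  then have "w = u \<or> w = - u" using supporting_normal_unique assms(1,2) by blast
  moreover have "\<epsilon> \<le> norm (w - u)"
  proof (rule LIMSEQ_le_const)
    show "(\<lambda>n. norm ((v \<circ> s) n - u)) \<longlonglongrightarrow> norm (w - u)" by (intro tendsto_intros lw)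
  qed (use far in auto)
  moreover have "\<epsilon> \<le> norm (w + u)"
  proof (rule LIMSEQ_le_const)
    show "(\<lambda>n. norm ((v \<circ> s) n + u)) \<longlonglongrightarrow> norm (w + u)" by (intro tendsto_intros lw)
  qed (use far in auto)
  ultimately show False using assms(3) by auto
qed

end

section \<open>Projection along the normal and local sheets\<close>

text \<open>
For a unit vector \<open>e\<close> this is the orthogonal projection along \<open>e\<close> onto the hyperplane orthogonal to
\<open>e\<close>.
\<close>
definition shadow :: "'a::real_inner \<Rightarrow> 'a \<Rightarrow> 'a" where
  "shadow e x = x - (e \<bullet> x) *\<^sub>R e"

lemma mem_cball_iff_norm: "x \<in> cball p \<rho> \<longleftrightarrow> norm (x - p) \<le> \<rho>"
  for p :: "'a::real_normed_vector"
  by (simp add: dist_norm norm_minus_commute)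

lemma shadow_diff: "shadow e (x - y) = shadow e x - shadow e y"
  by (simp add: shadow_def inner_diff_right scaleR_diff_left)

lemma shadow_minus [simp]: "shadow (- e) x = shadow e x"
  by (simp add: shadow_def)

lemma shadow_decomp: "shadow e x + (e \<bullet> x) *\<^sub>R e = x"
  by (simp add: shadow_def)

lemma continuous_on_shadow [continuous_intros]:
  "continuous_on S f \<Longrightarrow> continuous_on S (\<lambda>x. shadow e (f x))"
  unfolding shadow_def by (intro continuous_intros)

context
  fixes e :: "'a::real_inner"
  assumes e: "norm e = 1"
begin

lemma inner_shadow [simp]: "e \<bullet> shadow e x = 0"
  using e by (simp add: shadow_def inner_diff_right norm_eq_1)

lemma shadow_orthogonal: "e \<bullet> y = 0 \<Longrightarrow> shadow e (y + h *\<^sub>R e) = y"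
  using e by (simp add: shadow_def inner_add_right norm_eq_1)

lemma height_orthogonal: "e \<bullet> y = 0 \<Longrightarrow> e \<bullet> (y + h *\<^sub>R e) = h"
  using e by (simp add: inner_add_right norm_eq_1)

lemma norm_shadow_squared: "(norm x)\<^sup>2 = (norm (shadow e x))\<^sup>2 + (e \<bullet> x)\<^sup>2"
proof -
  let ?s = "shadow e x" and ?h = "e \<bullet> x"
  have "x \<bullet> x = (?s + ?h *\<^sub>R e) \<bullet> (?s + ?h *\<^sub>R e)" by (simp only: shadow_decomp)
  also have "\<dots> = ?s \<bullet> ?s + ?h * ?h"
    using inner_shadow[of x] inner_commute[of ?s e] e
    by (simp only: inner_add_left inner_add_right inner_scaleR_left inner_scaleR_right norm_eq_1) simp
  finally show ?thesis by (simp only: power2_norm_eq_inner power2_eq_square[of ?h])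
qed

lemma norm_shadow_le: "norm (shadow e x) \<le> norm x"
  by (rule power2_le_imp_le) (simp_all add: norm_shadow_squared[of x])

text \<open>
A vector of small slope is hardly shortened by the projection; from \<open>(1 - \<tau>)\<^sup>2 \<le> 1 - \<tau>\<^sup>2\<close>.
\<close>
lemma norm_le_shadow:
  assumes "\<bar>e \<bullet> x\<bar> \<le> \<tau> * norm x" "0 \<le> \<tau>" "\<tau> \<le> 1"
  shows "(1 - \<tau>) * norm x \<le> norm (shadow e x)"
proof (rule power2_le_imp_le)
  have "(e \<bullet> x)\<^sup>2 \<le> (\<tau> * norm x)\<^sup>2" using assms by (metis abs_ge_zero power2_abs power_mono)
  then have "(1 - \<tau>\<^sup>2) * (norm x)\<^sup>2 \<le> (norm (shadow e x))\<^sup>2"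
    using norm_shadow_squared[of x] by (simp add: algebra_simps power_mult_distrib)
  moreover have "(1 - \<tau>)\<^sup>2 \<le> 1 - \<tau>\<^sup>2"
    using assms mult_left_mono[of \<tau> 1 \<tau>] by (simp add: power2_eq_square algebra_simps)
  then have "(1 - \<tau>)\<^sup>2 * (norm x)\<^sup>2 \<le> (1 - \<tau>\<^sup>2) * (norm x)\<^sup>2"
    by (rule mult_right_mono) simp
  ultimately show "((1 - \<tau>) * norm x)\<^sup>2 \<le> (norm (shadow e x))\<^sup>2"
    by (simp add: power_mult_distrib)
qed simp

lemma inner_shadow_right: "e \<bullet> d = 0 \<Longrightarrow> d \<bullet> shadow e x = d \<bullet> x"
  by (simp add: shadow_def inner_diff_right inner_commute)

end

definition upper_height :: "'a::real_inner set \<Rightarrow> 'a \<Rightarrow> 'a \<Rightarrow> real \<Rightarrow> 'a \<Rightarrow> real" where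
  "upper_height X e p \<rho> y = Sup {h. p + y + h *\<^sub>R e \<in> X \<inter> cball p \<rho>}"

text \<open>
Turning the picture upside down lets every fact about the top sheet be reused for the bottom sheet.
\<close>
definition lower_height :: "'a::real_inner set \<Rightarrow> 'a \<Rightarrow> 'a \<Rightarrow> real \<Rightarrow> 'a \<Rightarrow> real" where
  "lower_height X e p \<rho> y = - upper_height X (- e) p \<rho> y"

text \<open>
What the rest of the local analysis needs to know about \<open>X\<close> near \<open>p\<close>, with \<open>e\<close> regarded as vertical.
\<open>slope\<close> bounds the steepness of secants issuing from each point, but only within a distance that
depends on that point; \<open>cone\<close> is the same bound at \<open>p\<close>, valid in the whole ball. \<open>spread\<close> says that near
each of its points \<open>X\<close> has others within an angle of 60 degrees of any given horizontal direction \<open>d\<close>, and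
\<open>extreme\<close> that each point is the highest or the lowest one on its vertical line. All the conditions
are invariant under \<open>e \<mapsto> - e\<close>.
\<close>
locale almost_horizontal =
  fixes X :: "'a::euclidean_space set" and e p :: 'a and \<rho> \<tau> :: real
  assumes e: "norm e = 1" and rho: "0 < \<rho>" and tau: "0 < \<tau>" "\<tau> \<le> 1 / 2"
    and p: "p \<in> X"
    and compact: "compact (X \<inter> cball p \<rho>)"
    and cone: "\<And>z. z \<in> X \<inter> cball p \<rho> \<Longrightarrow> \<bar>e \<bullet> (z - p)\<bar> \<le> \<tau> * norm (z - p)"
    and slope: "\<And>x. x \<in> X \<inter> cball p \<rho> \<Longrightarrow>
      \<exists>s>0. \<forall>z\<in>X. norm (z - x) < s \<longrightarrow> \<bar>e \<bullet> (z - x)\<bar> \<le> \<tau> * norm (z - x)"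
    and spread: "\<And>x d \<epsilon>. x \<in> X \<inter> cball p \<rho> \<Longrightarrow> norm d = 1 \<Longrightarrow> e \<bullet> d = 0 \<Longrightarrow> 0 < \<epsilon> \<Longrightarrow>
      \<exists>q\<in>X. q \<noteq> x \<and> norm (q - x) < \<epsilon> \<and> norm (q - x) / 2 \<le> d \<bullet> (q - x)"
    and extreme: "\<And>x. x \<in> X \<inter> cball p \<rho> \<Longrightarrow>
      (\<forall>t>0. x + t *\<^sub>R e \<notin> X \<inter> cball p \<rho>) \<or> (\<forall>t>0. x - t *\<^sub>R e \<notin> X \<inter> cball p \<rho>)"
begin

lemma upside_down: "almost_horizontal X (- e) p \<rho> \<tau>"
proof
  show "(\<forall>t>0. x + t *\<^sub>R - e \<notin> X \<inter> cball p \<rho>) \<or> (\<forall>t>0. x - t *\<^sub>R - e \<notin> X \<inter> cball p \<rho>)"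
    if "x \<in> X \<inter> cball p \<rho>" for x
    using extreme[OF that] by auto
qed (use e rho tau p compact cone slope spread in auto)

text \<open>
The projection of \<open>X\<close> is open at each point. Given a horizontal target \<open>y\<close>, take the point of \<open>X\<close> near \<open>x\<close> whose
projection is nearest to \<open>y\<close>. Since \<open>X\<close> is not steep at \<open>x\<close>, this minimiser lies in the interior
of the compact neighbourhood that was searched; so by \<open>spread\<close> it could still be moved towards
\<open>y\<close>, unless it already projects onto \<open>y\<close>.
\<close>
lemma shadow_open:
  assumes "x \<in> X" "norm (x - p) < \<rho>" "0 < \<epsilon>"
  shows "\<exists>\<eta>>0. \<forall>y. e \<bullet> y = 0 \<longrightarrow> norm y < \<eta> \<longrightarrow>
           (\<exists>z\<in>X. norm (z - x) < \<epsilon> \<and> shadow e (z - x) = y)"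
proof -
  have xK: "x \<in> X \<inter> cball p \<rho>" using assms by (simp add: dist_norm norm_minus_commute)
  obtain s where s: "0 < s" "\<And>z. z \<in> X \<Longrightarrow> norm (z - x) < s \<Longrightarrow> \<bar>e \<bullet> (z - x)\<bar> \<le> \<tau> * norm (z - x)"
    using slope[OF xK] by blast
  define \<sigma> where "\<sigma> = min (s / 2) (min (\<epsilon> / 2) (\<rho> - norm (x - p)))"
  have \<sigma>: "0 < \<sigma>" "\<sigma> < s" "\<sigma> < \<epsilon>" "\<sigma> + norm (x - p) \<le> \<rho>"
    using s assms by (auto simp: \<sigma>_def min_def)
  define K where "K = X \<inter> cball x \<sigma>"
  have K_sub: "cball x \<sigma> \<subseteq> cball p \<rho>"
  proof
    fix z assume "z \<in> cball x \<sigma>"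
    then show "z \<in> cball p \<rho>"
      using \<sigma>(4) norm_triangle_ineq[of "z - x" "x - p"] by (simp add: dist_norm norm_minus_commute)
  qed
  then have "K = (X \<inter> cball p \<rho>) \<inter> cball x \<sigma>" by (auto simp: K_def)
  then have "compact K" using compact by (metis compact_Int compact_cball)
  moreover have "x \<in> K" using assms \<sigma> by (simp add: K_def)
  have "\<exists>z\<in>X. norm (z - x) < \<epsilon> \<and> shadow e (z - x) = y" if y: "e \<bullet> y = 0" "norm y < \<sigma> / 4" for y
  proof -
    define \<phi> where "\<phi> z = norm (shadow e (z - x) - y)" for z
    have "continuous_on K \<phi>" unfolding \<phi>_def by (intro continuous_intros)
    then obtain z where z: "z \<in> K" "\<And>q. q \<in> K \<Longrightarrow> \<phi> z \<le> \<phi> q"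
      using continuous_attains_inf[OF \<open>compact K\<close>] \<open>x \<in> K\<close> by blast
    have "\<phi> z \<le> norm y" using z(2)[OF \<open>x \<in> K\<close>] by (simp add: \<phi>_def shadow_def)
    then have "norm (shadow e (z - x)) < \<sigma> / 2"
      using y(2) norm_triangle_sub[of "shadow e (z - x)" y] by (simp add: \<phi>_def)
    moreover have zX: "z \<in> X" "norm (z - x) \<le> \<sigma>"
      using z(1) by (auto simp: K_def dist_norm norm_minus_commute)
    moreover have "(1 - \<tau>) * norm (z - x) \<le> norm (shadow e (z - x))"
      using s(2)[of z] zX \<sigma> tau by (intro norm_le_shadow[OF e]) auto
    moreover have "norm (z - x) / 2 \<le> (1 - \<tau>) * norm (z - x)"
      using tau mult_right_mono[of "1/2" "1 - \<tau>" "norm (z - x)"] by simp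
    ultimately have zx: "norm (z - x) < \<sigma>" by linarith
    have "\<phi> z = 0"
    proof (rule ccontr)
      assume "\<phi> z \<noteq> 0"
      then have D: "0 < \<phi> z" by (simp add: \<phi>_def)
      define d where "d = (y - shadow e (z - x)) /\<^sub>R \<phi> z"
      have d: "norm d = 1" "e \<bullet> d = 0"
        using D y by (auto simp: d_def \<phi>_def norm_minus_commute inner_diff_right inner_shadow[OF e])
      have Dd: "y - shadow e (z - x) = \<phi> z *\<^sub>R d" using D by (simp add: d_def)
      have "z \<in> X \<inter> cball p \<rho>" "0 < min (\<sigma> - norm (z - x)) (\<phi> z)"
        using z(1) zx D \<open>K = (X \<inter> cball p \<rho>) \<inter> cball x \<sigma>\<close> by auto
      then obtain q where q: "q \<in> X" "q \<noteq> z" "norm (q - z) < min (\<sigma> - norm (z - x)) (\<phi> z)"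
          "norm (q - z) / 2 \<le> d \<bullet> (q - z)"
        using spread[OF _ d] by blast
      have "norm (q - x) \<le> \<sigma>" using q(3) norm_triangle_ineq[of "q - z" "z - x"] by simp
      then have "q \<in> K" using q(1) by (simp add: K_def dist_norm norm_minus_commute)
      have "shadow e (q - x) - y = shadow e (q - z) - \<phi> z *\<^sub>R d"
        using Dd by (simp add: shadow_diff algebra_simps)
      moreover have "(norm (a - c *\<^sub>R d))\<^sup>2 = (norm a)\<^sup>2 - 2 * c * (d \<bullet> a) + c\<^sup>2" for a c
      proof -
        have "d \<bullet> d = 1" using d(1) by (simp add: norm_eq_1)
        then show ?thesis unfolding power2_norm_eq_inner
          by (simp add: inner_diff_left inner_diff_right inner_commute[of a d] power2_eq_square algebra_simps)
      qed
      ultimately have "(\<phi> q)\<^sup>2 = (norm (shadow e (q - z)))\<^sup>2 - 2 * \<phi> z * (d \<bullet> (q - z)) + (\<phi> z)\<^sup>2"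
        using inner_shadow_right[OF e d(2)] by (simp add: \<phi>_def[of q])
      also have "\<dots> \<le> (norm (q - z))\<^sup>2 - \<phi> z * norm (q - z) + (\<phi> z)\<^sup>2"
      proof -
        have "\<phi> z * norm (q - z) \<le> \<phi> z * (2 * (d \<bullet> (q - z)))"
          using q(4) D by (intro mult_left_mono) auto
        moreover have "(norm (shadow e (q - z)))\<^sup>2 \<le> (norm (q - z))\<^sup>2"
          by (intro power_mono norm_shadow_le[OF e]) simp
        ultimately show ?thesis by linarith
      qed
      also have "\<dots> < (\<phi> z)\<^sup>2"
        using q(2,3) mult_strict_right_mono[of "norm (q - z)" "\<phi> z" "norm (q - z)"]
        by (simp add: power2_eq_square)
      finally have "\<phi> q < \<phi> z" by (rule power2_less_imp_less) (use D in simp)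
      then show False using z(2)[OF \<open>q \<in> K\<close>] by simp
    qed
    then have "shadow e (z - x) = y" by (simp add: \<phi>_def)
    then show ?thesis using zX zx \<sigma> by force
  qed
  then show ?thesis using \<sigma>(1) by (intro exI[of _ "\<sigma> / 4"]) auto
qed

lemma norm_le_shadow_center:
  assumes "z \<in> X \<inter> cball p \<rho>"
  shows "norm (z - p) \<le> 2 * norm (shadow e (z - p))"
proof -
  have "(1 - \<tau>) * norm (z - p) \<le> norm (shadow e (z - p))"
    using cone[OF assms] tau by (intro norm_le_shadow[OF e]) auto
  moreover have "norm (z - p) / 2 \<le> (1 - \<tau>) * norm (z - p)"
    using tau mult_right_mono[of "1/2" "1 - \<tau>" "norm (z - p)"] by simp
  ultimately show ?thesis by linarith
qed

lemma fibers_nonempty: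
  "\<exists>\<eta>>0. 2 * \<eta> \<le> \<rho> \<and> (\<forall>y. e \<bullet> y = 0 \<longrightarrow> norm y < \<eta> \<longrightarrow> (\<exists>h. p + y + h *\<^sub>R e \<in> X \<inter> cball p \<rho>))"
proof -
  obtain \<eta> where \<eta>: "0 < \<eta>" "\<And>y. e \<bullet> y = 0 \<Longrightarrow> norm y < \<eta> \<Longrightarrow>
      \<exists>z\<in>X. norm (z - p) < \<rho> \<and> shadow e (z - p) = y"
    using shadow_open[OF p, of \<rho>] rho by auto
  have "\<exists>h. p + y + h *\<^sub>R e \<in> X \<inter> cball p \<rho>" if y: "e \<bullet> y = 0" "norm y < \<eta>" for y
  proof -
    obtain z where z: "z \<in> X" "norm (z - p) < \<rho>" "shadow e (z - p) = y" using \<eta>(2)[OF y] by blast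
    have "p + y + (e \<bullet> (z - p)) *\<^sub>R e = z"
      using shadow_decomp[of e "z - p"] z(3) by (simp add: algebra_simps)
    then show ?thesis using z by (intro exI[of _ "e \<bullet> (z - p)"]) (simp add: dist_norm norm_minus_commute)
  qed
  then show ?thesis using \<eta>(1) rho by (intro exI[of _ "min \<eta> (\<rho> / 2)"]) auto
qed

lemma upper_height_max:
  assumes "p + y + h *\<^sub>R e \<in> X \<inter> cball p \<rho>"
  shows "p + y + upper_height X e p \<rho> y *\<^sub>R e \<in> X \<inter> cball p \<rho>" "h \<le> upper_height X e p \<rho> y"
proof -
  define F where "F = {h. p + y + h *\<^sub>R e \<in> X \<inter> cball p \<rho>}"
  have F_eq: "F = (\<lambda>h. p + y + h *\<^sub>R e) -` (X \<inter> cball p \<rho>)" by (auto simp: F_def)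
  have "closed F"
    unfolding F_eq
    by (intro continuous_closed_vimage compact_imp_closed[OF compact] continuous_intros)
  moreover have "bounded F"
  proof -
    have "\<bar>h\<bar> \<le> norm y + \<rho>" if "h \<in> F" for h
    proof -
      have "norm (y + h *\<^sub>R e) \<le> \<rho>" using that unfolding F_def mem_cball_iff_norm Int_iff mem_Collect_eq
        by (simp add: add.assoc)
      then have "norm (h *\<^sub>R e) \<le> norm y + \<rho>"
        using norm_triangle_ineq4[of "y + h *\<^sub>R e" y] by simp
      then show ?thesis using e by simp
    qed
    then show ?thesis by (auto simp: bounded_iff)
  qed
  ultimately have cF: "closed F" "bdd_above F" "F \<noteq> {}"
    using assms by (auto simp: F_def bounded_imp_bdd_above)
  then have "Sup F \<in> F" by (intro closed_contains_Sup) auto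
  then show "p + y + upper_height X e p \<rho> y *\<^sub>R e \<in> X \<inter> cball p \<rho>"
    by (simp add: F_def upper_height_def)
  show "h \<le> upper_height X e p \<rho> y"
    using cSup_upper[of h F] cF assms by (simp add: F_def upper_height_def)
qed

text \<open>
The height cannot drop suddenly, because \<open>X\<close> near the top point over \<open>y\<close> projects onto a neighbourhood
of \<open>y\<close>. It cannot jump up, because the points of \<open>X\<close> at least \<open>\<epsilon>\<close> higher form a compact set whose
projection misses \<open>y\<close>.
\<close>
lemma upper_height_continuous:
  assumes "2 * \<eta> \<le> \<rho>"
    and fib: "\<And>y. e \<bullet> y = 0 \<Longrightarrow> norm y < \<eta> \<Longrightarrow> \<exists>h. p + y + h *\<^sub>R e \<in> X \<inter> cball p \<rho>"
  shows "continuous_on {y. e \<bullet> y = 0 \<and> norm y < \<eta>} (upper_height X e p \<rho>)"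
proof -
  let ?f = "upper_height X e p \<rho>"
  let ?pt = "\<lambda>y. p + y + ?f y *\<^sub>R e"
  have pt: "?pt y \<in> X \<inter> cball p \<rho>" if "e \<bullet> y = 0" "norm y < \<eta>" for y
    using fib[OF that] upper_height_max(1) by blast
  have "\<exists>\<delta>>0. \<forall>y'. e \<bullet> y' = 0 \<longrightarrow> norm y' < \<eta> \<longrightarrow> norm (y' - y) < \<delta> \<longrightarrow> \<bar>?f y' - ?f y\<bar> < \<epsilon>"
    if y: "e \<bullet> y = 0" "norm y < \<eta>" and \<epsilon>: "0 < \<epsilon>" for y \<epsilon>
  proof -
    define x where "x = ?pt y"
    have xp: "x - p = y + ?f y *\<^sub>R e" by (simp add: x_def)
    have x: "x \<in> X \<inter> cball p \<rho>" "shadow e (x - p) = y"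
      using pt[OF y] shadow_orthogonal[OF e y(1)] by (auto simp: x_def add.assoc)
    have xin: "norm (x - p) < \<rho>" using norm_le_shadow_center[OF x(1)] x(2) y(2) assms(1) by simp
    obtain \<delta>1 where \<delta>1: "0 < \<delta>1" "\<And>w. e \<bullet> w = 0 \<Longrightarrow> norm w < \<delta>1 \<Longrightarrow>
        \<exists>z\<in>X. norm (z - x) < min \<epsilon> (\<rho> - norm (x - p)) \<and> shadow e (z - x) = w"
      using shadow_open[of x "min \<epsilon> (\<rho> - norm (x - p))"] x xin \<epsilon> by auto
    \<comment> \<open>base points over which \<open>X\<close> reaches at least \<open>\<epsilon>\<close> higher than over \<open>y\<close>\<close>
    define C where "C = (\<lambda>z. shadow e (z - p)) ` ((X \<inter> cball p \<rho>) \<inter> {z. ?f y + \<epsilon> \<le> e \<bullet> (z - p)})"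
    have "compact ((X \<inter> cball p \<rho>) \<inter> {z. ?f y + \<epsilon> \<le> e \<bullet> (z - p)})"
      by (intro compact_Int_closed[OF compact] closed_Collect_le continuous_intros)
    then have "compact C"
      unfolding C_def by (intro compact_continuous_image continuous_intros)
    moreover have "y \<notin> C"
    proof
      assume "y \<in> C"
      then obtain z where z: "z \<in> X \<inter> cball p \<rho>" "?f y + \<epsilon> \<le> e \<bullet> (z - p)" "shadow e (z - p) = y"
        by (auto simp: C_def)
      have "p + y + (e \<bullet> (z - p)) *\<^sub>R e = z"
        using shadow_decomp[of e "z - p"] z(3) by (simp add: algebra_simps)
      then have "e \<bullet> (z - p) \<le> ?f y" using upper_height_max(2) z(1) by metis
      then show False using z(2) \<epsilon> by simp
    qed
    ultimately obtain \<delta>2 where \<delta>2: "0 < \<delta>2" "\<And>w. w \<in> C \<Longrightarrow> \<delta>2 \<le> dist y w"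
      using separate_point_closed[of C y] compact_imp_closed[of C] by auto
    show ?thesis
    proof (intro exI[of _ "min \<delta>1 \<delta>2"] conjI allI impI)
      show "0 < min \<delta>1 \<delta>2" using \<delta>1 \<delta>2 by simp
      fix y' assume y': "e \<bullet> y' = 0" "norm y' < \<eta>" "norm (y' - y) < min \<delta>1 \<delta>2"
      have "y' \<notin> C" using \<delta>2(2)[of y'] y'(3) by (auto simp: dist_norm norm_minus_commute)
      moreover have "shadow e (?pt y' - p) = y'" "e \<bullet> (?pt y' - p) = ?f y'"
        using shadow_orthogonal[OF e y'(1)] height_orthogonal[OF e y'(1)] by (simp_all add: add.assoc)
      then have "y' \<in> C" if "?f y + \<epsilon> \<le> ?f y'"
        unfolding C_def using that pt[OF y'(1,2)] by (intro image_eqI[of _ _ "?pt y'"]) auto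
      ultimately have up: "?f y' < ?f y + \<epsilon>" by fastforce
      obtain z where z: "z \<in> X" "norm (z - x) < min \<epsilon> (\<rho> - norm (x - p))" "shadow e (z - x) = y' - y"
        using \<delta>1(2)[of "y' - y"] y y' by (auto simp: inner_diff_right)
      have "shadow e (z - p) = shadow e (z - x) + shadow e (x - p)" by (simp add: shadow_diff)
      then have "shadow e (z - p) = y'" using z(3) x(2) by simp
      then have zeq: "p + y' + (e \<bullet> (z - p)) *\<^sub>R e = z"
        using shadow_decomp[of e "z - p"] by (simp add: algebra_simps)
      have "norm (z - p) \<le> \<rho>" using z(2) norm_triangle_ineq[of "z - x" "x - p"] by simp
      then have "z \<in> X \<inter> cball p \<rho>" using z(1) by (simp add: dist_norm norm_minus_commute)
      then have "e \<bullet> (z - p) \<le> ?f y'" using upper_height_max(2) zeq by metis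
      moreover have "e \<bullet> (x - p) = ?f y" using xp height_orthogonal[OF e y(1)] by simp
      moreover have "\<bar>e \<bullet> (z - x)\<bar> < \<epsilon>"
        using Cauchy_Schwarz_ineq2[of e "z - x"] e z(2) by simp
      ultimately have "?f y - \<epsilon> < ?f y'" by (simp add: inner_diff_right)
      then show "\<bar>?f y' - ?f y\<bar> < \<epsilon>" using up by simp
    qed
  qed
  then show ?thesis unfolding continuous_on_iff by (simp add: dist_norm) blast
qed

lemma lower_height_min:
  assumes "p + y + h *\<^sub>R e \<in> X \<inter> cball p \<rho>"
  shows "p + y + lower_height X e p \<rho> y *\<^sub>R e \<in> X \<inter> cball p \<rho>" "lower_height X e p \<rho> y \<le> h"
proof -
  interpret neg: almost_horizontal X "- e" p \<rho> \<tau> by (rule upside_down)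
  have "p + y + (- h) *\<^sub>R (- e) \<in> X \<inter> cball p \<rho>" using assms by simp
  from neg.upper_height_max[OF this]
  show "p + y + lower_height X e p \<rho> y *\<^sub>R e \<in> X \<inter> cball p \<rho>" "lower_height X e p \<rho> y \<le> h"
    by (auto simp: lower_height_def)
qed

lemma lower_height_continuous:
  assumes "2 * \<eta> \<le> \<rho>"
    and fib: "\<And>y. e \<bullet> y = 0 \<Longrightarrow> norm y < \<eta> \<Longrightarrow> \<exists>h. p + y + h *\<^sub>R e \<in> X \<inter> cball p \<rho>"
  shows "continuous_on {y. e \<bullet> y = 0 \<and> norm y < \<eta>} (lower_height X e p \<rho>)"
proof -
  interpret neg: almost_horizontal X "- e" p \<rho> \<tau> by (rule upside_down)
  have "\<exists>h. p + y + h *\<^sub>R (- e) \<in> X \<inter> cball p \<rho>" if y: "- e \<bullet> y = 0" "norm y < \<eta>" for y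
  proof -
    obtain h where "p + y + h *\<^sub>R e \<in> X \<inter> cball p \<rho>" using fib y by auto
    then show ?thesis by (intro exI[of _ "- h"]) simp
  qed
  from neg.upper_height_continuous[OF assms(1) this]
  show ?thesis unfolding lower_height_def by (intro continuous_intros) simp
qed

lemma upper_or_lower:
  assumes "p + y + h *\<^sub>R e \<in> X \<inter> cball p \<rho>"
  shows "h = upper_height X e p \<rho> y \<or> h = lower_height X e p \<rho> y"
proof (rule ccontr)
  let ?u = "upper_height X e p \<rho> y" and ?l = "lower_height X e p \<rho> y"
  assume "\<not> ?thesis"
  then have lt: "0 < ?u - h" "0 < h - ?l"
    using upper_height_max(2)[OF assms] lower_height_min(2)[OF assms] by auto
  have "(p + y + h *\<^sub>R e) + (?u - h) *\<^sub>R e = p + y + ?u *\<^sub>R e"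
    "(p + y + h *\<^sub>R e) - (h - ?l) *\<^sub>R e = p + y + ?l *\<^sub>R e"
    by (auto simp: algebra_simps)
  then show False
    using extreme[OF assms] lt upper_height_max(1)[OF assms] lower_height_min(1)[OF assms] by metis
qed

text \<open>
The cone condition leaves no point but \<open>p\<close> on the vertical line through \<open>p\<close>, so the two sheets meet
there.
\<close>
lemma heights_center: "upper_height X e p \<rho> 0 = 0" "lower_height X e p \<rho> 0 = 0"
proof -
  have p': "p + 0 + 0 *\<^sub>R e \<in> X \<inter> cball p \<rho>" using p rho by simp
  have "h = 0" if "p + 0 + h *\<^sub>R e \<in> X \<inter> cball p \<rho>" for h
  proof -
    have "shadow e (p + 0 + h *\<^sub>R e - p) = 0" using shadow_orthogonal[OF e, of 0 h] by simp
    then show ?thesis using norm_le_shadow_center[OF that] e by simp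
  qed
  then show "upper_height X e p \<rho> 0 = 0" "lower_height X e p \<rho> 0 = 0"
    using upper_height_max(1)[OF p'] lower_height_min(1)[OF p'] by blast+
qed

end

context flat_supported
begin

text \<open>
Normals close to \<open>\<plusminus> e\<close> give every clause of \<open>almost_horizontal\<close>: the tangent hyperplanes are nearly
horizontal, and a supporting ball of radius \<open>r\<close> centred almost
vertically covers the vertical segment of length \<open>r\<close> on its side of the point. The bound
\<open>4 * \<rho> \<le> r\<close> keeps two points of the ball of radius \<open>\<rho>\<close> within such a segment.
\<close>
lemma almost_horizontal_near:
  assumes pX: "p \<in> X" and e: "supporting_normal X r p e" and \<tau>: "0 < \<tau>" "\<tau> \<le> 1 / 2"
  shows "\<exists>\<rho>>0. almost_horizontal X e p \<rho> \<tau> \<and> 4 * \<rho> \<le> r \<and>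
           (\<forall>x\<in>X \<inter> cball p \<rho>. \<forall>v. supporting_normal X r x v \<longrightarrow>
               norm (v - e) < \<tau> / 2 \<or> norm (v + e) < \<tau> / 2)"
proof -
  obtain \<delta>1 where \<delta>1: "0 < \<delta>1" "\<And>x v. x \<in> X \<Longrightarrow> norm (x - p) < \<delta>1 \<Longrightarrow> supporting_normal X r x v \<Longrightarrow>
           norm (v - e) < \<tau> / 2 \<or> norm (v + e) < \<tau> / 2"
    using normals_continuous[OF pX e, of "\<tau> / 2"] \<tau> by auto
  obtain \<delta>2 where \<delta>2: "0 < \<delta>2" "\<And>z. z \<in> X \<Longrightarrow> norm (z - p) < \<delta>2 \<Longrightarrow> \<bar>e \<bullet> (z - p)\<bar> \<le> \<tau> * norm (z - p)"
    using flat_approach[OF pX e, of \<tau>] \<tau> by auto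
  obtain C U where CU: "closed C" "open U" "X = C \<inter> U"
    using locally_closed unfolding locally_closed_def by blast
  obtain \<delta>3 where \<delta>3: "0 < \<delta>3" "cball p \<delta>3 \<subseteq> U"
    using CU pX open_contains_cball by blast
  define \<rho> where "\<rho> = min (min (\<delta>1 / 2) (\<delta>2 / 2)) (min \<delta>3 (r / 4))"
  have \<rho>: "0 < \<rho>" "\<rho> < \<delta>1" "\<rho> < \<delta>2" "\<rho> \<le> \<delta>3" "4 * \<rho> \<le> r"
    using \<delta>1(1) \<delta>2(1) \<delta>3(1) r_pos by (auto simp: \<rho>_def min_def)
  have inK: "x \<in> X" "norm (x - p) \<le> \<rho>" if "x \<in> X \<inter> cball p \<rho>" for x
    using that by (auto simp: dist_norm norm_minus_commute)
  have normals: "norm (v - e) < \<tau> / 2 \<or> norm (v + e) < \<tau> / 2"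
    if "x \<in> X \<inter> cball p \<rho>" "supporting_normal X r x v" for x v
    using \<delta>1(2)[of x v] inK[OF that(1)] that(2) \<rho> by simp
  have e1: "norm e = 1" using e by (simp add: supporting_normal_def)
  have signed: "\<exists>v v'. supporting_normal X r x v \<and> (v' = v \<or> v' = - v) \<and> norm (v' - e) < \<tau> / 2"
    if x: "x \<in> X \<inter> cball p \<rho>" for x
  proof -
    obtain v where v: "supporting_normal X r x v" using supported inK[OF x] by blast
    have "- v - e = - (v + e)" by simp
    then have "norm (- v - e) = norm (v + e)" by (simp only: norm_minus_cancel)
    then show ?thesis using normals[OF x v] v by metis
  qed
  have "almost_horizontal X e p \<rho> \<tau>"
  proof
    show "norm e = 1" "0 < \<rho>" "0 < \<tau>" "\<tau> \<le> 1 / 2" "p \<in> X" using e1 \<rho> \<tau> pX by auto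
    have "X \<inter> cball p \<rho> = C \<inter> cball p \<rho>"
      using CU(3) \<delta>3(2) \<rho>(4) by auto
    then show "compact (X \<inter> cball p \<rho>)" using CU(1) by (simp add: closed_Int_compact)
    show "\<bar>e \<bullet> (z - p)\<bar> \<le> \<tau> * norm (z - p)" if "z \<in> X \<inter> cball p \<rho>" for z
      using \<delta>2(2) inK[OF that] \<rho> by simp
  next
    fix x assume x: "x \<in> X \<inter> cball p \<rho>"
    obtain v v' where v: "supporting_normal X r x v" "v' = v \<or> v' = - v" "norm (v' - e) < \<tau> / 2"
      using signed[OF x] by blast
    have v1: "norm v = 1" "norm v' = 1" using v(1,2) by (auto simp: supporting_normal_def)
    obtain s where s: "0 < s" "\<And>z. z \<in> X \<Longrightarrow> norm (z - x) < s \<Longrightarrow> \<bar>v \<bullet> (z - x)\<bar> \<le> \<tau> / 2 * norm (z - x)"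
      using flat_approach[OF inK(1)[OF x] v(1), of "\<tau> / 2"] \<tau> by auto
    have "\<bar>e \<bullet> (z - x)\<bar> \<le> \<tau> * norm (z - x)" if "z \<in> X" "norm (z - x) < s" for z
    proof -
      have "\<bar>v' \<bullet> (z - x)\<bar> \<le> \<tau> / 2 * norm (z - x)" using s(2)[OF that] v(2) by auto
      moreover have "\<bar>(v' - e) \<bullet> (z - x)\<bar> \<le> norm (v' - e) * norm (z - x)"
        by (rule Cauchy_Schwarz_ineq2)
      moreover have "norm (v' - e) * norm (z - x) \<le> \<tau> / 2 * norm (z - x)"
        using v(3) by (intro mult_right_mono) auto
      ultimately show ?thesis unfolding inner_diff_left by linarith
    qed
    then show "\<exists>s>0. \<forall>z\<in>X. norm (z - x) < s \<longrightarrow> \<bar>e \<bullet> (z - x)\<bar> \<le> \<tau> * norm (z - x)"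
      using s(1) by blast
    have ve: "3 / 4 \<le> v' \<bullet> e"
    proof -
      have "\<bar>(v' - e) \<bullet> e\<bar> \<le> norm (v' - e) * norm e" by (rule Cauchy_Schwarz_ineq2)
      then show ?thesis using v(3) e1 \<tau> by (simp add: inner_diff_left norm_eq_1)
    qed
    have no_point: "x + t *\<^sub>R w \<notin> X \<inter> cball p \<rho>" if t: "0 < t" and w: "norm w = 1" "3 / 4 \<le> v \<bullet> w" for t w
    proof
      assume z: "x + t *\<^sub>R w \<in> X \<inter> cball p \<rho>"
      have "norm (t *\<^sub>R w) \<le> \<rho> + \<rho>"
        using inK(2)[OF z] inK(2)[OF x] norm_triangle_ineq4[of "x + t *\<^sub>R w - p" "x - p"] by simp
      then have "t \<le> r / 2" using t w \<rho> by simp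
      have "2 * r * (v \<bullet> (t *\<^sub>R w)) \<le> (norm (t *\<^sub>R w))\<^sup>2"
        using v(1) z unfolding supporting_normal_def by fastforce
      then have "t * (2 * r * (v \<bullet> w)) \<le> t * t" using w t by (simp add: power2_eq_square algebra_simps)
      then have "2 * r * (v \<bullet> w) \<le> t" using t by simp
      moreover have "2 * r * (3 / 4) \<le> 2 * r * (v \<bullet> w)" using w r_pos by (intro mult_left_mono) auto
      ultimately show False using \<open>t \<le> r / 2\<close> r_pos by linarith
    qed
    show "(\<forall>t>0. x + t *\<^sub>R e \<notin> X \<inter> cball p \<rho>) \<or> (\<forall>t>0. x - t *\<^sub>R e \<notin> X \<inter> cball p \<rho>)"
      using v(2)
    proof
      assume "v' = v"
      then show ?thesis using no_point[of _ e] e1 ve by blast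
    next
      assume "v' = - v"
      then have "3 / 4 \<le> v \<bullet> (- e)" using ve by simp
      then have "x + t *\<^sub>R (- e) \<notin> X \<inter> cball p \<rho>" if "0 < t" for t
        using no_point[of t "- e"] e1 that by simp
      then show ?thesis by simp
    qed
    fix d :: 'a and \<epsilon> :: real assume d: "norm d = 1" "e \<bullet> d = 0" "0 < \<epsilon>"
    \<comment> \<open>the direction in the tangent hyperplane at \<open>x\<close> that is closest to \<open>d\<close>\<close>
    define t where "t = d - (v \<bullet> d) *\<^sub>R v"
    have vt: "v \<bullet> t = 0" using v1 by (simp add: t_def inner_diff_right norm_eq_1)
    have "\<bar>v \<bullet> d\<bar> = \<bar>(v' - e) \<bullet> d\<bar>" using v(2) d(2) by (auto simp: inner_diff_left)
    then have "\<bar>v \<bullet> d\<bar> \<le> 1 / 4"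
      using Cauchy_Schwarz_ineq2[of "v' - e" d] v(3) d(1) \<tau> by simp
    then have t34: "3 / 4 \<le> norm t"
      using norm_triangle_ineq2[of d "(v \<bullet> d) *\<^sub>R v"] d(1) v1 by (simp add: t_def)
    have "d = t + (v \<bullet> d) *\<^sub>R v" by (simp add: t_def)
    then have dt: "d \<bullet> t = (norm t)\<^sup>2"
      using vt by (metis add.right_neutral inner_add_left inner_scaleR_left mult_zero_right power2_norm_eq_inner)
    define w where "w = t /\<^sub>R norm t"
    have tpos: "0 < norm t" using t34 by linarith
    have "d \<bullet> w = norm t" using dt tpos by (simp add: w_def power2_eq_square field_simps)
    then have w: "norm w = 1" "v \<bullet> w = 0" "3 / 4 \<le> d \<bullet> w"
      using t34 vt tpos by (auto simp: w_def)
    obtain q where q: "q \<in> X" "q \<noteq> x" "norm (q - x) < min \<epsilon> (1 / 4)"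
        "norm (direction x q - w) < min \<epsilon> (1 / 4)"
      using tangent_direction_attained[OF inK(1)[OF x] v(1) w(1,2), of "min \<epsilon> (1 / 4)"] d(3) by auto
    have "\<bar>d \<bullet> (direction x q - w)\<bar> \<le> 1 / 4"
      using Cauchy_Schwarz_ineq2[of d "direction x q - w"] d(1) q(4) by simp
    then have "1 / 2 \<le> d \<bullet> direction x q" using w(3) unfolding inner_diff_right by linarith
    then have "norm (q - x) * (1 / 2) \<le> norm (q - x) * (d \<bullet> direction x q)"
      by (rule mult_left_mono) simp
    then have "norm (q - x) / 2 \<le> d \<bullet> (q - x)" using q(2) by (simp add: inner_direction)
    then show "\<exists>q\<in>X. q \<noteq> x \<and> norm (q - x) < \<epsilon> \<and> norm (q - x) / 2 \<le> d \<bullet> (q - x)"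
      using q by auto
  qed
  then show ?thesis using \<rho> normals by blast
qed

end

context almost_horizontal
begin

abbreviation disk :: "real \<Rightarrow> 'a set" where
  "disk \<eta> \<equiv> {y. e \<bullet> y = 0 \<and> norm y < \<eta>}"

abbreviation upper :: "'a \<Rightarrow> real" where "upper \<equiv> upper_height X e p \<rho>"
abbreviation lower :: "'a \<Rightarrow> real" where "lower \<equiv> lower_height X e p \<rho>"

lemma point_over:
  assumes "e \<bullet> y = 0"
  shows "shadow e (p + y + h *\<^sub>R e - p) = y" "e \<bullet> (p + y + h *\<^sub>R e - p) = h"
  using shadow_orthogonal[OF e assms] height_orthogonal[OF e assms] by (simp_all add: add.assoc)

lemma point_eq:
  assumes "shadow e (x - p) = y"
  shows "p + y + (e \<bullet> (x - p)) *\<^sub>R e = x"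
  using shadow_decomp[of e "x - p"] assms by (simp add: algebra_simps)

lemma upper_lower_in:
  assumes fib: "\<And>y. y \<in> disk \<eta> \<Longrightarrow> \<exists>h. p + y + h *\<^sub>R e \<in> X \<inter> cball p \<rho>" and "y \<in> disk \<eta>"
  shows "p + y + upper y *\<^sub>R e \<in> X \<inter> cball p \<rho>" "p + y + lower y *\<^sub>R e \<in> X \<inter> cball p \<rho>"
    "lower y \<le> upper y"
proof -
  obtain h where h: "p + y + h *\<^sub>R e \<in> X \<inter> cball p \<rho>" using assms by blast
  show "p + y + upper y *\<^sub>R e \<in> X \<inter> cball p \<rho>" "p + y + lower y *\<^sub>R e \<in> X \<inter> cball p \<rho>"
    using upper_height_max(1)[OF h] lower_height_min(1)[OF h] by auto
  show "lower y \<le> upper y" using upper_height_max(2)[OF h] lower_height_min(2)[OF h] by simp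
qed

lemma graph_of_single_sheet:
  assumes \<eta>: "2 * \<eta> \<le> \<rho>"
    and fib: "\<And>y. y \<in> disk \<eta> \<Longrightarrow> \<exists>h. p + y + h *\<^sub>R e \<in> X \<inter> cball p \<rho>"
    and single: "\<And>y. y \<in> disk \<eta> \<Longrightarrow> upper y = lower y"
  shows "X \<inter> ({x. norm (shadow e (x - p)) < \<eta>} \<inter> ball p \<rho>) = (\<lambda>y. p + y + upper y *\<^sub>R e) ` disk \<eta>"
proof (intro equalityI subsetI)
  fix x assume x: "x \<in> X \<inter> ({x. norm (shadow e (x - p)) < \<eta>} \<inter> ball p \<rho>)"
  define y where "y = shadow e (x - p)"
  have y: "y \<in> disk \<eta>" using x by (simp add: y_def inner_shadow[OF e])
  have eq: "p + y + (e \<bullet> (x - p)) *\<^sub>R e = x" by (rule point_eq) (simp add: y_def)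
  have "x \<in> X \<inter> cball p \<rho>" using x by auto
  then have "e \<bullet> (x - p) = upper y"
    using upper_or_lower[of y "e \<bullet> (x - p)"] eq single[OF y] by auto
  then show "x \<in> (\<lambda>y. p + y + upper y *\<^sub>R e) ` disk \<eta>" using eq y by auto
next
  fix x assume "x \<in> (\<lambda>y. p + y + upper y *\<^sub>R e) ` disk \<eta>"
  then obtain y where y: "y \<in> disk \<eta>" "x = p + y + upper y *\<^sub>R e" by blast
  have x: "x \<in> X \<inter> cball p \<rho>" using upper_lower_in(1)[OF fib y(1)] y(2) by simp
  have s: "shadow e (x - p) = y" using point_over(1) y by auto
  have "norm (x - p) < \<rho>" using norm_le_shadow_center[OF x] s y(1) \<eta> by auto
  then show "x \<in> X \<inter> ({x. norm (shadow e (x - p)) < \<eta>} \<inter> ball p \<rho>)"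
    using x s y(1) by (simp add: dist_norm norm_minus_commute)
qed

end

locale almost_horizontal_sheets = almost_horizontal X e p \<rho> \<tau>
  for X :: "'a::euclidean_space set" and e p \<rho> \<tau> +
  fixes \<eta> :: real
  assumes eta: "0 < \<eta>" "2 * \<eta> \<le> \<rho>"
    and fibers: "\<And>y. y \<in> disk \<eta> \<Longrightarrow> \<exists>h. p + y + h *\<^sub>R e \<in> X \<inter> cball p \<rho>"
begin

lemma sheet_points:
  assumes "y \<in> disk \<eta>"
  shows "p + y + upper y *\<^sub>R e \<in> X \<inter> cball p \<rho>" "p + y + lower y *\<^sub>R e \<in> X \<inter> cball p \<rho>"
  using upper_lower_in(1,2)[of \<eta> y] fibers assms by blast+

lemma continuous_on_upper: "continuous_on (disk \<eta>) upper"
  using fibers by (intro upper_height_continuous eta) auto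

lemma continuous_on_lower: "continuous_on (disk \<eta>) lower"
  using fibers by (intro lower_height_continuous eta) auto

end

section \<open>Sheets of a hypersurface\<close>

lemma horizontal_eq_orthogonal: "horizontal = {y. axis last_coord 1 \<bullet> y = 0}"
  by (auto simp: horizontal_def inner_axis')

lemma dim_orthogonal_eq_horizontal:
  fixes e :: "real ^ 'n::finite"
  assumes "norm e = 1"
  shows "dim (horizontal :: (real ^ 'n) set) = dim {y. e \<bullet> y = 0}"
proof -
  have "e \<noteq> 0" using assms by auto
  moreover have "axis last_coord 1 \<noteq> (0 :: real ^ 'n)" by (simp add: axis_eq_0_iff)
  ultimately show ?thesis by (simp add: horizontal_eq_orthogonal dim_hyperplane)
qed

lemma subspace_horizontal: "subspace (horizontal :: (real ^ 'n::finite) set)"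
  unfolding horizontal_eq_orthogonal by (rule subspace_hyperplane)

lemma openin_disk: "openin (top_of_set {y. e \<bullet> y = 0}) {y. e \<bullet> y = 0 \<and> norm y < \<eta>}"
  for e :: "'a::real_inner"
proof -
  have "{y. e \<bullet> y = 0 \<and> norm y < \<eta>} = {y. e \<bullet> y = 0} \<inter> ball 0 \<eta>" by auto
  then show ?thesis by (metis open_ball openin_open_Int)
qed

text \<open>
An injective continuous image in \<open>X\<close> of an open piece of a hyperplane is, by invariance of domain
read in a chart of \<open>X\<close>, open in \<open>X\<close>.
\<close>
lemma open_in_hypersurface:
  fixes X :: "(real ^ 'n::finite) set" and e :: "real ^ 'n"
  assumes hyp: "hypersurface X" and e: "norm e = 1"
    and D: "openin (top_of_set {y. e \<bullet> y = 0}) D"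
    and \<phi>: "continuous_on D \<phi>" "inj_on \<phi> D" "\<phi> \<in> D \<rightarrow> X" and a: "a \<in> D"
  shows "\<exists>T. open T \<and> \<phi> a \<in> T \<and> X \<inter> T \<subseteq> \<phi> ` D"
proof -
  have "\<phi> a \<in> X" using \<phi>(3) a by auto
  then obtain U W h k where U: "\<phi> a \<in> U" "openin (top_of_set X) U"
      and W: "openin (top_of_set (horizontal :: (real ^ 'n) set)) W" and hk: "homeomorphism U W h k"
    using hyp unfolding hypersurface_def homeomorphic_def by blast
  have UX: "U \<subseteq> X" and WH: "W \<subseteq> horizontal" using U(2) W openin_imp_subset by blast+
  define D' where "D' = D \<inter> \<phi> -` U"
  have "openin (top_of_set D) D'"
    unfolding D'_def by (rule continuous_openin_preimage[OF \<phi>(1) _ U(2)]) (use \<phi>(3) in auto)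
  then have D': "openin (top_of_set {y. e \<bullet> y = 0}) D'" using D openin_trans by blast
  have "openin (top_of_set (horizontal :: (real ^ 'n) set)) ((h \<circ> \<phi>) ` D')"
  proof (rule invariance_of_domain_subspaces[OF D'])
    show "subspace {y. e \<bullet> y = 0}" by (rule subspace_hyperplane)
    show "dim (horizontal :: (real ^ 'n) set) \<le> dim {y. e \<bullet> y = 0}"
      using dim_orthogonal_eq_horizontal[OF e] by simp
    show "continuous_on D' (h \<circ> \<phi>)"
      using \<phi>(1) homeomorphism_cont1[OF hk]
      by (intro continuous_on_compose) (auto simp: D'_def intro: continuous_on_subset)
    show "h \<circ> \<phi> \<in> D' \<rightarrow> horizontal"
      using homeomorphism_image1[OF hk] WH by (auto simp: D'_def)
    have "inj_on h U" using homeomorphism_apply1[OF hk] by (metis inj_on_inverseI)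
    then show "inj_on (h \<circ> \<phi>) D'"
      using \<phi>(2) by (intro comp_inj_on) (auto simp: D'_def intro: inj_on_subset)
  qed (rule subspace_horizontal)
  moreover have "(h \<circ> \<phi>) ` D' \<subseteq> W"
  proof -
    have "\<phi> ` D' \<subseteq> U" by (auto simp: D'_def)
    then have "h ` \<phi> ` D' \<subseteq> W" using homeomorphism_image1[OF hk] by blast
    then show ?thesis by (simp only: image_comp)
  qed
  ultimately have "openin (top_of_set W) ((h \<circ> \<phi>) ` D')"
    using WH by (rule openin_subset_trans)
  moreover have "h \<in> U \<rightarrow> W" using homeomorphism_image1[OF hk] by blast
  ultimately have "openin (top_of_set U) (U \<inter> h -` ((h \<circ> \<phi>) ` D'))"
    using continuous_openin_preimage[OF homeomorphism_cont1[OF hk]] by blast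
  then have "openin (top_of_set X) (U \<inter> h -` ((h \<circ> \<phi>) ` D'))" using U(2) openin_trans by blast
  then obtain T where T: "open T" "U \<inter> h -` ((h \<circ> \<phi>) ` D') = X \<inter> T"
    by (auto simp: openin_open)
  have "X \<inter> T \<subseteq> \<phi> ` D"
  proof
    fix x assume "x \<in> X \<inter> T"
    then obtain y where y: "x \<in> U" "y \<in> D" "\<phi> y \<in> U" "h x = h (\<phi> y)"
      unfolding T(2)[symmetric] by (auto simp: D'_def)
    then have "x = \<phi> y" using homeomorphism_apply1[OF hk] by metis
    then show "x \<in> \<phi> ` D" using y by blast
  qed
  moreover have "\<phi> a \<in> T" using T(2) U(1) a by (auto simp: D'_def)
  ultimately show ?thesis using T(1) by blast
qed

text \<open>
The bottom sheet is open in \<open>X\<close> and contains \<open>p\<close>. Top points close to \<open>p\<close> therefore lie on the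
bottom sheet, and being over the same base point they are equal to the bottom points.
\<close>
lemma single_sheet_of_hypersurface:
  fixes X :: "(real ^ 'n::finite) set"
  assumes "almost_horizontal_sheets X e p \<rho> \<tau> \<eta>" and hyp: "hypersurface X"
  shows "\<exists>\<eta>'>0. \<eta>' \<le> \<eta> \<and> (\<forall>y. e \<bullet> y = 0 \<longrightarrow> norm y < \<eta>' \<longrightarrow>
           upper_height X e p \<rho> y = lower_height X e p \<rho> y)"
proof -
  interpret almost_horizontal_sheets X e p \<rho> \<tau> \<eta> by fact
  define lo where "lo y = p + y + lower y *\<^sub>R e" for y
  have sh: "shadow e (lo y - p) = y" "e \<bullet> (lo y - p) = lower y" if "e \<bullet> y = 0" for y
    using point_over[OF that] by (simp_all add: lo_def)
  have "\<exists>T. open T \<and> lo 0 \<in> T \<and> X \<inter> T \<subseteq> lo ` disk \<eta>"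
  proof (rule open_in_hypersurface[OF hyp e openin_disk])
    show "continuous_on (disk \<eta>) lo" unfolding lo_def by (intro continuous_intros continuous_on_lower)
    show "inj_on lo (disk \<eta>)" by (rule inj_on_inverseI[where g = "\<lambda>x. shadow e (x - p)"]) (use sh in auto)
    show "lo \<in> disk \<eta> \<rightarrow> X"
    proof
      show "lo y \<in> X" if "y \<in> disk \<eta>" for y using sheet_points(2)[OF that] by (simp add: lo_def)
    qed
  qed (use eta in simp)
  then obtain T where T: "open T" "p \<in> T" "X \<inter> T \<subseteq> lo ` disk \<eta>"
    using heights_center by (auto simp: lo_def)
  then obtain \<delta> where \<delta>: "0 < \<delta>" "ball p \<delta> \<subseteq> T" using open_contains_ball by blast
  have "upper y = lower y" if y: "e \<bullet> y = 0" "norm y < min \<eta> (\<delta> / 2)" for y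
  proof -
    define x where "x = p + y + upper y *\<^sub>R e"
    have x: "x \<in> X \<inter> cball p \<rho>" using sheet_points(1)[of y] y by (simp add: x_def)
    have xs: "shadow e (x - p) = y" "e \<bullet> (x - p) = upper y" using point_over[OF y(1)] by (simp_all add: x_def)
    have "norm (x - p) < \<delta>" using norm_le_shadow_center[OF x] xs y by simp
    then have "x \<in> X \<inter> T" using x \<delta>(2) by (auto simp: dist_norm norm_minus_commute)
    then obtain y' where "y' \<in> disk \<eta>" "x = lo y'" using T(3) by blast
    then show ?thesis using sh[of y'] xs by auto
  qed
  then show ?thesis using eta \<delta>(1) by (intro exI[of _ "min \<eta> (\<delta> / 2)"]) auto
qed

section \<open>Hausdorff measure of balls and half-balls in a hyperplane\<close>

lemma diameter_le_metric:
  fixes S :: "'a::metric_space set"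
  assumes "bounded S" "0 \<le> d" "\<And>x y. x \<in> S \<Longrightarrow> y \<in> S \<Longrightarrow> dist x y \<le> d"
  shows "diameter S \<le> d"
proof (rule ccontr)
  assume "\<not> diameter S \<le> d"
  then obtain \<delta> where \<delta>: "d < \<delta>" "\<delta> < diameter S" using dense not_le by blast
  then obtain x y where "x \<in> S" "y \<in> S" "\<delta> < dist x y"
    using diameter_lower_bounded[OF assms(1)] assms(2) by (meson le_less_trans)
  then show False using assms(3) \<delta>(1) by fastforce
qed

lemma lipschitz_image_diameter:
  fixes f :: "'a::metric_space \<Rightarrow> 'b::metric_space"
  assumes "L-lipschitz_on S f" "bounded S"
  shows "bounded (f ` S)" "diameter (f ` S) \<le> L * diameter S"
proof -
  have L: "0 \<le> L" using assms(1) by (rule lipschitz_on_nonneg)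
  have d: "dist (f x) (f y) \<le> L * diameter S" if "x \<in> S" "y \<in> S" for x y
    using lipschitz_onD[OF assms(1) that] mult_left_mono[OF diameter_bounded_bound[OF assms(2) that] L]
    by linarith
  show "bounded (f ` S)"
  proof (cases "S = {}")
    case False
    then obtain x where "x \<in> S" by blast
    then show ?thesis unfolding bounded_def using d by blast
  qed simp
  then show "diameter (f ` S) \<le> L * diameter S"
    using d L diameter_ge_0[OF assms(2)] by (intro diameter_le_metric) auto
qed

lemma hausdorff_gauge_le:
  assumes "bounded S" "0 \<le> L" "diameter S \<le> L * diameter T" "S \<noteq> {} \<Longrightarrow> T \<noteq> {}"
  shows "hausdorff_gauge d S \<le> ennreal (L ^ d) * hausdorff_gauge d T"
proof (cases "S = {}")
  case False
  have "diameter S / 2 \<le> L * (diameter T / 2)" using assms(3) by simp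
  then have "(diameter S / 2) ^ d \<le> (L * (diameter T / 2)) ^ d"
    using diameter_ge_0[OF assms(1)] by (intro power_mono) auto
  then have "(diameter S / 2) ^ d \<le> L ^ d * (diameter T / 2) ^ d"
    by (simp only: power_mult_distrib)
  then have "unit_ball_vol (real d) * (diameter S / 2) ^ d
      \<le> L ^ d * (unit_ball_vol (real d) * (diameter T / 2) ^ d)"
    by (subst mult.left_commute) (intro mult_left_mono, auto)
  then show ?thesis using False assms(2,4)
    by (simp add: hausdorff_gauge_def ennreal_mult'[symmetric] ennreal_leI)
qed (simp add: hausdorff_gauge_def)

lemma hausdorff_gauge_mono:
  assumes "S \<subseteq> T" "bounded T"
  shows "hausdorff_gauge d S \<le> hausdorff_gauge d T"
proof -
  have "hausdorff_gauge d S \<le> ennreal (1 ^ d) * hausdorff_gauge d T"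
    using assms bounded_subset[OF assms(2,1)] diameter_subset[OF assms]
    by (intro hausdorff_gauge_le) auto
  then show ?thesis by simp
qed

lemma hausdorff_pre_le:
  assumes "A \<subseteq> (\<Union>i. C i)" "\<And>i. bounded (C i)" "\<And>i. diameter (C i) \<le> \<delta>"
  shows "hausdorff_pre d \<delta> A \<le> (\<Sum>i. hausdorff_gauge d (C i))"
  unfolding hausdorff_pre_def using assms by (intro INF_lower) auto

lemma hausdorff_pre_greatest:
  assumes "\<And>C :: nat \<Rightarrow> _. A \<subseteq> (\<Union>i. C i) \<Longrightarrow> (\<And>i. bounded (C i)) \<Longrightarrow> (\<And>i. diameter (C i) \<le> \<delta>)
     \<Longrightarrow> c \<le> (\<Sum>i. hausdorff_gauge d (C i))"
  shows "c \<le> hausdorff_pre d \<delta> A"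
  unfolding hausdorff_pre_def using assms by (intro INF_greatest) auto

lemma hausdorff_pre_finite_cover:
  assumes I: "finite I" and "A \<subseteq> (\<Union>i\<in>I. C i)" "\<And>i. i \<in> I \<Longrightarrow> bounded (C i)"
    "\<And>i. i \<in> I \<Longrightarrow> diameter (C i) \<le> \<delta>" "0 \<le> \<delta>"
  shows "hausdorff_pre d \<delta> A \<le> (\<Sum>i\<in>I. hausdorff_gauge d (C i))"
proof -
  obtain h where h: "bij_betw h {0..<card I} I" using ex_bij_betw_nat_finite[OF I] by blast
  define D where "D k = (if k < card I then C (h k) else {})" for k
  have hI: "h k \<in> I" if "k < card I" for k using h that by (auto simp: bij_betw_def)
  have "A \<subseteq> (\<Union>k. D k)"
  proof
    fix x assume "x \<in> A"
    then obtain i where "i \<in> I" "x \<in> C i" using assms(2) by blast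
    then obtain k where "k < card I" "h k = i" using h unfolding bij_betw_def by force
    then show "x \<in> (\<Union>k. D k)" using \<open>x \<in> C i\<close> by (auto simp: D_def)
  qed
  then have "hausdorff_pre d \<delta> A \<le> (\<Sum>k. hausdorff_gauge d (D k))"
    using assms hI by (intro hausdorff_pre_le) (auto simp: D_def)
  also have "\<dots> = (\<Sum>k\<in>{0..<card I}. hausdorff_gauge d (D k))"
    by (intro suminf_finite) (auto simp: D_def hausdorff_gauge_def)
  also have "\<dots> = (\<Sum>k\<in>{0..<card I}. hausdorff_gauge d (C (h k)))"
    by (intro sum.cong) (auto simp: D_def)
  also have "\<dots> = (\<Sum>i\<in>I. hausdorff_gauge d (C i))"
    by (rule sum.reindex_bij_betw[OF h])
  finally show ?thesis .
qed

lemma hausdorff_pre_antimono: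
  "\<delta> \<le> \<epsilon> \<Longrightarrow> hausdorff_pre d \<epsilon> A \<le> hausdorff_pre d \<delta> A"
  by (intro hausdorff_pre_greatest hausdorff_pre_le) (auto intro: order_trans)

lemma hausdorff_pre_le_measure: "0 < \<delta> \<Longrightarrow> hausdorff_pre d \<delta> A \<le> hausdorff_measure d A"
  unfolding hausdorff_measure_def by (intro SUP_upper) auto

lemma hausdorff_measure_least:
  "(\<And>\<delta>. 0 < \<delta> \<Longrightarrow> hausdorff_pre d \<delta> A \<le> c) \<Longrightarrow> hausdorff_measure d A \<le> c"
  unfolding hausdorff_measure_def by (intro SUP_least) auto

lemma hausdorff_measure_mono:
  assumes "A \<subseteq> B"
  shows "hausdorff_measure d A \<le> hausdorff_measure d B"
proof (rule hausdorff_measure_least)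
  fix \<delta> :: real assume "0 < \<delta>"
  have "hausdorff_pre d \<delta> A \<le> hausdorff_pre d \<delta> B"
    using assms by (intro hausdorff_pre_greatest hausdorff_pre_le) auto
  then show "hausdorff_pre d \<delta> A \<le> hausdorff_measure d B"
    using hausdorff_pre_le_measure[OF \<open>0 < \<delta>\<close>] order_trans by blast
qed

text \<open>
Mapping a cover of \<open>A\<close> by \<open>f\<close> scales all diameters by \<open>L\<close>. The factor is moved to the other side in
the infimum over covers since \<open>L ^ d\<close> is invertible.
\<close>
lemma hausdorff_measure_lipschitz_image:
  fixes f :: "'a::metric_space \<Rightarrow> 'b::metric_space"
  assumes f: "L-lipschitz_on A f" and L: "0 < L"
  shows "hausdorff_measure d (f ` A) \<le> ennreal (L ^ d) * hausdorff_measure d A"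
proof (rule hausdorff_measure_least)
  fix \<delta> :: real assume \<delta>: "0 < \<delta>"
  have Ld: "ennreal (L ^ d) * ennreal (inverse (L ^ d)) = 1"
    using L by (simp add: ennreal_mult'[symmetric])
  have "ennreal (inverse (L ^ d)) * hausdorff_pre d \<delta> (f ` A) \<le> hausdorff_pre d (\<delta> / L) A"
  proof (rule hausdorff_pre_greatest)
    fix C :: "nat \<Rightarrow> 'a set"
    assume C: "A \<subseteq> (\<Union>i. C i)" "\<And>i. bounded (C i)" "\<And>i. diameter (C i) \<le> \<delta> / L"
    define D where "D i = f ` (A \<inter> C i)" for i
    have lip: "L-lipschitz_on (A \<inter> C i) f" "bounded (A \<inter> C i)" for i
      using lipschitz_on_subset[OF f] C(2) by (auto intro: bounded_subset)
    have D: "bounded (D i)" "diameter (D i) \<le> L * diameter (C i)" for i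
    proof -
      have "L * diameter (A \<inter> C i) \<le> L * diameter (C i)"
        using L C(2) by (intro mult_left_mono diameter_subset) auto
      then show "bounded (D i)" "diameter (D i) \<le> L * diameter (C i)"
        using lipschitz_image_diameter[OF lip, of i] by (auto simp: D_def)
    qed
    have "hausdorff_pre d \<delta> (f ` A) \<le> (\<Sum>i. hausdorff_gauge d (D i))"
    proof (rule hausdorff_pre_le)
      show "f ` A \<subseteq> (\<Union>i. D i)" using C(1) unfolding D_def by blast
      have "L * diameter (C i) \<le> \<delta>" for i using C(3)[of i] L by (simp add: field_simps)
      then show "diameter (D i) \<le> \<delta>" for i using D(2) order_trans by blast
    qed (rule D)
    also have "\<dots> \<le> (\<Sum>i. ennreal (L ^ d) * hausdorff_gauge d (C i))"
      using L D by (intro suminf_le hausdorff_gauge_le) (auto simp: D_def)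
    also have "\<dots> = ennreal (L ^ d) * (\<Sum>i. hausdorff_gauge d (C i))" by simp
    finally have "ennreal (inverse (L ^ d)) * hausdorff_pre d \<delta> (f ` A)
        \<le> ennreal (inverse (L ^ d)) * (ennreal (L ^ d) * (\<Sum>i. hausdorff_gauge d (C i)))"
      by (rule mult_left_mono) simp
    then show "ennreal (inverse (L ^ d)) * hausdorff_pre d \<delta> (f ` A) \<le> (\<Sum>i. hausdorff_gauge d (C i))"
      using Ld by (simp add: mult.assoc[symmetric] mult.commute)
  qed
  also have "\<dots> \<le> hausdorff_measure d A"
    using \<delta> L by (intro hausdorff_pre_le_measure) simp
  finally have "ennreal (L ^ d) * (ennreal (inverse (L ^ d)) * hausdorff_pre d \<delta> (f ` A))
      \<le> ennreal (L ^ d) * hausdorff_measure d A"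
    by (rule mult_left_mono) simp
  then show "hausdorff_pre d \<delta> (f ` A) \<le> ennreal (L ^ d) * hausdorff_measure d A"
    using Ld by (simp add: mult.assoc[symmetric])
qed

lemma le_INF_add_INF:
  fixes f :: "'a \<Rightarrow> ennreal" and g :: "'b \<Rightarrow> ennreal"
  assumes le: "\<And>a b. a \<in> S \<Longrightarrow> b \<in> T \<Longrightarrow> x \<le> f a + g b"
  shows "x \<le> (INF a\<in>S. f a) + (INF b\<in>T. g b)"
proof (rule ennreal_le_epsilon)
  fix \<epsilon> :: real assume fin: "(INF a\<in>S. f a) + (INF b\<in>T. g b) < top" and \<epsilon>: "0 < \<epsilon>"
  define I J where "I = (INF a\<in>S. f a)" and "J = (INF b\<in>T. g b)"
  have IJ: "I \<noteq> \<infinity>" "J \<noteq> \<infinity>" using fin unfolding I_def[symmetric] J_def[symmetric] by auto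
  obtain a where a: "a \<in> S" "f a < I + ennreal (\<epsilon> / 2)"
    using INF_approx_ennreal[OF _ I_def IJ(1), of "\<epsilon> / 2"] \<epsilon> by auto
  obtain b where b: "b \<in> T" "g b < J + ennreal (\<epsilon> / 2)"
    using INF_approx_ennreal[OF _ J_def IJ(2), of "\<epsilon> / 2"] \<epsilon> by auto
  have "x \<le> f a + g b" using le a b by blast
  also have "\<dots> \<le> (I + ennreal (\<epsilon> / 2)) + (J + ennreal (\<epsilon> / 2))"
    using a b by (intro add_mono) auto
  also have "\<dots> = I + J + (ennreal (\<epsilon> / 2) + ennreal (\<epsilon> / 2))"
    by (simp only: ac_simps)
  also have "ennreal (\<epsilon> / 2) + ennreal (\<epsilon> / 2) = ennreal \<epsilon>"
    using \<epsilon> by (simp add: ennreal_plus[symmetric])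
  finally show "x \<le> (INF a\<in>S. f a) + (INF b\<in>T. g b) + ennreal \<epsilon>"
    by (simp only: I_def J_def)
qed

text \<open>
Two covers are interleaved into one: even indices cover \<open>A\<close>, odd indices cover \<open>B\<close>.
\<close>
lemma hausdorff_measure_subadditive:
  "hausdorff_measure d (A \<union> B) \<le> hausdorff_measure d A + hausdorff_measure d B"
proof (rule hausdorff_measure_least)
  fix \<delta> :: real assume \<delta>: "0 < \<delta>"
  have "hausdorff_pre d \<delta> (A \<union> B) \<le> hausdorff_pre d \<delta> A + hausdorff_pre d \<delta> B"
    unfolding hausdorff_pre_def[of d \<delta> A] hausdorff_pre_def[of d \<delta> B]
  proof (rule le_INF_add_INF)
    fix C D :: "nat \<Rightarrow> 'a set"
    assume C: "C \<in> {C. A \<subseteq> (\<Union>i. C i) \<and> (\<forall>i. bounded (C i) \<and> diameter (C i) \<le> \<delta>)}"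
      and D: "D \<in> {C. B \<subseteq> (\<Union>i. C i) \<and> (\<forall>i. bounded (C i) \<and> diameter (C i) \<le> \<delta>)}"
    define E where "E i = (if even i then C (i div 2) else D (i div 2))" for i
    have "C i = E (2 * i)" "D i = E (2 * i + 1)" for i by (auto simp: E_def)
    then have "C i \<subseteq> (\<Union>i. E i)" "D i \<subseteq> (\<Union>i. E i)" for i by (metis UN_upper UNIV_I)+
    then have "(\<Union>i. C i) \<union> (\<Union>i. D i) \<subseteq> (\<Union>i. E i)" by (intro Un_least UN_least)
    moreover have "A \<subseteq> (\<Union>i. C i)" "B \<subseteq> (\<Union>i. D i)" using C D by simp_all
    ultimately have "A \<union> B \<subseteq> (\<Union>i. E i)" by (meson Un_mono order_trans)
    then have "hausdorff_pre d \<delta> (A \<union> B) \<le> (\<Sum>i. hausdorff_gauge d (E i))"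
      using C D by (intro hausdorff_pre_le) (auto simp: E_def)
    also have "\<dots> \<le> (\<Sum>i. hausdorff_gauge d (C i)) + (\<Sum>i. hausdorff_gauge d (D i))"
    proof (rule suminf_le_const)
      fix n
      have "(\<Sum>i<n. hausdorff_gauge d (E i)) \<le> (\<Sum>i<2 * n. hausdorff_gauge d (E i))"
        by (intro sum_mono2) auto
      also have "\<dots> = (\<Sum>i<n. hausdorff_gauge d (C i)) + (\<Sum>i<n. hausdorff_gauge d (D i))"
        by (induction n) (auto simp: E_def ac_simps)
      also have "\<dots> \<le> (\<Sum>i. hausdorff_gauge d (C i)) + (\<Sum>i. hausdorff_gauge d (D i))"
        by (intro add_mono sum_le_suminf) auto
      finally show "(\<Sum>i<n. hausdorff_gauge d (E i))
          \<le> (\<Sum>i. hausdorff_gauge d (C i)) + (\<Sum>i. hausdorff_gauge d (D i))" .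
    qed simp
    finally show "hausdorff_pre d \<delta> (A \<union> B)
        \<le> (\<Sum>i. hausdorff_gauge d (C i)) + (\<Sum>i. hausdorff_gauge d (D i))" .
  qed
  also have "\<dots> \<le> hausdorff_measure d A + hausdorff_measure d B"
    using \<delta> by (intro add_mono hausdorff_pre_le_measure)
  finally show "hausdorff_pre d \<delta> (A \<union> B) \<le> hausdorff_measure d A + hausdorff_measure d B" .
qed

text \<open>
A set of diameter less than \<open>s\<close> cannot meet both \<open>A\<close> and \<open>B\<close>, so a fine cover of the union splits
into a cover of \<open>A\<close> and a cover of \<open>B\<close> at no extra cost.
\<close>
lemma hausdorff_measure_separated:
  assumes s: "0 < s" and sep: "\<And>x y. x \<in> A \<Longrightarrow> y \<in> B \<Longrightarrow> s \<le> dist x y"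
  shows "hausdorff_measure d A + hausdorff_measure d B \<le> hausdorff_measure d (A \<union> B)"
proof -
  have pre: "hausdorff_pre d \<delta> A + hausdorff_pre d \<delta> B \<le> hausdorff_pre d \<delta> (A \<union> B)"
    if \<delta>: "0 < \<delta>" "\<delta> < s" for \<delta>
  proof (rule hausdorff_pre_greatest)
    fix C :: "nat \<Rightarrow> 'a set"
    assume C: "A \<union> B \<subseteq> (\<Union>i. C i)" "\<And>i. bounded (C i)" "\<And>i. diameter (C i) \<le> \<delta>"
    have bd: "bounded (C i \<inter> S)" "diameter (C i \<inter> S) \<le> \<delta>" for i S
      using C(2,3) diameter_subset[of "C i \<inter> S" "C i"]
      by (auto intro: bounded_subset order_trans)
    have "hausdorff_pre d \<delta> A + hausdorff_pre d \<delta> B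
        \<le> (\<Sum>i. hausdorff_gauge d (C i \<inter> A)) + (\<Sum>i. hausdorff_gauge d (C i \<inter> B))"
      using C(1) bd by (intro add_mono hausdorff_pre_le) auto
    also have "\<dots> = (\<Sum>i. hausdorff_gauge d (C i \<inter> A) + hausdorff_gauge d (C i \<inter> B))"
      by (rule suminf_add) auto
    also have "\<dots> \<le> (\<Sum>i. hausdorff_gauge d (C i))"
    proof (rule suminf_le)
      fix i
      have "C i \<inter> A = {} \<or> C i \<inter> B = {}"
      proof (rule ccontr)
        assume "\<not> ?thesis"
        then obtain x y where "x \<in> C i" "x \<in> A" "y \<in> C i" "y \<in> B" by blast
        then have "s \<le> diameter (C i)"
          using sep diameter_bounded_bound[OF C(2)] order_trans by blast
        then show False using C(3)[of i] \<delta> by linarith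
      qed
      moreover have m: "hausdorff_gauge d (C i \<inter> S) \<le> hausdorff_gauge d (C i)" for S
        using C(2) by (intro hausdorff_gauge_mono) auto
      moreover have z: "hausdorff_gauge d {} = 0" by (simp add: hausdorff_gauge_def)
      ultimately show "hausdorff_gauge d (C i \<inter> A) + hausdorff_gauge d (C i \<inter> B) \<le> hausdorff_gauge d (C i)"
        by (elim disjE) (simp_all only: z m add_0_left add_0_right)
    qed auto
    finally show "hausdorff_pre d \<delta> A + hausdorff_pre d \<delta> B \<le> (\<Sum>i. hausdorff_gauge d (C i))" .
  qed
  have le: "hausdorff_pre d \<delta> A + hausdorff_pre d \<epsilon> B \<le> hausdorff_measure d (A \<union> B)"
    if "0 < \<delta>" "0 < \<epsilon>" for \<delta> \<epsilon>
  proof -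
    define \<theta> where "\<theta> = min (s / 2) (min \<delta> \<epsilon>)"
    have \<theta>: "0 < \<theta>" "\<theta> < s" "\<theta> \<le> \<delta>" "\<theta> \<le> \<epsilon>" using that s by (auto simp: \<theta>_def)
    have "hausdorff_pre d \<delta> A + hausdorff_pre d \<epsilon> B \<le> hausdorff_pre d \<theta> A + hausdorff_pre d \<theta> B"
      using \<theta> by (intro add_mono hausdorff_pre_antimono)
    also have "\<dots> \<le> hausdorff_pre d \<theta> (A \<union> B)" using \<theta> by (intro pre)
    also have "\<dots> \<le> hausdorff_measure d (A \<union> B)" using \<theta> by (intro hausdorff_pre_le_measure)
    finally show ?thesis .
  qed
  have "hausdorff_measure d A + hausdorff_pre d \<epsilon> B \<le> hausdorff_measure d (A \<union> B)" if "0 < \<epsilon>" for \<epsilon>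
  proof -
    have "hausdorff_measure d A + hausdorff_pre d \<epsilon> B
        = (SUP \<delta>\<in>{0<..}. hausdorff_pre d \<delta> A + hausdorff_pre d \<epsilon> B)"
      unfolding hausdorff_measure_def by (subst ennreal_SUP_add_left) auto
    also have "\<dots> \<le> hausdorff_measure d (A \<union> B)" using le that by (intro SUP_least) auto
    finally show ?thesis .
  qed
  then have "(SUP \<epsilon>\<in>{0<..}. hausdorff_measure d A + hausdorff_pre d \<epsilon> B) \<le> hausdorff_measure d (A \<union> B)"
    by (intro SUP_least) auto
  moreover have "hausdorff_measure d A + hausdorff_measure d B
      = (SUP \<epsilon>\<in>{0<..}. hausdorff_measure d A + hausdorff_pre d \<epsilon> B)"
    unfolding hausdorff_measure_def[of d B] by (subst ennreal_SUP_add_right) auto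
  ultimately show ?thesis by simp
qed

text \<open>
Of the grid of mesh \<open>1 / k\<close>, at most \<open>(2 * k + 1) ^ d\<close> cells meet the ball, each of diameter at most
\<open>N / k\<close>; the resulting bound does not depend on \<open>k\<close>.
\<close>
lemma hausdorff_horizontal_ball_finite:
  "hausdorff_measure (CARD('n) - 1) ((horizontal :: (real ^ 'n::finite) set) \<inter> cball 0 1) < \<infinity>"
proof -
  define d where "d = CARD('n) - 1"
  define N where "N = real CARD('n)"
  define B where "B = (horizontal :: (real ^ 'n) set) \<inter> cball 0 1"
  define \<omega> where "\<omega> = unit_ball_vol (real d)"
  have \<omega>: "0 \<le> \<omega>" by (simp add: \<omega>_def)
  have N: "0 \<le> N" by (simp add: N_def)
  have "hausdorff_measure d B \<le> ennreal (\<omega> * (3 * N / 2) ^ d)"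
  proof (rule hausdorff_measure_least)
    fix \<delta> :: real assume \<delta>: "0 < \<delta>"
    obtain k0 :: nat where k0: "N / \<delta> < real k0" using reals_Archimedean2 by blast
    define k where "k = Suc k0"
    have k: "0 < real k" "N / real k \<le> \<delta>"
      using k0 \<delta> by (auto simp: k_def field_simps)
    define S :: "'n \<Rightarrow> int set" where "S i = (if i = last_coord then {0} else {- int k..int k})" for i
    define F where "F = (PiE UNIV S)"
    define cell where "cell f = {x \<in> B. \<forall>i. \<lfloor>real k * x $ i\<rfloor> = f i}" for f :: "'n \<Rightarrow> int"
    have finF: "finite F" unfolding F_def by (intro finite_PiE) (auto simp: S_def)
    have "card F = (\<Prod>i\<in>UNIV. card (S i))" unfolding F_def by (rule card_PiE) simp
    also have "\<dots> = card (S last_coord) * (\<Prod>i\<in>UNIV - {last_coord}. card (S i))"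
      by (rule prod.remove) auto
    also have "(\<Prod>i\<in>UNIV - {last_coord}. card (S i)) = (\<Prod>i\<in>(UNIV::'n set) - {last_coord}. 2 * k + 1)"
      by (rule prod.cong) (auto simp: S_def)
    finally have cardF: "card F = (2 * k + 1) ^ d"
      by (simp add: S_def d_def card_Diff_singleton)
    have cover: "B \<subseteq> (\<Union>f\<in>F. cell f)"
    proof
      fix x assume x: "x \<in> B"
      define f where "f = (\<lambda>i. \<lfloor>real k * x $ i\<rfloor>)"
      have "f i \<in> S i" for i
      proof (cases "i = last_coord")
        case True
        then show ?thesis using x by (simp add: f_def S_def B_def horizontal_def)
      next
        case False
        have "\<bar>x $ i\<bar> \<le> 1" using component_le_norm_cart[of x i] x by (simp add: B_def)
        then have "real k * x $ i \<le> real k * 1" "real k * (- 1) \<le> real k * x $ i"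
          using k(1) by (intro mult_left_mono; simp)+
        then have "\<lfloor>real k * x $ i\<rfloor> \<le> int k" "- int k \<le> \<lfloor>real k * x $ i\<rfloor>"
          by (simp_all add: floor_le_iff le_floor_iff)
        then show ?thesis using False by (simp add: f_def S_def)
      qed
      then have "f \<in> F" by (simp add: F_def PiE_def Pi_def)
      then show "x \<in> (\<Union>f\<in>F. cell f)" using x by (auto simp: cell_def f_def)
    qed
    have bd: "bounded (cell f)" for f
      by (rule bounded_subset[of "cball 0 1"]) (auto simp: cell_def B_def)
    have diam: "diameter (cell f) \<le> N / real k" for f
    proof (rule diameter_le_metric[OF bd])
      fix x y assume xy: "x \<in> cell f" "y \<in> cell f"
      have "\<bar>(x - y) $ i\<bar> \<le> 1 / real k" for i
      proof -
        have "\<lfloor>real k * x $ i\<rfloor> = \<lfloor>real k * y $ i\<rfloor>" using xy by (simp add: cell_def)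
        then have "\<bar>real k * x $ i - real k * y $ i\<bar> \<le> 1" by linarith
        then have "real k * \<bar>(x - y) $ i\<bar> \<le> 1"
          using k(1) by (simp add: abs_mult right_diff_distrib[symmetric])
        then show ?thesis using k(1) by (simp add: field_simps)
      qed
      then have "(\<Sum>i\<in>UNIV. \<bar>(x - y) $ i\<bar>) \<le> (\<Sum>i\<in>(UNIV::'n set). 1 / real k)" by (intro sum_mono)
      then show "dist x y \<le> N / real k"
        using norm_le_l1_cart[of "x - y"] by (simp add: dist_norm N_def)
    qed (use N k in simp)
    have "hausdorff_pre d \<delta> B \<le> (\<Sum>f\<in>F. hausdorff_gauge d (cell f))"
      using finF cover bd diam k(2) \<delta> by (intro hausdorff_pre_finite_cover) (auto intro: order_trans)
    also have "\<dots> \<le> (\<Sum>f\<in>F. ennreal (\<omega> * (N / real k / 2) ^ d))"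
    proof (rule sum_mono)
      fix f
      have "(diameter (cell f) / 2) ^ d \<le> (N / real k / 2) ^ d"
        using diam[of f] diameter_ge_0[OF bd, of f] by (intro power_mono) auto
      then have "\<omega> * (diameter (cell f) / 2) ^ d \<le> \<omega> * (N / real k / 2) ^ d"
        using \<omega> by (rule mult_left_mono)
      then show "hausdorff_gauge d (cell f) \<le> ennreal (\<omega> * (N / real k / 2) ^ d)"
        by (simp add: hausdorff_gauge_def \<omega>_def ennreal_leI)
    qed
    also have "\<dots> = ennreal (real (card F) * (\<omega> * (N / real k / 2) ^ d))"
      using \<omega> N k by (simp add: ennreal_mult ennreal_of_nat_eq_real_of_nat)
    also have "\<dots> \<le> ennreal (\<omega> * (3 * N / 2) ^ d)"
    proof (rule ennreal_leI)
      have "real (2 * k + 1) * (N / real k / 2) \<le> 3 * N / 2"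
      proof -
        have "real (2 * k + 1) \<le> 3 * real k" by (simp add: k_def)
        then have "real (2 * k + 1) * (N / real k / 2) \<le> 3 * real k * (N / real k / 2)"
          using N k by (intro mult_right_mono) auto
        then show ?thesis using k(1) by simp
      qed
      then have "(real (2 * k + 1) * (N / real k / 2)) ^ d \<le> (3 * N / 2) ^ d"
        using N by (intro power_mono) auto
      then have "real (card F) * (N / real k / 2) ^ d \<le> (3 * N / 2) ^ d"
        unfolding cardF of_nat_power power_mult_distrib .
      from mult_left_mono[OF this \<omega>]
      show "real (card F) * (\<omega> * (N / real k / 2) ^ d) \<le> \<omega> * (3 * N / 2) ^ d"
        by (simp only: mult.left_commute)
    qed
    finally show "hausdorff_pre d \<delta> B \<le> ennreal (\<omega> * (3 * N / 2) ^ d)" .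
  qed
  then show ?thesis unfolding d_def B_def
    by (metis ennreal_less_top infinity_ennreal_def order_le_less_trans)
qed

lemma prod_last_coord:
  "(\<Prod>i\<in>(UNIV::'n::finite set). if i = last_coord then 1 else c) = c ^ (CARD('n) - 1)"
  for c :: real
proof -
  have "(\<Prod>i\<in>(UNIV::'n set). if i = last_coord then 1 else c)
      = (\<Prod>i\<in>(UNIV::'n set) - {last_coord}. if i = last_coord then 1 else c)"
    by (subst prod.remove[of _ last_coord]) auto
  also have "\<dots> = (\<Prod>i\<in>(UNIV::'n set) - {last_coord}. c)" by (rule prod.cong) auto
  finally show ?thesis by (simp add: card_Diff_singleton)
qed

lemma emeasure_box_over_horizontal:
  fixes x :: "real ^ 'n::finite"
  assumes "0 \<le> D"
  shows "emeasure lborel (cbox (\<chi> i. if i = last_coord then 0 else x $ i - D)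
           (\<chi> i. if i = last_coord then 1 else x $ i + D)) = ennreal ((2 * D) ^ (CARD('n) - 1))"
    (is "emeasure lborel (cbox ?a ?b) = _")
proof -
  have "?a $ i \<le> ?b $ i" for i using assms by simp
  then have "cbox ?a ?b \<noteq> {}" by (simp add: interval_ne_empty_cart)
  then have "measure lborel (cbox ?a ?b) = (\<Prod>i\<in>UNIV. ?b $ i - ?a $ i)" by (rule content_cbox_cart)
  also have "\<dots> = (\<Prod>i\<in>(UNIV::'n set). if i = last_coord then 1 else 2 * D)"
    by (rule prod.cong) auto
  also have "\<dots> = (2 * D) ^ (CARD('n) - 1)" by (rule prod_last_coord)
  finally have m: "measure lborel (cbox ?a ?b) = (2 * D) ^ (CARD('n) - 1)" .
  have "emeasure lborel (cbox ?a ?b) = ennreal (measure lborel (cbox ?a ?b))"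
    by (rule emeasure_eq_ennreal_measure) (use emeasure_lborel_cbox_finite[of ?a ?b] in simp)
  then show ?thesis by (simp only: m)
qed

text \<open>
Thickening a covering set of diameter \<open>D\<close> by the unit interval in the last coordinate puts it into
a box of volume \<open>(2 * D) ^ d\<close>, a fixed multiple of its gauge. The thickened cover contains a
fixed box of positive volume, so Lebesgue measure bounds the gauges from below.
\<close>
lemma hausdorff_horizontal_ball_pos:
  "0 < hausdorff_measure (CARD('n) - 1) ((horizontal :: (real ^ 'n::finite) set) \<inter> cball 0 1)"
proof -
  define d where "d = CARD('n) - 1"
  define B where "B = (horizontal :: (real ^ 'n) set) \<inter> cball 0 1"
  define N where "N = real CARD('n)"
  have N: "0 < N" by (simp add: N_def)
  define \<omega> where "\<omega> = unit_ball_vol (real d)"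
  have \<omega>: "0 < \<omega>" by (simp add: \<omega>_def)
  define box where "box x D = cbox (\<chi> i. if i = last_coord then 0 else x $ i - D)
      (\<chi> i. if i = last_coord then 1 else x $ i + D)" for x :: "real ^ 'n" and D :: real
  have mbox: "z \<in> box x D \<longleftrightarrow> 0 \<le> z $ last_coord \<and> z $ last_coord \<le> 1 \<and>
      (\<forall>i. i \<noteq> last_coord \<longrightarrow> \<bar>z $ i - x $ i\<bar> \<le> D)" for z x D
    unfolding box_def mem_box_cart by (auto simp: abs_le_iff algebra_simps)
  have ebox: "0 \<le> D \<Longrightarrow> emeasure lborel (box x D) = ennreal ((2 * D) ^ d)" for x D
    unfolding box_def d_def by (rule emeasure_box_over_horizontal)
  have "ennreal (\<omega> / 4 ^ d * (2 / N) ^ d) \<le> hausdorff_pre d 1 B"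
  proof (rule hausdorff_pre_greatest)
    fix C :: "nat \<Rightarrow> (real ^ 'n) set"
    assume C: "B \<subseteq> (\<Union>i. C i)" "\<And>i. bounded (C i)" "\<And>i. diameter (C i) \<le> 1"
    define c where "c i = (SOME x. x \<in> C i)" for i
    define E where "E i = (if C i = {} then {} else box (c i) (diameter (C i)))" for i
    have "box 0 (1 / N) \<subseteq> (\<Union>i. E i)"
    proof
      fix z assume z: "z \<in> box 0 (1 / N)"
      define x :: "real ^ 'n" where "x = (\<chi> i. if i = last_coord then 0 else z $ i)"
      have "\<bar>x $ i\<bar> \<le> 1 / N" for i using z N by (simp add: mbox x_def)
      then have "(\<Sum>i\<in>UNIV. \<bar>x $ i\<bar>) \<le> (\<Sum>i\<in>(UNIV::'n set). 1 / N)" by (intro sum_mono)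
      then have "norm x \<le> 1" using norm_le_l1_cart[of x] N by (simp add: N_def)
      then have "x \<in> B" by (simp add: B_def horizontal_def x_def)
      then obtain i where i: "x \<in> C i" using C(1) by blast
      then have ci: "c i \<in> C i" unfolding c_def by (rule someI)
      have "\<bar>z $ j - c i $ j\<bar> \<le> diameter (C i)" if "j \<noteq> last_coord" for j
        using diameter_bounded_bound[OF C(2) i ci] component_le_norm_cart[of "x - c i" j] that
        by (simp add: dist_norm x_def)
      then have "z \<in> E i" using i z by (auto simp: E_def mbox)
      then show "z \<in> (\<Union>i. E i)" by blast
    qed
    then have "emeasure lborel (box 0 (1 / N)) \<le> emeasure lborel (\<Union>i. E i)"
      by (intro emeasure_mono) (auto simp: E_def box_def)
    also have "\<dots> \<le> (\<Sum>i. emeasure lborel (E i))"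
      by (intro emeasure_subadditive_countably) (auto simp: E_def box_def)
    also have "\<dots> = (\<Sum>i. ennreal (4 ^ d / \<omega>) * hausdorff_gauge d (C i))"
    proof (rule suminf_cong)
      fix i
      show "emeasure lborel (E i) = ennreal (4 ^ d / \<omega>) * hausdorff_gauge d (C i)"
      proof (cases "C i = {}")
        case False
        let ?D = "diameter (C i)"
        have D: "0 \<le> ?D" by (rule diameter_ge_0[OF C(2)])
        have "(2 * ?D) ^ d = (4 * (?D / 2)) ^ d" by simp
        then have "(2 * ?D) ^ d = 4 ^ d * (?D / 2) ^ d" by (simp only: power_mult_distrib)
        then have "(2 * ?D) ^ d = 4 ^ d / \<omega> * (\<omega> * (?D / 2) ^ d)" using \<omega> by simp
        then show ?thesis using False ebox[OF D] \<omega> D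
          by (simp add: E_def hausdorff_gauge_def \<omega>_def[symmetric] ennreal_mult'[symmetric])
      qed (simp add: E_def hausdorff_gauge_def)
    qed
    also have "\<dots> = ennreal (4 ^ d / \<omega>) * (\<Sum>i. hausdorff_gauge d (C i))" by simp
    finally have "ennreal ((2 * (1 / N)) ^ d) \<le> ennreal (4 ^ d / \<omega>) * (\<Sum>i. hausdorff_gauge d (C i))"
      using ebox[of "1 / N" 0] N by simp
    then have "ennreal (\<omega> / 4 ^ d) * ennreal ((2 * (1 / N)) ^ d)
        \<le> ennreal (\<omega> / 4 ^ d) * (ennreal (4 ^ d / \<omega>) * (\<Sum>i. hausdorff_gauge d (C i)))"
      by (rule mult_left_mono) simp
    also have "\<dots> = (\<Sum>i. hausdorff_gauge d (C i))"
      using \<omega> by (simp add: mult.assoc[symmetric] ennreal_mult'[symmetric])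
    also have "ennreal (\<omega> / 4 ^ d) * ennreal ((2 * (1 / N)) ^ d) = ennreal (\<omega> / 4 ^ d * (2 / N) ^ d)"
      using \<omega> N by (subst ennreal_mult'[symmetric]) auto
    finally show "ennreal (\<omega> / 4 ^ d * (2 / N) ^ d) \<le> (\<Sum>i. hausdorff_gauge d (C i))" .
  qed
  then have "ennreal (\<omega> / 4 ^ d * (2 / N) ^ d) \<le> hausdorff_measure d B"
    using hausdorff_pre_le_measure[of 1 d B] by simp
  moreover have "0 < ennreal (\<omega> / 4 ^ d * (2 / N) ^ d)" using \<omega> N by simp
  ultimately show ?thesis unfolding d_def B_def by (rule less_le_trans[rotated])
qed

lemma lipschitz_scaleR_orthogonal:
  assumes "orthogonal_transformation Q" "0 \<le> c"
  shows "c-lipschitz_on S (\<lambda>x. c *\<^sub>R Q x)"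
proof (rule lipschitz_onI)
  fix x y
  have "c *\<^sub>R Q x - c *\<^sub>R Q y = c *\<^sub>R Q (x - y)"
    using assms(1) by (simp add: orthogonal_transformation_def linear_diff scaleR_diff_right)
  then show "dist (c *\<^sub>R Q x) (c *\<^sub>R Q y) \<le> c * dist x y"
    using assms by (simp add: dist_norm orthogonal_transformation_norm)
qed (use assms in simp)

text \<open>
Any two hyperplanes through the origin are related by an orthogonal transformation, so balls in
them may be compared at the cost of the scaling factor alone.
\<close>
lemma hausdorff_hyperplane_ball_scale:
  fixes e e' :: "real ^ 'n::finite"
  assumes "norm e = 1" "norm e' = 1" "0 < c"
  shows "hausdorff_measure d ({y. e' \<bullet> y = 0} \<inter> cball 0 (c * s))
       \<le> ennreal (c ^ d) * hausdorff_measure d ({y. e \<bullet> y = 0} \<inter> cball 0 s)"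
proof -
  obtain Q where Q: "orthogonal_transformation Q" "Q e' = e"
    using orthogonal_transformation_exists[of e' e] assms by auto
  let ?R = "inv Q"
  have R: "orthogonal_transformation ?R" using Q(1) by (rule orthogonal_transformation_inv)
  have bij: "bij Q" using Q(1) by (rule orthogonal_transformation_bij)
  have QR: "Q (?R y) = y" "?R (Q y) = y" for y
    using bij by (simp_all add: bij_is_surj surj_f_inv_f bij_is_inj)
  have ip: "Q x \<bullet> Q y = x \<bullet> y" for x y using Q(1) by (simp add: orthogonal_transformation_def)
  have "{y. e' \<bullet> y = 0} \<inter> cball 0 (c * s) \<subseteq> (\<lambda>y. c *\<^sub>R ?R y) ` ({y. e \<bullet> y = 0} \<inter> cball 0 s)"
  proof
    fix y assume y: "y \<in> {y. e' \<bullet> y = 0} \<inter> cball 0 (c * s)"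
    define x where "x = (1 / c) *\<^sub>R Q y"
    have "e \<bullet> x = 0" using y ip[of e' y] Q(2) by (simp add: x_def)
    moreover have "norm x \<le> s"
      using y assms(3) orthogonal_transformation_norm[OF Q(1), of y] by (simp add: x_def field_simps)
    moreover have "y = c *\<^sub>R ?R x"
      using R assms(3) QR(2)[of y] by (simp add: x_def orthogonal_transformation_def linear_cmul)
    ultimately show "y \<in> (\<lambda>y. c *\<^sub>R ?R y) ` ({y. e \<bullet> y = 0} \<inter> cball 0 s)" by auto
  qed
  then have "hausdorff_measure d ({y. e' \<bullet> y = 0} \<inter> cball 0 (c * s))
      \<le> hausdorff_measure d ((\<lambda>y. c *\<^sub>R ?R y) ` ({y. e \<bullet> y = 0} \<inter> cball 0 s))"
    by (rule hausdorff_measure_mono)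
  also have "\<dots> \<le> ennreal (c ^ d) * hausdorff_measure d ({y. e \<bullet> y = 0} \<inter> cball 0 s)"
    using assms(3) by (intro hausdorff_measure_lipschitz_image lipschitz_scaleR_orthogonal R) auto
  finally show ?thesis .
qed

lemma hausdorff_horizontal_ball:
  fixes s :: real
  assumes s: "0 < s"
  defines "H \<equiv> hausdorff_measure (CARD('n) - 1) ((horizontal :: (real ^ 'n::finite) set) \<inter> cball 0 s)"
  shows "H \<noteq> 0" "H \<noteq> \<infinity>"
proof -
  let ?d = "CARD('n) - 1" and ?e = "axis last_coord 1 :: real ^ 'n"
  let ?H1 = "hausdorff_measure ?d ((horizontal :: (real ^ 'n) set) \<inter> cball 0 1)"
  have e: "norm ?e = 1" by simp
  have "?H1 \<le> ennreal ((1 / s) ^ ?d) * H"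
    using hausdorff_hyperplane_ball_scale[OF e e, of "1 / s" ?d s] s
    by (simp add: H_def horizontal_eq_orthogonal)
  then show "H \<noteq> 0" using hausdorff_horizontal_ball_pos[where 'n='n] by auto
  have "H \<le> ennreal (s ^ ?d) * ?H1"
    using hausdorff_hyperplane_ball_scale[OF e e s, of ?d 1] by (simp add: H_def horizontal_eq_orthogonal)
  also have "\<dots> < \<infinity>"
    using hausdorff_horizontal_ball_finite[where 'n='n] by (simp add: ennreal_mult_less_top)
  finally show "H \<noteq> \<infinity>" by simp
qed

lemma hausdorff_measure_isometric_le:
  assumes "\<And>x y. x \<in> A \<Longrightarrow> y \<in> A \<Longrightarrow> dist (f x) (f y) \<le> dist x y" "B \<subseteq> f ` A"
  shows "hausdorff_measure d B \<le> hausdorff_measure d A"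
proof -
  have "1-lipschitz_on A f" using assms(1) by (intro lipschitz_onI) auto
  from hausdorff_measure_lipschitz_image[OF this, of d]
  have "hausdorff_measure d (f ` A) \<le> hausdorff_measure d A" by simp
  then show ?thesis using hausdorff_measure_mono[OF assms(2), of d] by (rule order_trans[rotated])
qed

text \<open>
The density \<open>3 / 2\<close> comes from here: up to the factor \<open>(1 - \<epsilon>) ^ d\<close>, the cap \<open>K\<close> has the measure of a
half-ball, and it is counted twice, together with the opposite half-ball \<open>L\<close> counted once. Half-balls
carry at least half of the measure of the ball by the symmetry \<open>y \<mapsto> - y\<close> and subadditivity.
The cap keeps the distance \<open>\<epsilon> * s\<close> from the boundary hyperplane; it therefore lies inside a
ball tangent to that hyperplane at the origin as soon as \<open>s\<close> is small.
\<close>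
lemma hausdorff_three_halves_ball:
  fixes u :: "'a::euclidean_space"
  assumes V: "subspace V" and u: "u \<in> V" "norm u = 1" and \<epsilon>: "0 < \<epsilon>" "\<epsilon> < 1" and s: "0 < s"
  defines "K \<equiv> {y \<in> V \<inter> cball 0 s. \<epsilon> * s \<le> u \<bullet> y}" and "L \<equiv> {y \<in> V \<inter> cball 0 s. u \<bullet> y \<le> 0}"
  shows "ennreal (1 / 2 + (1 - \<epsilon>) ^ d) * hausdorff_measure d (V \<inter> cball 0 s)
       \<le> hausdorff_measure d K + hausdorff_measure d (K \<union> L)"
proof -
  let ?H = "hausdorff_measure d"
  define U where "U = {y \<in> V \<inter> cball 0 s. 0 \<le> u \<bullet> y}"
  have UL: "?H U \<le> ?H L"
  proof (rule hausdorff_measure_isometric_le)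
    show "U \<subseteq> uminus ` L"
    proof
      fix y assume "y \<in> U"
      then have "- y \<in> L" using V by (simp add: U_def L_def subspace_neg)
      then show "y \<in> uminus ` L" by force
    qed
  qed (simp add: dist_minus)
  have LU: "?H L \<le> ?H U"
  proof (rule hausdorff_measure_isometric_le)
    show "L \<subseteq> uminus ` U"
    proof
      fix y assume "y \<in> L"
      then have "- y \<in> U" using V by (simp add: U_def L_def subspace_neg)
      then show "y \<in> uminus ` U" by force
    qed
  qed (simp add: dist_minus)
  have "V \<inter> cball 0 s = U \<union> L" by (auto simp: U_def L_def)
  then have ball: "?H (V \<inter> cball 0 s) \<le> ?H U + ?H L" by (simp add: hausdorff_measure_subadditive)
  have two: "x + x = ennreal 2 * x" for x :: ennreal by (simp add: mult_2)
  have half: "ennreal (1 / 2) * ?H (V \<inter> cball 0 s) \<le> a" if "?H (V \<inter> cball 0 s) \<le> ennreal 2 * a" for a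
  proof -
    have "ennreal (1 / 2) * ?H (V \<inter> cball 0 s) \<le> ennreal (1 / 2) * (ennreal 2 * a)"
      using that by (rule mult_left_mono) simp
    also have "\<dots> = (ennreal (1 / 2) * ennreal 2) * a" by (simp only: mult.assoc)
    also have "ennreal (1 / 2) * ennreal 2 = 1" by (subst ennreal_mult'[symmetric]) auto
    finally show ?thesis by simp
  qed
  have L: "ennreal (1 / 2) * ?H (V \<inter> cball 0 s) \<le> ?H L"
  proof (rule half)
    show "?H (V \<inter> cball 0 s) \<le> ennreal 2 * ?H L"
      using ball add_right_mono[OF UL, of "?H L"] two[of "?H L"] by simp
  qed
  \<comment> \<open>stretches the cap over the upper half-ball \<open>U\<close>\<close>
  define \<phi> where "\<phi> x = (1 / (1 - \<epsilon>)) *\<^sub>R (x - (\<epsilon> * s) *\<^sub>R u)" for x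
  have "U \<subseteq> \<phi> ` K"
  proof
    fix y assume y: "y \<in> U"
    define x where "x = (1 - \<epsilon>) *\<^sub>R y + (\<epsilon> * s) *\<^sub>R u"
    have uu: "u \<bullet> u = 1" using u by (simp add: norm_eq_1)
    have "x \<in> V" using y u V by (simp add: x_def U_def subspace_add subspace_scale)
    moreover have "norm x \<le> s"
    proof -
      have "norm x \<le> norm ((1 - \<epsilon>) *\<^sub>R y) + norm ((\<epsilon> * s) *\<^sub>R u)"
        unfolding x_def by (rule norm_triangle_ineq)
      also have "\<dots> = (1 - \<epsilon>) * norm y + \<epsilon> * s" using \<epsilon> s u by simp
      also have "\<dots> \<le> (1 - \<epsilon>) * s + \<epsilon> * s"
        using y \<epsilon> by (intro add_right_mono mult_left_mono) (auto simp: U_def)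
      finally show ?thesis by (simp add: algebra_simps)
    qed
    moreover have "\<epsilon> * s \<le> u \<bullet> x" using y \<epsilon> uu by (simp add: x_def U_def inner_add_right)
    ultimately have "x \<in> K" by (simp add: K_def)
    moreover have "y = \<phi> x" using \<epsilon> by (simp add: \<phi>_def x_def)
    ultimately show "y \<in> \<phi> ` K" by blast
  qed
  moreover have "(1 / (1 - \<epsilon>))-lipschitz_on K \<phi>"
  proof (rule lipschitz_onI)
    fix x y
    have "\<phi> x - \<phi> y = (1 / (1 - \<epsilon>)) *\<^sub>R (x - y)" by (simp add: \<phi>_def scaleR_diff_right)
    then show "dist (\<phi> x) (\<phi> y) \<le> 1 / (1 - \<epsilon>) * dist x y" using \<epsilon> by (simp add: dist_norm)
  qed (use \<epsilon> in simp)
  ultimately have UK: "?H U \<le> ennreal ((1 / (1 - \<epsilon>)) ^ d) * ?H K"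
    using \<epsilon> by (intro order_trans[OF hausdorff_measure_mono hausdorff_measure_lipschitz_image]) auto
  have "?H (V \<inter> cball 0 s) \<le> ennreal 2 * ?H U"
    using ball add_left_mono[OF LU, of "?H U"] two[of "?H U"] by simp
  then have "ennreal (1 / 2) * ?H (V \<inter> cball 0 s) \<le> ?H U" by (rule half)
  then have "ennreal (1 / 2) * ?H (V \<inter> cball 0 s) \<le> ennreal ((1 / (1 - \<epsilon>)) ^ d) * ?H K"
    using UK by (rule order_trans)
  then have "ennreal ((1 - \<epsilon>) ^ d) * (ennreal (1 / 2) * ?H (V \<inter> cball 0 s))
      \<le> ennreal ((1 - \<epsilon>) ^ d) * (ennreal ((1 / (1 - \<epsilon>)) ^ d) * ?H K)"
    by (rule mult_left_mono) simp
  also have "\<dots> = ?H K"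
    using \<epsilon> by (simp add: mult.assoc[symmetric] ennreal_mult'[symmetric] power_mult_distrib[symmetric])
  finally have K': "ennreal ((1 - \<epsilon>) ^ d) * (ennreal (1 / 2) * ?H (V \<inter> cball 0 s)) \<le> ?H K" .
  have K: "ennreal ((1 - \<epsilon>) ^ d / 2) * ?H (V \<inter> cball 0 s) \<le> ?H K"
  proof -
    have "ennreal ((1 - \<epsilon>) ^ d / 2) = ennreal ((1 - \<epsilon>) ^ d) * ennreal (1 / 2)"
      using \<epsilon> by (subst ennreal_mult'[symmetric]) auto
    then show ?thesis using K' by (simp only: mult.assoc)
  qed
  have "?H K + ?H L \<le> ?H (K \<union> L)"
  proof (rule hausdorff_measure_separated)
    show "0 < \<epsilon> * s" using \<epsilon> s by simp
    fix x y assume "x \<in> K" "y \<in> L"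
    then have "\<epsilon> * s \<le> u \<bullet> (x - y)" by (simp add: K_def L_def inner_diff_right)
    also have "\<dots> \<le> norm (x - y)" using norm_cauchy_schwarz[of u "x - y"] u by simp
    finally show "\<epsilon> * s \<le> dist x y" by (simp add: dist_norm)
  qed
  then have KKL: "?H K + (?H K + ?H L) \<le> ?H K + ?H (K \<union> L)" by (rule add_left_mono)
  have sum: "ennreal ((1 - \<epsilon>) ^ d / 2) * ?H (V \<inter> cball 0 s)
      + (ennreal ((1 - \<epsilon>) ^ d / 2) * ?H (V \<inter> cball 0 s) + ennreal (1 / 2) * ?H (V \<inter> cball 0 s))
      \<le> ?H K + (?H K + ?H L)"
    by (intro add_mono K L)
  have split: "ennreal (1 / 2 + (1 - \<epsilon>) ^ d)
      = ennreal ((1 - \<epsilon>) ^ d / 2) + (ennreal ((1 - \<epsilon>) ^ d / 2) + ennreal (1 / 2))"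
  proof -
    have "1 / 2 + (1 - \<epsilon>) ^ d = (1 - \<epsilon>) ^ d / 2 + ((1 - \<epsilon>) ^ d / 2 + 1 / 2)" by simp
    then show ?thesis using \<epsilon> by (simp only: ennreal_plus[symmetric] zero_le_power divide_nonneg_nonneg add_nonneg_nonneg)
  qed
  show ?thesis unfolding split distrib_right using sum KKL by (rule order_trans)
qed

section \<open>Density at a point where two sheets merge\<close>

context almost_horizontal_sheets
begin

text \<open>
\<open>y1\<close> is a point nearest to \<open>y0\<close> among those over which the sheets meet. It exists by continuity of
the heights, and it is closer to \<open>y0\<close> than the boundary of the disk is, because the origin competes.
\<close>
lemma touching_ball:
  assumes y0: "y0 \<in> disk (\<eta> / 4)" "upper y0 \<noteq> lower y0"
  obtains y1 where "y1 \<in> disk \<eta>" "upper y1 = lower y1" "y1 \<noteq> y0"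
    "\<And>y. e \<bullet> y = 0 \<Longrightarrow> dist y0 y < dist y0 y1 \<Longrightarrow> y \<in> disk \<eta> \<and> upper y \<noteq> lower y"
proof -
  define S where "S = {y. e \<bullet> y = 0} \<inter> cball 0 (\<eta> / 2)"
  define B where "B = {y \<in> S. upper y - lower y = 0}"
  have "S \<subseteq> disk \<eta>" using eta by (auto simp: S_def)
  then have "continuous_on S (\<lambda>y. upper y - lower y)"
    by (intro continuous_intros continuous_on_subset[OF continuous_on_upper]
        continuous_on_subset[OF continuous_on_lower])
  moreover have "closed S" unfolding S_def by (intro closed_Int closed_hyperplane closed_cball)
  ultimately have "closed B" unfolding B_def by (rule continuous_closed_preimage_constant)
  moreover have "0 \<in> B" using heights_center eta by (simp add: B_def S_def)
  ultimately obtain y1 where y1: "y1 \<in> B" "\<And>y. y \<in> B \<Longrightarrow> dist y0 y1 \<le> dist y0 y"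
    using distance_attains_inf[of B y0] by blast
  have "dist y0 y1 \<le> norm y0" using y1(2)[OF \<open>0 \<in> B\<close>] by simp
  show thesis
  proof
    show "y1 \<in> disk \<eta>" "upper y1 = lower y1" "y1 \<noteq> y0"
      using y1(1) y0 \<open>S \<subseteq> disk \<eta>\<close> by (auto simp: B_def)
    fix y assume y: "e \<bullet> y = 0" "dist y0 y < dist y0 y1"
    have "norm y \<le> norm y0 + dist y0 y" using norm_triangle_ineq4[of y0 "y0 - y"] by (simp add: dist_norm)
    then have "norm y \<le> \<eta> / 2" using y(2) \<open>dist y0 y1 \<le> norm y0\<close> y0(1) by auto
    then have "y \<in> S" using y(1) by (simp add: S_def)
    moreover have "y \<notin> B" using y1(2)[of y] y(2) by auto
    ultimately show "y \<in> disk \<eta> \<and> upper y \<noteq> lower y"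
      using \<open>S \<subseteq> disk \<eta>\<close> by (auto simp: B_def)
  qed
qed

text \<open>
At the point \<open>x\<close> over \<open>y1\<close>, the sheets over a cap of the touching ball are two disjoint compact sets.
Together with the bottom sheet over the opposite half-ball, they project onto twice the cap and
once the half-ball. The slope bound confines them to the ball of radius \<open>s / (1 - \<tau>)\<close>.
\<close>
lemma sheets_measure_lower_bound:
  assumes y0: "y0 \<in> disk (\<eta> / 4)" "upper y0 \<noteq> lower y0"
  obtains x b where "x \<in> X" "0 < b"
    "\<And>s. 0 < s \<Longrightarrow> s < b \<Longrightarrow> ennreal (1 / 2 + (1 - \<tau>) ^ d) * hausdorff_measure d ({y. e \<bullet> y = 0} \<inter> cball 0 s)
        \<le> hausdorff_measure d (X \<inter> cball x (s / (1 - \<tau>)))"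
proof -
  let ?H = "hausdorff_measure d"
  define V where "V = {y. e \<bullet> y = 0}"
  have V: "subspace V" unfolding V_def by (rule subspace_hyperplane)
  obtain y1 where y1: "y1 \<in> disk \<eta>" "upper y1 = lower y1" "y1 \<noteq> y0"
    and two: "\<And>y. e \<bullet> y = 0 \<Longrightarrow> dist y0 y < dist y0 y1 \<Longrightarrow> y \<in> disk \<eta> \<and> upper y \<noteq> lower y"
    using touching_ball[OF y0] by blast
  define up where "up y = p + y + upper y *\<^sub>R e" for y
  define lo where "lo y = p + y + lower y *\<^sub>R e" for y
  define x where "x = up y1"
  have upK: "up y \<in> X \<inter> cball p \<rho>" and loK: "lo y \<in> X \<inter> cball p \<rho>" if "y \<in> disk \<eta>" for y
    using sheet_points[OF that] by (auto simp: up_def lo_def)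
  have cup: "continuous_on (disk \<eta>) up" and clo: "continuous_on (disk \<eta>) lo"
    unfolding up_def lo_def by (intro continuous_intros continuous_on_upper continuous_on_lower)+
  have xK: "x \<in> X \<inter> cball p \<rho>" using upK[OF y1(1)] by (simp add: x_def)
  have xlo: "x = lo y1" using y1(2) by (simp add: x_def up_def lo_def)
  have shadow_up: "shadow e (up y - x) = y - y1" and shadow_lo: "shadow e (lo y - x) = y - y1"
    if "y \<in> disk \<eta>" for y
  proof -
    have "up y - x = (y - y1) + (upper y - upper y1) *\<^sub>R e" "lo y - x = (y - y1) + (lower y - upper y1) *\<^sub>R e"
      by (simp_all add: x_def up_def lo_def algebra_simps)
    moreover have "e \<bullet> (y - y1) = 0" using that y1(1) by (simp add: inner_diff_right)
    ultimately show "shadow e (up y - x) = y - y1" "shadow e (lo y - x) = y - y1"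
      by (simp_all only: shadow_orthogonal[OF e])
  qed
  obtain s0 where s0: "0 < s0" "\<And>z. z \<in> X \<Longrightarrow> norm (z - x) < s0 \<Longrightarrow> \<bar>e \<bullet> (z - x)\<bar> \<le> \<tau> * norm (z - x)"
    using slope[OF xK] by blast
  obtain b1 where b1: "0 < b1" "\<And>y. y \<in> disk \<eta> \<Longrightarrow> dist y y1 < b1 \<Longrightarrow> dist (up y) (up y1) < s0"
    using cup y1(1) s0(1) unfolding continuous_on_iff by meson
  obtain b2 where b2: "0 < b2" "\<And>y. y \<in> disk \<eta> \<Longrightarrow> dist y y1 < b2 \<Longrightarrow> dist (lo y) (lo y1) < s0"
    using clo y1(1) s0(1) unfolding continuous_on_iff by meson
  define \<delta> where "\<delta> = dist y0 y1"
  have \<delta>: "0 < \<delta>" using y1(3) by (simp add: \<delta>_def)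
  define u where "u = (y0 - y1) /\<^sub>R \<delta>"
  have u: "u \<in> V" "norm u = 1" "y0 - y1 = \<delta> *\<^sub>R u"
    using \<delta> y0(1) y1(1) by (auto simp: u_def V_def inner_diff_right) (simp add: \<delta>_def dist_norm)
  define b where "b = min (min b1 b2) (min (\<eta> - norm y1) (2 * \<delta> * \<tau>))"
  show thesis
  proof
    show "x \<in> X" using xK by blast
    show "0 < b" using b1 b2 y1(1) \<delta> tau by (simp add: b_def)
    fix s assume s: "0 < s" "s < b"
    define K where "K = {y \<in> V \<inter> cball 0 s. \<tau> * s \<le> u \<bullet> y}"
    define L where "L = {y \<in> V \<inter> cball 0 s. u \<bullet> y \<le> 0}"
    have KL: "y \<in> V" "norm y \<le> s" if "y \<in> K \<union> L" for y using that by (auto simp: K_def L_def)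
    have disk: "y1 + y \<in> disk \<eta>" if "y \<in> K \<union> L" for y
    proof -
      have "norm (y1 + y) \<le> norm y1 + s" using norm_triangle_ineq[of y1 y] KL(2)[OF that] by simp
      then show ?thesis using KL(1)[OF that] y1(1) s by (simp add: V_def b_def inner_add_right)
    qed
    \<comment> \<open>the cap, moved to \<open>y1\<close>, lies in the open ball around \<open>y0\<close> that touches \<open>y1\<close>\<close>
    have two_K: "upper (y1 + y) \<noteq> lower (y1 + y)" if y: "y \<in> K" for y
    proof -
      have yV: "y \<in> V" "norm y \<le> s" "\<tau> * s \<le> u \<bullet> y" using y by (auto simp: K_def)
      have "(norm (y - \<delta> *\<^sub>R u))\<^sup>2 = (norm y)\<^sup>2 - 2 * \<delta> * (u \<bullet> y) + \<delta>\<^sup>2"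
      proof -
        have "u \<bullet> u = 1" using u(2) by (simp add: norm_eq_1)
        then show ?thesis unfolding power2_norm_eq_inner
          by (simp add: inner_diff_left inner_diff_right inner_commute[of y u] power2_eq_square algebra_simps)
      qed
      also have "\<dots> \<le> s\<^sup>2 - 2 * \<delta> * (\<tau> * s) + \<delta>\<^sup>2"
      proof -
        have "(norm y)\<^sup>2 \<le> s\<^sup>2" using yV by (intro power_mono) auto
        moreover have "2 * \<delta> * (\<tau> * s) \<le> 2 * \<delta> * (u \<bullet> y)"
          using yV(3) \<delta> by (intro mult_left_mono) auto
        ultimately show ?thesis by linarith
      qed
      also have "\<dots> < \<delta>\<^sup>2"
      proof -
        have "s * s < (2 * \<delta> * \<tau>) * s" using s by (intro mult_strict_right_mono) (auto simp: b_def)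
        then show ?thesis by (simp add: power2_eq_square algebra_simps)
      qed
      finally have "norm (y - \<delta> *\<^sub>R u) < \<delta>" by (rule power2_less_imp_less) (use \<delta> in simp)
      moreover have "y0 - (y1 + y) = - (y - \<delta> *\<^sub>R u)" using u(3) by (simp add: algebra_simps)
      ultimately have "dist y0 (y1 + y) < \<delta>" by (simp only: dist_norm norm_minus_cancel)
      then have "dist y0 (y1 + y) < dist y0 y1" by (simp only: \<delta>_def)
      moreover have "e \<bullet> (y1 + y) = 0" using yV(1) y1(1) by (simp add: V_def inner_add_right)
      ultimately show ?thesis using two by blast
    qed
    define S1 where "S1 = (\<lambda>y. up (y1 + y)) ` K"
    define S2 where "S2 = (\<lambda>y. lo (y1 + y)) ` (K \<union> L)"
    have comp: "compact K" "compact (K \<union> L)"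
    proof -
      have "K = (V \<inter> {y. \<tau> * s \<le> u \<bullet> y}) \<inter> cball 0 s" "L = (V \<inter> {y. u \<bullet> y \<le> 0}) \<inter> cball 0 s"
        by (auto simp: K_def L_def)
      then show "compact K" "compact (K \<union> L)" unfolding V_def
        by (auto intro!: closed_Int_compact closed_Int closed_hyperplane closed_Collect_le continuous_intros)
    qed
    have "compact S1" unfolding S1_def using disk
      by (intro compact_continuous_image comp continuous_on_compose2[OF cup] continuous_intros) auto
    moreover have "compact S2" unfolding S2_def using disk
      by (intro compact_continuous_image comp continuous_on_compose2[OF clo] continuous_intros) auto
    moreover have "S1 \<inter> S2 = {}"
    proof (rule ccontr)
      assume "S1 \<inter> S2 \<noteq> {}"
      then obtain y y' where y: "y \<in> K" "y' \<in> K \<union> L" "up (y1 + y) = lo (y1 + y')"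
        by (auto simp: S1_def S2_def)
      have "shadow e (up (y1 + y) - x) = shadow e (lo (y1 + y') - x)" using y(3) by simp
      then have "y = y'" using shadow_up[OF disk, of y] shadow_lo[OF disk, of y'] y by simp
      then have "upper (y1 + y) *\<^sub>R e = lower (y1 + y) *\<^sub>R e" using y(3) by (simp add: up_def lo_def)
      then show False using two_K[OF y(1)] e by auto
    qed
    ultimately obtain g where g: "0 < g" "\<And>a b. a \<in> S1 \<Longrightarrow> b \<in> S2 \<Longrightarrow> g \<le> dist a b"
      using separate_compact_closed[of S1 S2] compact_imp_closed by blast
    have proj: "dist (shadow e (a - x)) (shadow e (b - x)) \<le> dist a b" for a b
      using norm_shadow_le[OF e, of "a - b"] by (simp add: dist_norm shadow_diff)
    have "?H K \<le> ?H S1"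
    proof (rule hausdorff_measure_isometric_le[where f = "\<lambda>z. shadow e (z - x)"])
      show "K \<subseteq> (\<lambda>z. shadow e (z - x)) ` S1"
        unfolding S1_def image_image using shadow_up[OF disk] by force
    qed (rule proj)
    moreover have "?H (K \<union> L) \<le> ?H S2"
    proof (rule hausdorff_measure_isometric_le[where f = "\<lambda>z. shadow e (z - x)"])
      show "K \<union> L \<subseteq> (\<lambda>z. shadow e (z - x)) ` S2"
        unfolding S2_def image_image using shadow_lo[OF disk] by force
    qed (rule proj)
    ultimately have "?H K + ?H (K \<union> L) \<le> ?H S1 + ?H S2" by (rule add_mono)
    also have "\<dots> \<le> ?H (S1 \<union> S2)" using g by (rule hausdorff_measure_separated)
    also have "\<dots> \<le> ?H (X \<inter> cball x (s / (1 - \<tau>)))"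
    proof (rule hausdorff_measure_mono)
      have in_ball: "z \<in> cball x (s / (1 - \<tau>))"
        if z: "z \<in> X" "norm (z - x) < s0" and sh: "norm (shadow e (z - x)) \<le> s" for z
      proof -
        have "(1 - \<tau>) * norm (z - x) \<le> norm (shadow e (z - x))"
          using s0(2)[OF z] tau by (intro norm_le_shadow[OF e]) auto
        then have "(1 - \<tau>) * norm (z - x) \<le> s" using sh by linarith
        then have "norm (z - x) \<le> s / (1 - \<tau>)" using tau by (simp add: field_simps)
        then show ?thesis by (simp only: mem_cball_iff_norm)
      qed
      show "S1 \<union> S2 \<subseteq> X \<inter> cball x (s / (1 - \<tau>))"
      proof
        fix z assume "z \<in> S1 \<union> S2"
        then obtain y where y: "y \<in> K \<union> L" "z = up (y1 + y) \<or> z = lo (y1 + y)"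
          by (auto simp: S1_def S2_def)
        have "dist (y1 + y) y1 \<le> s" using KL(2)[OF y(1)] by (simp add: dist_norm)
        then have "dist (up (y1 + y)) x < s0" "dist (lo (y1 + y)) x < s0"
          using b1(2)[OF disk[OF y(1)]] b2(2)[OF disk[OF y(1)]] s by (auto simp: b_def x_def[symmetric] xlo[symmetric])
        then have "norm (z - x) < s0" using y(2) by (auto simp: dist_norm)
        moreover have "shadow e (z - x) = y"
          using y(2) shadow_up[OF disk[OF y(1)]] shadow_lo[OF disk[OF y(1)]] by auto
        moreover have "z \<in> X" using y(2) upK[OF disk[OF y(1)]] loK[OF disk[OF y(1)]] by auto
        ultimately show "z \<in> X \<inter> cball x (s / (1 - \<tau>))" using in_ball KL(2)[OF y(1)] by auto
      qed
    qed
    finally have "?H K + ?H (K \<union> L) \<le> ?H (X \<inter> cball x (s / (1 - \<tau>)))" .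
    moreover have "ennreal (1 / 2 + (1 - \<tau>) ^ d) * ?H (V \<inter> cball 0 s) \<le> ?H K + ?H (K \<union> L)"
      unfolding K_def L_def using tau s(1) by (intro hausdorff_three_halves_ball V u) auto
    ultimately show "ennreal (1 / 2 + (1 - \<tau>) ^ d) * ?H ({y. e \<bullet> y = 0} \<inter> cball 0 s)
        \<le> ?H (X \<inter> cball x (s / (1 - \<tau>)))"
      unfolding V_def by (rule order_trans[rotated])
  qed
qed

end

lemma multiplicity_at_ge:
  fixes X :: "(real ^ 'n::finite) set" and e x :: "real ^ 'n"
  defines "d \<equiv> CARD('n) - 1"
  assumes e: "norm e = 1" and \<tau>: "0 < \<tau>" "\<tau> < 1" and b: "0 < b" and c: "0 \<le> c"
    and bound: "\<And>s. 0 < s \<Longrightarrow> s < b \<Longrightarrow> ennreal c * hausdorff_measure d ({y. e \<bullet> y = 0} \<inter> cball 0 s)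
        \<le> hausdorff_measure d (X \<inter> cball x (s / (1 - \<tau>)))"
  shows "ennreal (c * (1 - \<tau>) ^ d) \<le> multiplicity_at X x"
  unfolding multiplicity_at_def d_def[symmetric]
proof (rule Liminf_bounded)
  let ?H = "hausdorff_measure d"
  have "ennreal (c * (1 - \<tau>) ^ d) \<le> ?H (X \<inter> cball x R) / ?H ((horizontal :: (real ^ 'n) set) \<inter> cball 0 R)"
    if R: "0 < R" "R < b" for R
  proof -
    \<comment> \<open>radius in the hyperplane that corresponds to the radius \<open>R\<close> around \<open>x\<close> in \<open>X\<close>\<close>
    define s where "s = (1 - \<tau>) * R"
    have "s < 1 * R" unfolding s_def using \<tau> R by (intro mult_strict_right_mono) auto
    then have "s < b" using R(2) by linarith
    moreover have "0 < s" "R = s / (1 - \<tau>)" using R \<tau> by (simp_all add: s_def)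
    ultimately have s: "0 < s" "s < b" "R = s / (1 - \<tau>)" by blast+
    let ?B = "?H ((horizontal :: (real ^ 'n) set) \<inter> cball 0 R)"
    have B: "?B \<noteq> 0" "?B \<noteq> \<infinity>" using hausdorff_horizontal_ball[OF R(1), where 'n='n] by (simp_all add: d_def)
    have ax: "norm (axis last_coord 1 :: real ^ 'n) = 1" by simp
    have "?B \<le> ennreal ((1 / (1 - \<tau>)) ^ d) * ?H ({y. e \<bullet> y = 0} \<inter> cball 0 s)"
      using hausdorff_hyperplane_ball_scale[OF e ax, of "1 / (1 - \<tau>)" d s] \<tau> s(3)
      by (simp add: horizontal_eq_orthogonal)
    then have "ennreal ((1 - \<tau>) ^ d) * ?B
        \<le> ennreal ((1 - \<tau>) ^ d) * (ennreal ((1 / (1 - \<tau>)) ^ d) * ?H ({y. e \<bullet> y = 0} \<inter> cball 0 s))"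
      by (rule mult_left_mono) simp
    also have "\<dots> = ?H ({y. e \<bullet> y = 0} \<inter> cball 0 s)"
      using \<tau> by (simp add: mult.assoc[symmetric] ennreal_mult'[symmetric] power_mult_distrib[symmetric])
    finally have "ennreal c * (ennreal ((1 - \<tau>) ^ d) * ?B) \<le> ennreal c * ?H ({y. e \<bullet> y = 0} \<inter> cball 0 s)"
      by (rule mult_left_mono) simp
    also have "\<dots> \<le> ?H (X \<inter> cball x R)" using bound[OF s(1,2)] s(3) by simp
    finally have "ennreal (c * (1 - \<tau>) ^ d) * ?B \<le> ?H (X \<inter> cball x R)"
      using c \<tau> by (simp add: ennreal_mult mult.assoc)
    then have "ennreal (c * (1 - \<tau>) ^ d) * ?B / ?B \<le> ?H (X \<inter> cball x R) / ?B"
      by (rule divide_right_mono_ennreal)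
    then show ?thesis using B by (simp add: ennreal_mult_divide_eq)
  qed
  then show "\<forall>\<^sub>F R in at_right 0. ennreal (c * (1 - \<tau>) ^ d)
      \<le> ?H (X \<inter> cball x R) / ?H ((horizontal :: (real ^ 'n) set) \<inter> cball 0 R)"
    unfolding eventually_at_right_field using b by blast
qed

text \<open>
The hypothesis relating \<open>m\<close> and \<open>\<tau>\<close> bounds the density produced by \<open>sheets_measure_lower_bound\<close>.
One factor \<open>(1 - \<tau>) ^ d\<close> is the loss from the cap, the other the loss from the slope of the sheets.
\<close>
lemma single_sheet_of_multiplicity:
  fixes X :: "(real ^ 'n::finite) set"
  assumes "almost_horizontal_sheets X e p \<rho> \<tau> \<eta>"
    and m: "\<And>x. x \<in> X \<Longrightarrow> multiplicity_at X x \<le> ennreal m"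
    and \<tau>: "m < (1 / 2 + (1 - \<tau>) ^ (CARD('n) - 1)) * (1 - \<tau>) ^ (CARD('n) - 1)"
    and y: "e \<bullet> y = 0" "norm y < \<eta> / 4"
  shows "upper_height X e p \<rho> y = lower_height X e p \<rho> y"
proof (rule ccontr)
  interpret almost_horizontal_sheets X e p \<rho> \<tau> \<eta> by fact
  let ?d = "CARD('n) - 1"
  assume "upper y \<noteq> lower y"
  then obtain x b where x: "x \<in> X" "0 < b"
    "\<And>s. 0 < s \<Longrightarrow> s < b \<Longrightarrow> ennreal (1 / 2 + (1 - \<tau>) ^ ?d) * hausdorff_measure ?d ({y. e \<bullet> y = 0} \<inter> cball 0 s)
        \<le> hausdorff_measure ?d (X \<inter> cball x (s / (1 - \<tau>)))"
    using sheets_measure_lower_bound[of y ?d] y by auto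
  have "ennreal ((1 / 2 + (1 - \<tau>) ^ ?d) * (1 - \<tau>) ^ ?d) \<le> multiplicity_at X x"
    using tau by (intro multiplicity_at_ge[OF e _ _ x(2) _ x(3)]) (auto intro: add_nonneg_nonneg)
  also have "\<dots> \<le> ennreal m" by (rule m[OF x(1)])
  also have "\<dots> < ennreal ((1 / 2 + (1 - \<tau>) ^ ?d) * (1 - \<tau>) ^ ?d)"
    using tau \<tau> by (intro ennreal_lessI mult_pos_pos add_pos_pos zero_less_power) auto
  finally show False by simp
qed

section \<open>Regularity of a single sheet\<close>

text \<open>
The gradients at \<open>y1\<close> and \<open>y2\<close> are compared by evaluating \<open>f\<close> at a third point \<open>z\<close>, which lies at distance
\<open>d = norm (y1 - y2)\<close> from \<open>y2\<close> in the direction of \<open>g y1 - g y2\<close>: three applications of the quadratic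
bound give \<open>d * norm (g y1 - g y2) \<le> M * (d\<^sup>2 + 4 * d\<^sup>2 + d\<^sup>2)\<close>. The radius is divided by three
to keep \<open>z\<close> in the disk.
\<close>
lemma lipschitz_of_quadratic_approximation:
  fixes f :: "'a::real_inner \<Rightarrow> real"
  assumes M: "0 \<le> M" and g: "\<And>y. y \<in> V \<Longrightarrow> norm y < \<eta> \<Longrightarrow> g y \<in> V" and V: "subspace V"
    and quad: "\<And>y z. y \<in> V \<Longrightarrow> norm y < \<eta> \<Longrightarrow> z \<in> V \<Longrightarrow> norm z < \<eta> \<Longrightarrow>
        \<bar>f z - f y - g y \<bullet> (z - y)\<bar> \<le> M * (norm (z - y))\<^sup>2"
  shows "(6 * M)-lipschitz_on {y\<in>V. norm y < \<eta> / 3} g"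
proof (rule lipschitz_onI)
  fix y1 y2 assume "y1 \<in> {y\<in>V. norm y < \<eta> / 3}" "y2 \<in> {y\<in>V. norm y < \<eta> / 3}"
  then have y: "y1 \<in> V" "norm y1 < \<eta> / 3" "y2 \<in> V" "norm y2 < \<eta> / 3" by auto
  then have y': "norm y1 < \<eta>" "norm y2 < \<eta>" using norm_ge_zero[of y1] norm_ge_zero[of y2] by linarith+
  define d where "d = norm (y1 - y2)"
  define w where "w = g y1 - g y2"
  show "dist (g y1) (g y2) \<le> 6 * M * dist y1 y2"
  proof (cases "w = 0 \<or> y1 = y2")
    case True
    then show ?thesis using M by (auto simp: w_def)
  next
    case False
    then have d: "0 < d" and w: "0 < norm w" by (auto simp: d_def)
    define z where "z = y2 + (d / norm w) *\<^sub>R w"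
    have zy: "norm (z - y2) = d" using d w by (simp add: z_def)
    have "w \<in> V" unfolding w_def using g y y' V by (intro subspace_diff) auto
    then have zV: "z \<in> V" using V y by (simp add: z_def subspace_add subspace_scale)
    have "d < 2 * \<eta> / 3" using norm_triangle_ineq4[of y1 y2] y by (simp add: d_def)
    then have z\<eta>: "norm z < \<eta>" using norm_triangle_ineq[of "z - y2" y2] zy y by simp
    have zy1: "norm (z - y1) \<le> 2 * d"
      using norm_triangle_ineq[of "z - y2" "y2 - y1"] zy by (simp add: d_def norm_minus_commute)
    have "d * norm w = w \<bullet> (z - y2)"
      using w by (simp add: z_def dot_square_norm power2_eq_square)
    also have "\<dots> = (f z - f y2 - g y2 \<bullet> (z - y2)) - (f z - f y1 - g y1 \<bullet> (z - y1))
        + (f y2 - f y1 - g y1 \<bullet> (y2 - y1))"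
      by (simp add: w_def inner_diff_left inner_diff_right)
    also have "\<dots> \<le> M * d\<^sup>2 + M * (2 * d)\<^sup>2 + M * d\<^sup>2"
    proof -
      have "\<bar>f z - f y2 - g y2 \<bullet> (z - y2)\<bar> \<le> M * d\<^sup>2"
        using quad[OF y(3) y'(2) zV z\<eta>] zy by simp
      moreover have "\<bar>f y2 - f y1 - g y1 \<bullet> (y2 - y1)\<bar> \<le> M * d\<^sup>2"
        using quad[OF y(1) y'(1) y(3) y'(2)] by (simp add: d_def norm_minus_commute)
      moreover have "M * (norm (z - y1))\<^sup>2 \<le> M * (2 * d)\<^sup>2"
        using zy1 M by (intro mult_left_mono power_mono) auto
      then have "\<bar>f z - f y1 - g y1 \<bullet> (z - y1)\<bar> \<le> M * (2 * d)\<^sup>2"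
        using quad[OF y(1) y'(1) zV z\<eta>] by linarith
      ultimately show ?thesis by linarith
    qed
    also have "\<dots> = d * (6 * M * d)" by (simp add: power2_eq_square)
    finally have "norm w \<le> 6 * M * d" using d by simp
    then show ?thesis by (simp add: w_def d_def dist_norm)
  qed
qed (use M in simp)

context flat_supported
begin

text \<open>
Let \<open>n y\<close> be the normal at the point \<open>pt y\<close>, with its sign chosen near \<open>e\<close>. The identity \<open>key\<close>
in the proof says that \<open>n y \<bullet> (pt z - pt y)\<close> is the error of the linear approximation of \<open>f\<close> with
gradient \<open>- shadow e (n y) / (n y \<bullet> e)\<close>, up to the factor \<open>n y \<bullet> e\<close>, which lies between \<open>3 / 4\<close> and
\<open>1\<close>. Flatness of the tangent cones makes this error of smaller order, and supporting balls on
both sides make it quadratic.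
\<close>
lemma C1_graph:
  fixes e p :: 'a and \<eta> :: real and f :: "'a \<Rightarrow> real"
  defines "D \<equiv> {y. e \<bullet> y = 0 \<and> norm y < \<eta>}" and "pt \<equiv> (\<lambda>y. p + y + f y *\<^sub>R e)"
  assumes e: "norm e = 1" and X: "\<And>y. y \<in> D \<Longrightarrow> pt y \<in> X" and f: "continuous_on D f"
    and normals: "\<And>y v. y \<in> D \<Longrightarrow> supporting_normal X r (pt y) v \<Longrightarrow>
        norm (v - e) < 1 / 4 \<or> norm (v + e) < 1 / 4"
  obtains g where "\<And>y. y \<in> D \<Longrightarrow> e \<bullet> g y = 0"
    "\<And>y. y \<in> D \<Longrightarrow> (f has_derivative (\<lambda>h. g y \<bullet> h)) (at y within {y. e \<bullet> y = 0})"
    "continuous_on D g"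
    "\<And>y z. y \<in> D \<Longrightarrow> z \<in> D \<Longrightarrow> (\<And>x. x \<in> X \<Longrightarrow> \<exists>u. supporting_normal X r x u \<and> supporting_normal X r x (- u))
       \<Longrightarrow> norm (pt z - pt y) \<le> r / 2 \<Longrightarrow> \<bar>f z - f y - g y \<bullet> (z - y)\<bar> \<le> 3 / r * (norm (z - y))\<^sup>2"
proof -
  have ee: "e \<bullet> e = 1" using e by (simp add: norm_eq_1)
  have "\<exists>n. norm n = 1 \<and> norm (n - e) < 1 / 4 \<and>
      (supporting_normal X r (pt y) n \<or> supporting_normal X r (pt y) (- n))" if y: "y \<in> D" for y
  proof -
    obtain v where v: "supporting_normal X r (pt y) v" using supported[OF X[OF y]] by blast
    then have v1: "norm v = 1" by (simp add: supporting_normal_def)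
    have "- v - e = - (v + e)" by simp
    then have "norm (- v - e) = norm (v + e)" by (simp only: norm_minus_cancel)
    then show ?thesis using normals[OF y v] v v1
      by (cases "norm (v - e) < 1 / 4") (auto intro: exI[of _ v] exI[of _ "- v"])
  qed
  then obtain n where n: "\<And>y. y \<in> D \<Longrightarrow> norm (n y) = 1" "\<And>y. y \<in> D \<Longrightarrow> norm (n y - e) < 1 / 4"
      "\<And>y. y \<in> D \<Longrightarrow> supporting_normal X r (pt y) (n y) \<or> supporting_normal X r (pt y) (- n y)"
    by metis
  have ne: "3 / 4 \<le> n y \<bullet> e" if "y \<in> D" for y
    using Cauchy_Schwarz_ineq2[of "n y - e" e] n(2)[OF that] e ee unfolding inner_diff_left by simp
  define g where "g y = - (1 / (n y \<bullet> e)) *\<^sub>R shadow e (n y)" for y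
  have g: "e \<bullet> g y = 0" for y by (simp add: g_def inner_shadow[OF e])
  have key: "n y \<bullet> (pt z - pt y) = (n y \<bullet> e) * (f z - f y - g y \<bullet> (z - y))" if "y \<in> D" "z \<in> D" for y z
  proof -
    have "e \<bullet> (z - y) = 0" using that by (simp add: D_def inner_diff_right)
    then have "shadow e (n y) \<bullet> (z - y) = n y \<bullet> (z - y)"
      by (simp add: shadow_def inner_diff_left)
    then have "(n y \<bullet> e) * (g y \<bullet> (z - y)) = - (n y \<bullet> (z - y))"
      using ne[OF that(1)] by (simp add: g_def)
    moreover have "pt z - pt y = (z - y) + (f z - f y) *\<^sub>R e" by (simp add: pt_def algebra_simps)
    then have "n y \<bullet> (pt z - pt y) = n y \<bullet> (z - y) + (f z - f y) * (n y \<bullet> e)"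
      by (simp only: inner_add_right inner_scaleR_right)
    ultimately show ?thesis by (simp add: algebra_simps)
  qed
  have steep: "norm (pt z - pt y) \<le> 2 * norm (z - y)"
    if yz: "y \<in> D" "z \<in> D" and le: "\<bar>n y \<bullet> (pt z - pt y)\<bar> \<le> 1 / 4 * norm (pt z - pt y)" for y z
  proof -
    have "\<bar>(n y - e) \<bullet> (pt z - pt y)\<bar> \<le> norm (n y - e) * norm (pt z - pt y)"
      by (rule Cauchy_Schwarz_ineq2)
    moreover have "norm (n y - e) * norm (pt z - pt y) \<le> 1 / 4 * norm (pt z - pt y)"
      using n(2)[OF yz(1)] by (intro mult_right_mono) auto
    ultimately have "\<bar>e \<bullet> (pt z - pt y)\<bar> \<le> 1 / 2 * norm (pt z - pt y)"
      using le unfolding inner_diff_left by linarith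
    from norm_le_shadow[OF e this] have "norm (pt z - pt y) \<le> 2 * norm (shadow e (pt z - pt y))" by simp
    moreover have "e \<bullet> (z - y) = 0" using yz by (simp add: D_def inner_diff_right)
    then have "shadow e ((z - y) + (f z - f y) *\<^sub>R e) = z - y" by (rule shadow_orthogonal[OF e])
    moreover have "pt z - pt y = (z - y) + (f z - f y) *\<^sub>R e" by (simp add: pt_def algebra_simps)
    ultimately show ?thesis by simp
  qed
  have cpt: "continuous_on D pt" unfolding pt_def by (intro continuous_intros f)
  have approach: "\<exists>\<delta>>0. \<forall>z\<in>X. norm (z - pt y) < \<delta> \<longrightarrow> \<bar>n y \<bullet> (z - pt y)\<bar> \<le> \<epsilon> * norm (z - pt y)"
    if "y \<in> D" "0 < \<epsilon>" for y \<epsilon>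
    using n(3)[OF that(1)] flat_approach[OF X[OF that(1)] _ that(2), of "n y"]
      flat_approach[OF X[OF that(1)] _ that(2), of "- n y"] by auto
  show thesis
  proof
    fix y assume y: "y \<in> D"
    show "e \<bullet> g y = 0" by (rule g)
    show "(f has_derivative (\<lambda>h. g y \<bullet> h)) (at y within {y. e \<bullet> y = 0})"
      unfolding has_derivative_within_alt
    proof (intro conjI allI impI bounded_linear_inner_right)
      fix \<epsilon> :: real assume \<epsilon>: "0 < \<epsilon>"
      obtain \<delta> where \<delta>: "0 < \<delta>" "\<And>z. z \<in> X \<Longrightarrow> norm (z - pt y) < \<delta> \<Longrightarrow>
          \<bar>n y \<bullet> (z - pt y)\<bar> \<le> min (1 / 4) (\<epsilon> / 4) * norm (z - pt y)"
        using approach[OF y, of "min (1 / 4) (\<epsilon> / 4)"] \<epsilon> by auto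
      obtain d where d: "0 < d" "\<And>z. z \<in> D \<Longrightarrow> dist z y < d \<Longrightarrow> dist (pt z) (pt y) < \<delta>"
        using cpt y \<delta>(1) unfolding continuous_on_iff by meson
      show "\<exists>d>0. \<forall>z\<in>{y. e \<bullet> y = 0}. norm (z - y) < d \<longrightarrow>
              norm (f z - f y - g y \<bullet> (z - y)) \<le> \<epsilon> * norm (z - y)"
      proof (intro exI[of _ "min d (\<eta> - norm y)"] conjI ballI impI)
        show "0 < min d (\<eta> - norm y)" using d y by (simp add: D_def)
        fix z assume "z \<in> {y. e \<bullet> y = 0}" and zy: "norm (z - y) < min d (\<eta> - norm y)"
        moreover have "norm z \<le> norm (z - y) + norm y" using norm_triangle_ineq[of "z - y" y] by simp
        ultimately have z: "z \<in> D" by (simp add: D_def)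
        have le: "\<bar>n y \<bullet> (pt z - pt y)\<bar> \<le> min (1 / 4) (\<epsilon> / 4) * norm (pt z - pt y)"
          using \<delta>(2)[OF X[OF z]] d(2)[OF z] zy by (simp add: dist_norm)
        have "min (1 / 4) (\<epsilon> / 4) * norm (pt z - pt y) \<le> 1 / 4 * norm (pt z - pt y)"
          by (intro mult_right_mono) auto
        then have st: "norm (pt z - pt y) \<le> 2 * norm (z - y)" using le by (intro steep y z) linarith
        have "min (1 / 4) (\<epsilon> / 4) * norm (pt z - pt y) \<le> \<epsilon> / 4 * (2 * norm (z - y))"
          using \<epsilon> st by (intro mult_mono) auto
        then have "\<bar>n y \<bullet> e\<bar> * \<bar>f z - f y - g y \<bullet> (z - y)\<bar> \<le> 1 / 2 * (\<epsilon> * norm (z - y))"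
          using le unfolding key[OF y z] abs_mult by simp
        moreover have "3 / 4 * \<bar>f z - f y - g y \<bullet> (z - y)\<bar> \<le> \<bar>n y \<bullet> e\<bar> * \<bar>f z - f y - g y \<bullet> (z - y)\<bar>"
          using ne[OF y] by (intro mult_right_mono) auto
        moreover have "0 \<le> \<epsilon> * norm (z - y)" using \<epsilon> by simp
        moreover have "a \<le> c" if "b \<le> 1 / 2 * c" "3 / 4 * a \<le> b" "0 \<le> c" for a b c :: real
          using that by linarith
        ultimately show "norm (f z - f y - g y \<bullet> (z - y)) \<le> \<epsilon> * norm (z - y)"
          unfolding real_norm_def by blast
      qed
    qed
  next
    have "continuous_on D n"
      unfolding continuous_on_iff
    proof (intro ballI allI impI)
      fix y :: 'a and \<epsilon> :: real assume y: "y \<in> D" and \<epsilon>: "0 < \<epsilon>"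
      obtain u where u: "supporting_normal X r (pt y) u" "u = n y \<or> u = - n y" using n(3)[OF y] by blast
      obtain \<delta> where \<delta>: "0 < \<delta>" "\<And>x v. x \<in> X \<Longrightarrow> norm (x - pt y) < \<delta> \<Longrightarrow> supporting_normal X r x v \<Longrightarrow>
           norm (v - u) < min \<epsilon> 1 \<or> norm (v + u) < min \<epsilon> 1"
        using normals_continuous[OF X[OF y] u(1), of "min \<epsilon> 1"] \<epsilon> by auto
      obtain d where d: "0 < d" "\<And>z. z \<in> D \<Longrightarrow> dist z y < d \<Longrightarrow> dist (pt z) (pt y) < \<delta>"
        using cpt y \<delta>(1) unfolding continuous_on_iff by meson
      have "dist (n z) (n y) < \<epsilon>" if z: "z \<in> D" and zy: "dist z y < d" for z
      proof -
        obtain v where v: "supporting_normal X r (pt z) v" "v = n z \<or> v = - n z" using n(3)[OF z] by blast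
        have "norm (v - u) < min \<epsilon> 1 \<or> norm (v + u) < min \<epsilon> 1"
          using \<delta>(2)[OF X[OF z] _ v(1)] d(2)[OF z zy] by (simp add: dist_norm)
        moreover have "norm (- n z - n y) = norm (n z + n y)" "norm (- n z + n y) = norm (n z - n y)"
          using norm_minus_cancel[of "n z + n y"] norm_minus_cancel[of "n z - n y"] by (simp_all add: norm_minus_commute)
        ultimately have "norm (n z - n y) < min \<epsilon> 1 \<or> norm (n z + n y) < min \<epsilon> 1"
          using u(2) v(2) by auto
        moreover have "\<not> norm (n z + n y) < 1"
        proof
          assume "norm (n z + n y) < 1"
          have "2 *\<^sub>R e = (n z + n y) - (n z - e) - (n y - e)" by (simp add: scaleR_2)
          then have "norm (2 *\<^sub>R e) \<le> norm (n z + n y) + norm (n z - e) + norm (n y - e)"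
            by (metis (no_types, opaque_lifting) add_mono_thms_linordered_semiring(3) norm_triangle_ineq4 order_trans)
          then show False using \<open>norm (n z + n y) < 1\<close> n(2)[OF y] n(2)[OF z] e by simp
        qed
        ultimately show ?thesis by (auto simp: dist_norm)
      qed
      then show "\<exists>d>0. \<forall>z\<in>D. dist z y < d \<longrightarrow> dist (n z) (n y) < \<epsilon>" using d(1) by blast
    qed
    then show "continuous_on D g"
      unfolding g_def using ne by (intro continuous_intros) force+
  next
    fix y z assume y: "y \<in> D" and z: "z \<in> D" and near: "norm (pt z - pt y) \<le> r / 2"
      and two: "\<And>x. x \<in> X \<Longrightarrow> \<exists>u. supporting_normal X r x u \<and> supporting_normal X r x (- u)"
    obtain u where u: "supporting_normal X r (pt y) u" "supporting_normal X r (pt y) (- u)"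
      using two[OF X[OF y]] by blast
    have "n y = u \<or> n y = - u"
      using n(3)[OF y] supporting_normal_unique[OF X[OF y] u(1)] by fastforce
    then have "supporting_normal X r (pt y) (n y)" "supporting_normal X r (pt y) (- n y)"
      using u by auto
    then have "2 * r * (n y \<bullet> (pt z - pt y)) \<le> (norm (pt z - pt y))\<^sup>2"
      "2 * r * (- n y \<bullet> (pt z - pt y)) \<le> (norm (pt z - pt y))\<^sup>2"
      using X[OF z] unfolding supporting_normal_def by blast+
    then have "\<bar>2 * r * (n y \<bullet> (pt z - pt y))\<bar> \<le> (norm (pt z - pt y))\<^sup>2" by (simp add: abs_le_iff)
    then have sq: "2 * r * \<bar>n y \<bullet> (pt z - pt y)\<bar> \<le> (norm (pt z - pt y))\<^sup>2"
      using r_pos by (simp add: abs_mult)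
    have "(norm (pt z - pt y))\<^sup>2 \<le> r / 2 * norm (pt z - pt y)"
      unfolding power2_eq_square by (intro mult_right_mono near) simp
    then have "r * (2 * \<bar>n y \<bullet> (pt z - pt y)\<bar>) \<le> r * (1 / 2 * norm (pt z - pt y))"
      using sq by simp
    then have "\<bar>n y \<bullet> (pt z - pt y)\<bar> \<le> 1 / 4 * norm (pt z - pt y)" using r_pos by simp
    then have "norm (pt z - pt y) \<le> 2 * norm (z - y)" by (rule steep[OF y z])
    then have "(norm (pt z - pt y))\<^sup>2 \<le> (2 * norm (z - y))\<^sup>2" by (intro power_mono) auto
    then have "2 * r * (\<bar>n y \<bullet> e\<bar> * \<bar>f z - f y - g y \<bullet> (z - y)\<bar>) \<le> 4 * (norm (z - y))\<^sup>2"
      using sq unfolding key[OF y z] abs_mult by (simp add: power_mult_distrib)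
    moreover have "3 / 4 * \<bar>f z - f y - g y \<bullet> (z - y)\<bar> \<le> \<bar>n y \<bullet> e\<bar> * \<bar>f z - f y - g y \<bullet> (z - y)\<bar>"
      using ne[OF y] by (intro mult_right_mono) auto
    then have "2 * r * (3 / 4 * \<bar>f z - f y - g y \<bullet> (z - y)\<bar>)
        \<le> 2 * r * (\<bar>n y \<bullet> e\<bar> * \<bar>f z - f y - g y \<bullet> (z - y)\<bar>)"
      using r_pos by (intro mult_left_mono) auto
    ultimately have "r * \<bar>f z - f y - g y \<bullet> (z - y)\<bar> \<le> 8 / 3 * (norm (z - y))\<^sup>2" by linarith
    also have "\<dots> \<le> 3 * (norm (z - y))\<^sup>2" by (intro mult_right_mono) auto
    finally show "\<bar>f z - f y - g y \<bullet> (z - y)\<bar> \<le> 3 / r * (norm (z - y))\<^sup>2"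
      using r_pos by (simp add: field_simps)
  qed
qed

end

section \<open>Rotation into graph position\<close>

text \<open>
An orthogonal transformation taking \<open>e\<close> to the last coordinate axis carries the graph over the
hyperplane orthogonal to \<open>e\<close>, together with any gradient of \<open>f\<close>, to a graph over the coordinate
hyperplane.
\<close>
lemma rotate_graph:
  fixes e p :: "real ^ 'n::finite" and f :: "real ^ 'n \<Rightarrow> real"
  assumes e: "norm e = 1" and G: "G = (\<lambda>y. p + y + f y *\<^sub>R e) ` {y. e \<bullet> y = 0 \<and> norm y < \<eta>}"
  obtains \<rho> W f' where "rigid_motion \<rho>" "openin (top_of_set horizontal) W" "\<rho> ` G = graph_over W f'"
    "\<And>g. (\<And>y. e \<bullet> y = 0 \<Longrightarrow> norm y < \<eta> \<Longrightarrow> e \<bullet> g y = 0 \<and>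
             (f has_derivative (\<lambda>h. g y \<bullet> h)) (at y within {y. e \<bullet> y = 0})) \<Longrightarrow>
       \<exists>g'. has_gradient_on f' g' W \<and>
         (continuous_on {y. e \<bullet> y = 0 \<and> norm y < \<eta>} g \<longrightarrow> continuous_on W g') \<and>
         (\<forall>L. L-lipschitz_on {y. e \<bullet> y = 0 \<and> norm y < \<eta>} g \<longrightarrow> L-lipschitz_on W g')"
proof -
  let ?a = "axis last_coord 1 :: real ^ 'n"
  define D where "D = {y. e \<bullet> y = 0 \<and> norm y < \<eta>}"
  obtain Q where Q: "orthogonal_transformation Q" "Q e = ?a"
    using orthogonal_transformation_exists[of e ?a] e by auto
  define R where "R = inv Q"
  have R: "orthogonal_transformation R" unfolding R_def using Q(1) by (rule orthogonal_transformation_inv)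
  have bij: "bij Q" using Q(1) by (rule orthogonal_transformation_bij)
  have QR: "Q (R y) = y" "R (Q y) = y" for y
    using bij by (simp_all add: R_def bij_is_surj surj_f_inv_f bij_is_inj)
  have lin: "linear Q" "linear R" using Q(1) R by (auto simp: orthogonal_transformation_def)
  have nQ: "norm (Q x) = norm x" "norm (R x) = norm x" for x
    using orthogonal_transformation_norm Q(1) R by blast+
  have ip: "Q x \<bullet> Q y = x \<bullet> y" for x y using Q(1) by (simp add: orthogonal_transformation_def)
  have aQ: "?a \<bullet> Q y = e \<bullet> y" for y using ip[of e y] Q(2) by simp
  have eR: "e \<bullet> R w = ?a \<bullet> w" for w using aQ[of "R w"] QR by simp
  define W where "W = {w. ?a \<bullet> w = 0 \<and> norm w < \<eta>}"
  have RW: "R w \<in> D" if "w \<in> W" for w using that by (simp add: D_def W_def eR nQ)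
  have WQ: "W = Q ` D"
  proof
    show "W \<subseteq> Q ` D" using RW QR by (metis image_eqI subsetI)
    show "Q ` D \<subseteq> W" by (auto simp: D_def W_def aQ nQ)
  qed
  define f' where "f' w = f (R w)" for w
  show thesis
  proof
    have "(\<lambda>x. Q (x - p)) = (\<lambda>x. - Q p + Q x)" using lin by (simp add: linear_diff)
    then show "rigid_motion (\<lambda>x. Q (x - p))" unfolding rigid_motion_def using Q(1) by blast
    show "openin (top_of_set horizontal) W"
      unfolding W_def horizontal_eq_orthogonal by (rule openin_disk)
    have "Q (p + y + f y *\<^sub>R e - p) = Q y + f' (Q y) *\<^sub>R ?a" for y
    proof -
      have "p + y + f y *\<^sub>R e - p = y + f y *\<^sub>R e" by simp
      then show ?thesis using lin Q(2) by (simp only: linear_add linear_cmul f'_def QR)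
    qed
    then show "(\<lambda>x. Q (x - p)) ` G = graph_over W f'"
      unfolding G graph_over_def WQ image_image D_def[symmetric] by (simp only:)
    fix g assume g: "\<And>y. e \<bullet> y = 0 \<Longrightarrow> norm y < \<eta> \<Longrightarrow> e \<bullet> g y = 0 \<and>
             (f has_derivative (\<lambda>h. g y \<bullet> h)) (at y within {y. e \<bullet> y = 0})"
    define g' where "g' w = Q (g (R w))" for w
    have "has_gradient_on f' g' W"
      unfolding has_gradient_on_def
    proof (intro ballI conjI)
      fix w assume w: "w \<in> W"
      then have gw: "e \<bullet> g (R w) = 0" "(f has_derivative (\<lambda>h. g (R w) \<bullet> h)) (at (R w) within {y. e \<bullet> y = 0})"
        using g[of "R w"] RW[OF w] by (auto simp: D_def)
      show "g' w \<in> horizontal" using gw(1) by (simp add: g'_def horizontal_eq_orthogonal aQ)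
      have "(R has_derivative R) (at w within horizontal)"
        using lin(2) by (intro linear_imp_has_derivative)
      moreover have "(f has_derivative (\<lambda>h. g (R w) \<bullet> h)) (at (R w) within R ` horizontal)"
        by (rule has_derivative_subset[OF gw(2)]) (auto simp: horizontal_eq_orthogonal eR)
      ultimately have "((\<lambda>x. f (R x)) has_derivative (\<lambda>h. g (R w) \<bullet> R h)) (at w within horizontal)"
        by (rule has_derivative_in_compose)
      moreover have "g (R w) \<bullet> R h = g' w \<bullet> h" for h
        using ip[of "g (R w)" "R h"] QR by (simp add: g'_def)
      ultimately show "(f' has_derivative (\<lambda>h. g' w \<bullet> h)) (at w within horizontal)"
        by (simp add: f'_def[abs_def])
    qed
    moreover have "continuous_on W g'" if "continuous_on D g"
      unfolding g'_def using RW lin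
      by (intro continuous_on_compose2[OF linear_continuous_on[of Q UNIV]]
          continuous_on_compose2[OF that] linear_continuous_on) (auto simp: linear_conv_bounded_linear)
    moreover have "L-lipschitz_on W g'" if L: "L-lipschitz_on D g" for L
    proof (rule lipschitz_onI)
      fix w v assume "w \<in> W" "v \<in> W"
      then have "dist (g (R w)) (g (R v)) \<le> L * dist (R w) (R v)" using lipschitz_onD[OF L] RW by blast
      moreover have "dist (Q x) (Q y) = dist x y" "dist (R x) (R y) = dist x y" for x y
        using nQ by (simp_all add: dist_norm linear_diff[OF lin(1), symmetric] linear_diff[OF lin(2), symmetric])
      ultimately show "dist (g' w) (g' v) \<le> L * dist w v" by (simp add: g'_def)
    qed (rule lipschitz_on_nonneg[OF L])
    ultimately show "\<exists>g'. has_gradient_on f' g' W \<and>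
         (continuous_on {y. e \<bullet> y = 0 \<and> norm y < \<eta>} g \<longrightarrow> continuous_on W g') \<and>
         (\<forall>L. L-lipschitz_on {y. e \<bullet> y = 0 \<and> norm y < \<eta>} g \<longrightarrow> L-lipschitz_on W g')"
      unfolding D_def by blast
  qed
qed

lemma has_gradient_on_continuous:
  fixes W :: "(real ^ 'n::finite) set"
  assumes "has_gradient_on f g W" "W \<subseteq> horizontal"
  shows "continuous_on W f"
  unfolding continuous_on_eq_continuous_within
proof
  fix w assume "w \<in> W"
  then have "(f has_derivative (\<lambda>h. g w \<bullet> h)) (at w within horizontal)"
    using assms(1) by (simp add: has_gradient_on_def)
  from has_derivative_continuous[OF this] show "continuous (at w within W) f"
    using assms(2) by (rule continuous_within_subset)
qed

lemma hypersurface_of_locally_graph: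
  fixes X :: "(real ^ 'n::finite) set"
  assumes "locally_graph C1_fun_on X"
  shows "hypersurface X"
  unfolding hypersurface_def
proof
  let ?a = "axis last_coord 1 :: real ^ 'n"
  have a: "norm ?a = 1" by simp
  fix p assume p: "p \<in> X"
  from assms[unfolded locally_graph_def, rule_format, OF p]
  obtain U \<rho> W f where U: "open U" "p \<in> U" and \<rho>: "rigid_motion \<rho>"
      and W: "openin (top_of_set horizontal) W" "C1_fun_on W f" and G: "\<rho> ` (X \<inter> U) = graph_over W f"
    by blast
  obtain c Q where Q: "orthogonal_transformation Q" and \<rho>_eq: "\<rho> = (\<lambda>x. c + Q x)"
    using \<rho> unfolding rigid_motion_def by blast
  define R where "R = inv Q"
  have R: "orthogonal_transformation R" unfolding R_def using Q(1) by (rule orthogonal_transformation_inv)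
  have bij: "bij Q" using Q(1) by (rule orthogonal_transformation_bij)
  have QR: "Q (R y) = y" "R (Q y) = y" for y
    using bij by (simp_all add: R_def bij_is_surj surj_f_inv_f bij_is_inj)
  have bl: "bounded_linear Q" "bounded_linear R"
    using Q R by (simp_all add: orthogonal_transformation_def linear_conv_bounded_linear)
  have WH: "W \<subseteq> horizontal" using W(1) openin_imp_subset by blast
  then have sW: "shadow ?a (w + f w *\<^sub>R ?a) = w" if "w \<in> W" for w
    using that by (intro shadow_orthogonal[OF a]) (auto simp: horizontal_eq_orthogonal)
  have cf: "continuous_on W f" using W(2) has_gradient_on_continuous WH unfolding C1_fun_on_def by blast
  have "homeomorphism (X \<inter> U) W (\<lambda>x. shadow ?a (\<rho> x)) (\<lambda>w. R (w + f w *\<^sub>R ?a - c))"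
  proof (rule homeomorphismI)
    show "continuous_on (X \<inter> U) (\<lambda>x. shadow ?a (\<rho> x))"
      unfolding \<rho>_eq by (intro continuous_intros bounded_linear.continuous_on[OF bl(1)])
    show "continuous_on W (\<lambda>w. R (w + f w *\<^sub>R ?a - c))"
      by (intro continuous_intros bounded_linear.continuous_on[OF bl(2)] cf)
    have up: "\<exists>w\<in>W. \<rho> x = w + f w *\<^sub>R ?a" if "x \<in> X \<inter> U" for x
      using that G unfolding graph_over_def by blast
    have R\<rho>: "R (\<rho> x - c) = x" for x by (simp add: \<rho>_eq QR)
    show "(\<lambda>x. shadow ?a (\<rho> x)) ` (X \<inter> U) \<subseteq> W" using up sW by force
    have down: "R (w + f w *\<^sub>R ?a - c) \<in> X \<inter> U \<and> \<rho> (R (w + f w *\<^sub>R ?a - c)) = w + f w *\<^sub>R ?a" if "w \<in> W" for w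
    proof -
      have "w + f w *\<^sub>R ?a \<in> \<rho> ` (X \<inter> U)" using that unfolding G graph_over_def by blast
      then obtain x where "x \<in> X \<inter> U" "\<rho> x = w + f w *\<^sub>R ?a" by force
      then show ?thesis using R\<rho>[of x] by simp
    qed
    show "(\<lambda>w. R (w + f w *\<^sub>R ?a - c)) ` W \<subseteq> X \<inter> U" using down by blast
    show "R (shadow ?a (\<rho> x) + f (shadow ?a (\<rho> x)) *\<^sub>R ?a - c) = x" if "x \<in> X \<inter> U" for x
      using up[OF that] sW R\<rho>[of x] by auto
    show "shadow ?a (\<rho> (R (w + f w *\<^sub>R ?a - c))) = w" if "w \<in> W" for w
      using down[OF that] sW[OF that] by simp
  qed
  then show "\<exists>U W. p \<in> U \<and> openin (top_of_set X) U \<and>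
        openin (top_of_set (horizontal :: (real ^ 'n) set)) W \<and> U homeomorphic W"
    using p U W(1) by (intro exI[of _ "X \<inter> U"] exI[of _ W]) (auto simp: homeomorphic_def)
qed

text \<open>
As \<open>\<tau>\<close> tends to \<open>0\<close>, the right-hand side tends to \<open>3 / 2\<close>.
\<close>
lemma sheet_angle:
  fixes m :: real
  assumes "m < 3 / 2"
  shows "\<exists>\<tau>. 0 < \<tau> \<and> \<tau> \<le> 1 / 2 \<and> m < (1 / 2 + (1 - \<tau>) ^ d) * (1 - \<tau>) ^ d"
proof -
  have "((\<lambda>\<tau>. (1 / 2 + (1 - \<tau>) ^ d) * (1 - \<tau>) ^ d) \<longlongrightarrow> (1 / 2 + (1 - 0) ^ d) * (1 - 0) ^ d) (at_right (0::real))"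
    by (intro tendsto_intros)
  then have "\<forall>\<^sub>F \<tau> in at_right 0. m < (1 / 2 + (1 - \<tau>) ^ d) * (1 - \<tau>) ^ d"
    using assms by (intro order_tendstoD(1)) auto
  then obtain b where b: "0 < b" "\<And>\<tau>. 0 < \<tau> \<Longrightarrow> \<tau> < b \<Longrightarrow> m < (1 / 2 + (1 - \<tau>) ^ d) * (1 - \<tau>) ^ d"
    unfolding eventually_at_right_field by blast
  then show ?thesis by (intro exI[of _ "min (b / 2) (1 / 2)"]) auto
qed

text \<open>
The slope bound \<open>\<tau>\<close> is fixed first: arbitrary for hypersurfaces, and so small that the density
at a merging point would exceed \<open>m\<close> in the other case.
\<close>
lemma local_C1_graph:
  fixes X :: "(real ^ 'n::finite) set"
  assumes fs: "flat_supported X r" and p: "p \<in> X"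
    and alt: "hypersurface X \<or> (\<exists>m::real. m < 3 / 2 \<and> (\<forall>p\<in>X. multiplicity_at X p \<le> ennreal m))"
  shows "\<exists>U \<rho> W f. open U \<and> p \<in> U \<and> rigid_motion \<rho> \<and> openin (top_of_set horizontal) W \<and>
    C1_fun_on W f \<and> \<rho> ` (X \<inter> U) = graph_over W f \<and>
    ((\<forall>x\<in>X. \<exists>u. supporting_normal X r x u \<and> supporting_normal X r x (- u)) \<longrightarrow> C11_fun_on W f)"
proof -
  interpret flat_supported X r by (rule fs)
  let ?d = "CARD('n) - 1"
  obtain e where e: "supporting_normal X r p e" using supported[OF p] by blast
  have "\<exists>\<tau>. 0 < \<tau> \<and> \<tau> \<le> 1 / 2 \<and> (hypersurface X \<or>
      (\<exists>m. m < (1 / 2 + (1 - \<tau>) ^ ?d) * (1 - \<tau>) ^ ?d \<and> (\<forall>p\<in>X. multiplicity_at X p \<le> ennreal m)))"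
    using alt
  proof
    assume "hypersurface X"
    then show ?thesis by (intro exI[of _ "1 / 2"]) simp
  next
    assume "\<exists>m::real. m < 3 / 2 \<and> (\<forall>p\<in>X. multiplicity_at X p \<le> ennreal m)"
    then show ?thesis using sheet_angle by blast
  qed
  then obtain \<tau> where \<tau>: "0 < \<tau>" "\<tau> \<le> 1 / 2" and alt': "hypersurface X \<or>
      (\<exists>m. m < (1 / 2 + (1 - \<tau>) ^ ?d) * (1 - \<tau>) ^ ?d \<and> (\<forall>p\<in>X. multiplicity_at X p \<le> ennreal m))"
    by blast
  obtain \<rho> where ah: "almost_horizontal X e p \<rho> \<tau>" and \<rho>: "0 < \<rho>" "4 * \<rho> \<le> r"
    and normals: "\<And>x v. x \<in> X \<inter> cball p \<rho> \<Longrightarrow> supporting_normal X r x v \<Longrightarrow>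
        norm (v - e) < \<tau> / 2 \<or> norm (v + e) < \<tau> / 2"
    using almost_horizontal_near[OF p e \<tau>] by blast
  interpret almost_horizontal X e p \<rho> \<tau> by (rule ah)
  obtain \<eta> where \<eta>: "0 < \<eta>" "2 * \<eta> \<le> \<rho>"
      "\<And>y. y \<in> disk \<eta> \<Longrightarrow> \<exists>h. p + y + h *\<^sub>R e \<in> X \<inter> cball p \<rho>"
    using fibers_nonempty by auto
  have sheets: "almost_horizontal_sheets X e p \<rho> \<tau> \<eta>"
    by unfold_locales (use \<eta> in auto)
  have "\<exists>\<eta>'>0. \<eta>' \<le> \<eta> \<and> (\<forall>y. e \<bullet> y = 0 \<longrightarrow> norm y < \<eta>' \<longrightarrow> upper y = lower y)"
    using alt'
  proof
    assume "hypersurface X"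
    then show ?thesis by (rule single_sheet_of_hypersurface[OF sheets])
  next
    assume "\<exists>m. m < (1 / 2 + (1 - \<tau>) ^ ?d) * (1 - \<tau>) ^ ?d \<and> (\<forall>p\<in>X. multiplicity_at X p \<le> ennreal m)"
    then have "\<forall>y. e \<bullet> y = 0 \<longrightarrow> norm y < \<eta> / 4 \<longrightarrow> upper y = lower y"
      using single_sheet_of_multiplicity[OF sheets] by blast
    then show ?thesis using \<eta>(1) by (intro exI[of _ "\<eta> / 4"]) auto
  qed
  then obtain \<theta> where \<theta>: "0 < \<theta>" "\<theta> \<le> \<eta>" "\<And>y. y \<in> disk \<theta> \<Longrightarrow> upper y = lower y" by auto
  have sub: "disk \<theta> \<subseteq> disk \<eta>" "disk (\<theta> / 3) \<subseteq> disk \<theta>" using \<theta> by auto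
  define pt where "pt y = p + y + upper y *\<^sub>R e" for y
  have ptK: "pt y \<in> X \<inter> cball p \<rho>" if "y \<in> disk \<theta>" for y
    using upper_lower_in(1)[OF \<eta>(3)] that sub by (auto simp: pt_def)
  have "continuous_on (disk \<theta>) upper"
    using \<eta> by (intro continuous_on_subset[OF upper_height_continuous[OF \<eta>(2)] sub(1)]) auto
  moreover have "norm (v - e) < 1 / 4 \<or> norm (v + e) < 1 / 4"
    if "y \<in> disk \<theta>" "supporting_normal X r (pt y) v" for y v
    using normals[OF ptK[OF that(1)] that(2)] \<tau> by auto
  ultimately obtain g where g: "\<And>y. y \<in> disk \<theta> \<Longrightarrow> e \<bullet> g y = 0"
    "\<And>y. y \<in> disk \<theta> \<Longrightarrow> (upper has_derivative (\<lambda>h. g y \<bullet> h)) (at y within {y. e \<bullet> y = 0})"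
    "continuous_on (disk \<theta>) g"
    and quad: "\<And>y z. y \<in> disk \<theta> \<Longrightarrow> z \<in> disk \<theta> \<Longrightarrow>
      (\<And>x. x \<in> X \<Longrightarrow> \<exists>u. supporting_normal X r x u \<and> supporting_normal X r x (- u)) \<Longrightarrow>
      norm (pt z - pt y) \<le> r / 2 \<Longrightarrow> \<bar>upper z - upper y - g y \<bullet> (z - y)\<bar> \<le> 3 / r * (norm (z - y))\<^sup>2"
    using C1_graph[of e \<theta> p upper] almost_horizontal.e[OF ah] ptK unfolding pt_def by blast
  have lip: "(6 * (3 / r))-lipschitz_on (disk (\<theta> / 3)) g"
    if two: "\<forall>x\<in>X. \<exists>u. supporting_normal X r x u \<and> supporting_normal X r x (- u)"
  proof -
    have "(6 * (3 / r))-lipschitz_on {y \<in> {y. e \<bullet> y = 0}. norm y < \<theta> / 3} g"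
    proof (rule lipschitz_of_quadratic_approximation[where f = upper])
      fix y z assume yz: "y \<in> {y. e \<bullet> y = 0}" "norm y < \<theta>" "z \<in> {y. e \<bullet> y = 0}" "norm z < \<theta>"
      have "norm (pt y - p) \<le> \<rho>" "norm (pt z - p) \<le> \<rho>"
        using ptK[of y] ptK[of z] yz by (auto simp: dist_norm norm_minus_commute)
      then have "norm (pt z - pt y) \<le> r / 2"
        using norm_triangle_ineq4[of "pt z - p" "pt y - p"] \<rho>(2) by simp
      then show "\<bar>upper z - upper y - g y \<bullet> (z - y)\<bar> \<le> 3 / r * (norm (z - y))\<^sup>2"
        using quad two yz by auto
    qed (use g(1) r_pos subspace_hyperplane in auto)
    then show ?thesis by simp
  qed
  define U where "U = {x. norm (shadow e (x - p)) < \<theta> / 3} \<inter> ball p \<rho>"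
  have "open U" unfolding U_def
    by (intro open_Int open_ball open_Collect_less continuous_intros)
  moreover have "p \<in> U" using \<theta>(1) \<rho>(1) by (simp add: U_def shadow_def)
  moreover have G: "X \<inter> U = (\<lambda>y. p + y + upper y *\<^sub>R e) ` disk (\<theta> / 3)"
    unfolding U_def
  proof (rule graph_of_single_sheet)
    show "2 * (\<theta> / 3) \<le> \<rho>" using \<theta>(1,2) \<eta>(2) by simp
    show "\<exists>h. p + y + h *\<^sub>R e \<in> X \<inter> cball p \<rho>" if "y \<in> disk (\<theta> / 3)" for y
      using \<eta>(3) sub that by blast
    show "upper y = lower y" if "y \<in> disk (\<theta> / 3)" for y
      using \<theta>(3) sub that by blast
  qed
  moreover obtain \<sigma> W f' where \<sigma>: "rigid_motion \<sigma>" "openin (top_of_set horizontal) W"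
    "\<sigma> ` (X \<inter> U) = graph_over W f'"
    and grad: "\<And>g. (\<And>y. e \<bullet> y = 0 \<Longrightarrow> norm y < \<theta> / 3 \<Longrightarrow> e \<bullet> g y = 0 \<and>
             (upper has_derivative (\<lambda>h. g y \<bullet> h)) (at y within {y. e \<bullet> y = 0})) \<Longrightarrow>
       \<exists>g'. has_gradient_on f' g' W \<and> (continuous_on (disk (\<theta> / 3)) g \<longrightarrow> continuous_on W g') \<and>
         (\<forall>L. L-lipschitz_on (disk (\<theta> / 3)) g \<longrightarrow> L-lipschitz_on W g')"
    using rotate_graph[OF almost_horizontal.e[OF ah] G] by blast
  moreover obtain g' where g': "has_gradient_on f' g' W"
      "continuous_on (disk (\<theta> / 3)) g \<longrightarrow> continuous_on W g'"
      "\<And>L. L-lipschitz_on (disk (\<theta> / 3)) g \<Longrightarrow> L-lipschitz_on W g'"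
    using grad[of g] g(1,2) \<theta>(1) by auto
  have "continuous_on W g'" using g'(2) continuous_on_subset[OF g(3) sub(2)] by blast
  then have "C1_fun_on W f'" using g'(1) unfolding C1_fun_on_def by blast
  moreover have "C11_fun_on W f'" if "\<forall>x\<in>X. \<exists>u. supporting_normal X r x u \<and> supporting_normal X r x (- u)"
    using g'(1) g'(3)[OF lip[OF that]] unfolding C11_fun_on_def by blast
  ultimately show ?thesis using \<sigma> by blast
qed

theorem theorem1p2:
  fixes X :: "(real ^ 'n::finite) set"
  assumes "locally_closed X"
    and "flat_tangent_cones X"
    and "positive_support X"
    and "hypersurface X \<or> (\<exists>m::real. m < 3 / 2 \<and> (\<forall>p\<in>X. multiplicity_at X p \<le> ennreal m))"
  shows "C1_hypersurface X \<and> (double_positive_support X \<longrightarrow> C11_hypersurface X)"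
proof -
  obtain r where r: "0 < r" "\<forall>p\<in>X. \<exists>c. p \<in> cball c r \<and> interior (cball c r) \<inter> X = {}"
    using assms(3) unfolding positive_support_def by blast
  have fs: "flat_supported X r"
    using assms(1,2) r supporting_normal_of_ball[of r] by unfold_locales blast+
  have graph: "locally_graph C1_fun_on X"
    unfolding locally_graph_def
  proof
    fix p assume "p \<in> X"
    from local_C1_graph[OF fs this assms(4)]
    show "\<exists>U \<rho> W f. open U \<and> p \<in> U \<and> rigid_motion \<rho> \<and> openin (top_of_set horizontal) W \<and>
        C1_fun_on W f \<and> \<rho> ` (X \<inter> U) = graph_over W f"
      by (elim exE conjE) (intro exI conjI)
  qed
  then have hyp: "hypersurface X" by (rule hypersurface_of_locally_graph)
  have "locally_graph C11_fun_on X" if dbl: "double_positive_support X"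
  proof -
    obtain r where r: "0 < r" and balls: "\<And>p. p \<in> X \<Longrightarrow> \<exists>c c'.
        p \<in> cball c r \<and> interior (cball c r) \<inter> X = {} \<and>
        p \<in> cball c' r \<and> interior (cball c' r) \<inter> X = {} \<and>
        interior (cball c r) \<inter> interior (cball c' r) = {}"
      using dbl unfolding double_positive_support_def by blast
    interpret flat_supported X r
    proof
      show "\<exists>u. supporting_normal X r p u" if "p \<in> X" for p
        using balls[OF that] supporting_normal_of_ball[OF r that] by blast
    qed (rule r assms)+
    have two: "\<exists>u. supporting_normal X r p u \<and> supporting_normal X r p (- u)" if p: "p \<in> X" for p
    proof -
      obtain c c' where c: "p \<in> cball c r" "interior (cball c r) \<inter> X = {}"
        "p \<in> cball c' r" "interior (cball c' r) \<inter> X = {}" "ball c r \<inter> ball c' r = {}"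
        using balls[OF p] by (auto simp: interior_cball)
      let ?u = "(c - p) /\<^sub>R r" and ?u' = "(c' - p) /\<^sub>R r"
      have u: "supporting_normal X r p ?u" "supporting_normal X r p ?u'"
        using supporting_normal_of_ball[OF r p] c by blast+
      have "c \<in> ball c r" using r by simp
      then have "c \<noteq> c'" using c(5) by blast
      then have "?u' \<noteq> ?u" using r by simp
      then have "?u' = - ?u" using supporting_normal_unique[OF p u] by blast
      then show ?thesis using u by metis
    qed
    show ?thesis
      unfolding locally_graph_def
    proof
      fix p assume "p \<in> X"
      from local_C1_graph[OF flat_supported_axioms this assms(4)] two
      show "\<exists>U \<rho> W f. open U \<and> p \<in> U \<and> rigid_motion \<rho> \<and> openin (top_of_set horizontal) W \<and>
          C11_fun_on W f \<and> \<rho> ` (X \<inter> U) = graph_over W f"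
        by (elim exE conjE) (intro exI conjI, auto)
    qed
  qed
  then show ?thesis using graph hyp unfolding C1_hypersurface_def C11_hypersurface_def by blast
qed

end
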